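(* Let $N\ge1$ and $1<p<2$. For $q$ sufficiently large let $u_q\in\mathcal C$ be the nonconstant solution of $$-\Delta_p u+u^{p-1}=u^{q-1}\ \text{ in }B,\qquad u>0\ \text{ in }B,\qquad \partial_\nu u=0\ \text{ on }\partial B \qquad (P_q)$$ with $I_q(u_q)=\inf_{u\in\mathcal N_q}I_q(u)$ described in the context. Then for every sufficiently large $q$ there exists another nonconstant solution $v_q\in\mathcal C$ of $(P_q)$, distinct from $u_q$.
   Context: $B$ is the open unit ball of $\mathbb R^N$, $\nu$ (in $\partial_\nu$) is its outer unit normal, $\Delta_p u=\mathrm{div}(|\nabla u|^{p-2}\nabla u)$, and solutions are weak solutions in $W^{1,p}(B)$. Norm: $\|u\|_{W^{1,p}(B)}^p=\int_B(|\nabla u|^p+|u|^p)\,dx$. Cone: $\mathcal C:=\{u\in W^{1,p}_{\mathrm{rad}}(B): u\ge 0,\ u(r_1)\le u(r_2)\text{ for all }0<r_1\le r_2\le 1\}$, where $W^{1,p}_{\mathrm{rad}}(B)$ is the subspace of radial functions and $u(|x|):=u(x)$ (radial functions are taken continuous on $(0,1]$, and $u(0):=\lim_{r\to0^+}u(r)$). Truncated nonlinearity: $p^*:=Np/(N-p)$ if $N>p$ and $p^*:=+\infty$ otherwise; $\ell\in(p,p^* )$ is fixed. There is a constant $C(N,p)$, fixed once and for all, with $\|u\|_{L^\infty(B)}\le C(N,p)\|u\|_{W^{1,p}(B)}$ for all $u\in\mathcal C$. Put $p'=p/(p-1)$ and $s_0:=\max\{2+(p')^{1/p},\ C(N,p)(1+|B|^{1/p})\}$.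 For $q>2$ define $f_q(s)=0$ for $s<0$, $f_q(s)=s^{q-1}$ for $s\in[0,s_0]$, and $f_q(s)=s_0^{q-1}+\frac{q-1}{\ell-1}s_0^{q-\ell}(s^{\ell-1}-s_0^{\ell-1})$ for $s>s_0$. Let $F_q(u)=\int_0^u f_q(s)\,ds$. Energy functional on $W^{1,p}(B)$: $I_q(u):=\int_B\left(\frac{|\nabla u|^p}{p}+\frac{|u|^p}{p}-F_q(u)\right)dx$. Nehari-type set: $\mathcal N_q:=\left\{u\in\mathcal C\setminus\{0\}:\int_B(|\nabla u|^p+|u|^p)\,dx=\int_B f_q(u)u\,dx\right\}$. The solution $u_q$: for $q$ sufficiently large there exists a nonconstant solution $u_q\in\mathcal C$ of $(P_q)$ with $I_q(u_q)=\inf_{\mathcal N_q}I_q$; moreover $I_q(u_q)<I_q(1)$ for $q$ large, and as $q\to\infty$ one has $u_q\to G$ in $W^{1,p}(B)\cap C^{0,\nu}(\bar B)$ for any $\nu\in(0,1)$, where $G$ is the unique solution of $-\Delta_pG+|G|^{p-2}G=0$ in $B$, $G=1$ on $\partial B$. A family $(u_q)$ of such solutions is fixed. *)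

theory Defs
  imports "HOL-Probability.Essential_Supremum" "HOL-Analysis.Analysis"
begin

section \<open>Sobolev spaces on the unit ball\<close>

text \<open>The space \<open>\<real>\<^sup>N\<close> is an arbitrary Euclidean space \<open>'a\<close> with \<open>N = DIM('a)\<close>. Functions on the ball (or the
  closed ball) are total functions whose values elsewhere are irrelevant.\<close>

abbreviation ball_leb :: "'a::euclidean_space measure" where
  "ball_leb \<equiv> lebesgue_on (ball 0 1)"

primrec Ck_fun :: "nat \<Rightarrow> ('a::euclidean_space \<Rightarrow> real) \<Rightarrow> bool" where
  "Ck_fun 0 \<phi> \<longleftrightarrow> continuous_on UNIV \<phi>"
| "Ck_fun (Suc k) \<phi> \<longleftrightarrow> \<phi> differentiable_on UNIV \<and>
     (\<forall>i\<in>Basis. Ck_fun k (\<lambda>x. frechet_derivative \<phi> (at x) i))"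

definition test_functions :: "('a::euclidean_space \<Rightarrow> real) set" where
  "test_functions = {\<phi>. (\<forall>k. Ck_fun k \<phi>) \<and>
     compact (closure {x. \<phi> x \<noteq> 0}) \<and> closure {x. \<phi> x \<noteq> 0} \<subseteq> ball 0 1}"

definition is_weak_gradient :: "('a::euclidean_space \<Rightarrow> real) \<Rightarrow> ('a \<Rightarrow> 'a) \<Rightarrow> bool" where
  "is_weak_gradient u g \<longleftrightarrow>
     (\<forall>K. compact K \<and> K \<subseteq> ball 0 1 \<longrightarrow> u absolutely_integrable_on K \<and> g absolutely_integrable_on K) \<and>
     (\<forall>\<phi>\<in>test_functions. \<forall>i\<in>Basis.
        (LINT x|ball_leb. u x * frechet_derivative \<phi> (at x) i) = - (LINT x|ball_leb. (g x \<bullet> i) * \<phi> x))"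

text \<open>A choice of weak gradient; whenever one exists it is unique up to null sets of the ball.\<close>

definition wgrad :: "('a::euclidean_space \<Rightarrow> real) \<Rightarrow> 'a \<Rightarrow> 'a" where
  "wgrad u = (SOME g. is_weak_gradient u g)"

definition W1p :: "real \<Rightarrow> ('a::euclidean_space \<Rightarrow> real) set" where
  "W1p p = {u. u \<in> borel_measurable ball_leb \<and> integrable ball_leb (\<lambda>x. \<bar>u x\<bar> powr p) \<and>
     (\<exists>g. is_weak_gradient u g \<and> integrable ball_leb (\<lambda>x. norm (g x) powr p))}"

definition W1p_norm :: "real \<Rightarrow> ('a::euclidean_space \<Rightarrow> real) \<Rightarrow> real" where
  "W1p_norm p u = (LINT x|ball_leb. norm (wgrad u x) powr p + \<bar>u x\<bar> powr p) powr (1 / p)"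

definition W1p_zero :: "real \<Rightarrow> ('a::euclidean_space \<Rightarrow> real) set" where
  "W1p_zero p = {u \<in> W1p p. \<forall>\<epsilon>>0. \<exists>\<phi>\<in>test_functions. W1p_norm p (\<lambda>x. u x - \<phi> x) < \<epsilon>}"

definition Linf_norm :: "('a::euclidean_space \<Rightarrow> real) \<Rightarrow> ereal" where
  "Linf_norm u = esssup ball_leb (\<lambda>x. ereal \<bar>u x\<bar>)"

text \<open>The norm of \<open>C\<^sup>0\<^sup>,\<^sup>\<alpha>\<close> on the closed ball; infinite exactly when the function is not in that space.\<close>

definition holder_norm :: "real \<Rightarrow> ('a::euclidean_space \<Rightarrow> real) \<Rightarrow> ereal" where
  "holder_norm \<alpha> u = (SUP x\<in>cball 0 1. ereal \<bar>u x\<bar>) +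
     (SUP (x, y)\<in>{(x, y). x \<in> cball 0 1 \<and> y \<in> cball 0 1 \<and> x \<noteq> y}.
        ereal (\<bar>u x - u y\<bar> / dist x y powr \<alpha>))"

section \<open>The cone of radially nondecreasing functions\<close>

text \<open>Radial Sobolev functions are represented by their representative that is continuous away from
  the origin, up to and including the boundary.\<close>

definition W1p_rad :: "real \<Rightarrow> ('a::euclidean_space \<Rightarrow> real) set" where
  "W1p_rad p = {u \<in> W1p p. (\<exists>w. continuous_on {0<..1} w \<and>
     (\<forall>x\<in>cball 0 1 - {0}. u x = w (norm x)))}"

text \<open>A nonnegative nondecreasing profile has a limit at \<open>0\<close>; the last condition is the convention that
  this limit is the value at the origin. Elements of the cone are thus continuous on the closed
  ball, and almost everywhere equality of two of them on the ball is pointwise equality there.\<close>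

definition rad_cone :: "real \<Rightarrow> ('a::euclidean_space \<Rightarrow> real) set" where
  "rad_cone p = {u \<in> W1p_rad p. (\<forall>x\<in>cball 0 1. 0 \<le> u x) \<and>
     (\<forall>x y. 0 < norm x \<and> norm x \<le> norm y \<and> norm y \<le> 1 \<longrightarrow> u x \<le> u y) \<and>
     (u \<longlongrightarrow> u 0) (at 0)}"

definition nonconstant :: "('a::euclidean_space \<Rightarrow> real) \<Rightarrow> bool" where
  "nonconstant u \<longleftrightarrow> \<not> (\<exists>c. \<forall>x\<in>ball 0 1. u x = c)"

section \<open>Equations\<close>

text \<open>Weak solutions: the Neumann condition is encoded by testing with all of \<open>W\<^sup>1\<^sup>,\<^sup>p\<close>. For
  \<open>p < 2\<close> the field \<open>|\<nabla>u|\<^sup>p\<^sup>-\<^sup>2 \<nabla>u\<close> is read as \<open>0\<close> where \<open>\<nabla>u = 0\<close>. As \<open>q\<close> may be supercritical,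
  integrability of \<open>u\<^sup>q\<^sup>-\<^sup>1 \<phi>\<close> is required explicitly; it is automatic for bounded \<open>u\<close>.\<close>

definition solves_P :: "real \<Rightarrow> real \<Rightarrow> ('a::euclidean_space \<Rightarrow> real) \<Rightarrow> bool" where
  "solves_P p q u \<longleftrightarrow> u \<in> W1p p \<and> (\<forall>x\<in>ball 0 1. 0 < u x) \<and>
     (\<forall>\<phi>\<in>W1p p. integrable ball_leb (\<lambda>x. u x powr (q - 1) * \<phi> x) \<and>
        (LINT x|ball_leb. norm (wgrad u x) powr (p - 2) * (wgrad u x \<bullet> wgrad \<phi> x)
                          + u x powr (p - 1) * \<phi> x)
        = (LINT x|ball_leb. u x powr (q - 1) * \<phi> x))"

text \<open>The problem \<open>-\<Delta>\<^sub>p G + |G|\<^sup>p\<^sup>-\<^sup>2 G = 0\<close> in the ball with \<open>G = 1\<close> on the boundary.\<close>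

definition solves_Dirichlet :: "real \<Rightarrow> ('a::euclidean_space \<Rightarrow> real) \<Rightarrow> bool" where
  "solves_Dirichlet p G \<longleftrightarrow> G \<in> W1p p \<and> (\<lambda>x. G x - 1) \<in> W1p_zero p \<and>
     (\<forall>\<phi>\<in>W1p_zero p.
        (LINT x|ball_leb. norm (wgrad G x) powr (p - 2) * (wgrad G x \<bullet> wgrad \<phi> x)
                          + \<bar>G x\<bar> powr (p - 2) * G x * \<phi> x) = 0)"

section \<open>Truncated energy and Nehari set\<close>

definition p_star :: "nat \<Rightarrow> real \<Rightarrow> ereal" where
  "p_star N p = (if real N > p then ereal (real N * p / (real N - p)) else \<infinity>)"

definition trunc_level :: "'a::euclidean_space itself \<Rightarrow> real \<Rightarrow> real \<Rightarrow> real" where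
  "trunc_level _ p C = max (2 + (p / (p - 1)) powr (1 / p))
     (C * (1 + measure lebesgue (ball (0::'a) 1) powr (1 / p)))"

definition trunc_nl :: "real \<Rightarrow> real \<Rightarrow> real \<Rightarrow> real \<Rightarrow> real" where
  "trunc_nl l s0 q s =
     (if s < 0 then 0
      else if s \<le> s0 then s powr (q - 1)
      else s0 powr (q - 1)
           + (q - 1) / (l - 1) * s0 powr (q - l) * (s powr (l - 1) - s0 powr (l - 1)))"

definition trunc_prim :: "real \<Rightarrow> real \<Rightarrow> real \<Rightarrow> real \<Rightarrow> real" where
  "trunc_prim l s0 q t = (LBINT s=ereal 0..ereal t. trunc_nl l s0 q s)"

definition energy ::
  "real \<Rightarrow> real \<Rightarrow> real \<Rightarrow> real \<Rightarrow> ('a::euclidean_space \<Rightarrow> real) \<Rightarrow> real" where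
  "energy p l C q u = (LINT x|ball_leb. norm (wgrad u x) powr p / p + \<bar>u x\<bar> powr p / p
     - trunc_prim l (trunc_level TYPE('a) p C) q (u x))"

definition nehari ::
  "real \<Rightarrow> real \<Rightarrow> real \<Rightarrow> real \<Rightarrow> ('a::euclidean_space \<Rightarrow> real) set" where
  "nehari p l C q = {u \<in> rad_cone p. (\<exists>x\<in>ball 0 1. u x \<noteq> 0) \<and>
     (LINT x|ball_leb. norm (wgrad u x) powr p + \<bar>u x\<bar> powr p)
     = (LINT x|ball_leb. trunc_nl l (trunc_level TYPE('a) p C) q (u x) * u x)}"

end

theory Submission
  imports Defs "HOL-Computational_Algebra.Polynomial"
begin

text \<open>Shooting: the radial problem with start value \<open>U 0 = d\<close> and \<open>U' 0 = 0\<close> is well posed because \<open>1/(p - 1) > 1\<close>.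
  Let \<open>m d\<close> be the minimum over \<open>r\<close> of the average of \<open>u powr (p - 1) - u powr (q - 1)\<close> over the ball of
  radius \<open>r\<close>, which has the sign of \<open>U' r\<close>. If \<open>m d = 0\<close>, the minimum is attained at \<open>r = 1\<close> only, so that
  \<open>U\<close> is a nondecreasing Neumann solution. For \<open>d = 1/4\<close>, and also for \<open>d\<close> close to \<open>1\<close>, where \<open>p < 2\<close> makes the
  oscillation around \<open>1\<close> arbitrarily slow, \<open>U\<close> does not exceed \<open>1\<close> and \<open>m d > 0\<close>. For a suitable fixed \<open>d\<close> and
  all large \<open>q\<close>, \<open>U\<close> crosses \<open>1\<close> inside the ball and is reflected almost elastically, so \<open>m d < 0\<close>. Hence there
  are two nonconstant increasing solutions with different values at \<open>0\<close>, and \<open>u\<^sub>q\<close> is at most one of them.\<close>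

section \<open>Smooth functions\<close>

text \<open>Why the average and not the flux: the flux at radius \<open>r\<close> is
  \<open>r / N\<close> times that average and vanishes at \<open>r = 0\<close> for every start
  value, so its minimum is never positive. The average has a positive limit at \<open>0\<close>, so
  the sign of its minimum separates the three cases. Negative fluxes are cut off to
  \<open>0\<close>, which keeps every trajectory nondecreasing even for start values where the true
  one would turn back. When \<open>m d = 0\<close> nothing is cut off. As \<open>m\<close> is
  continuous in \<open>d\<close>, it vanishes on either side of a height where it is negative. The
  other obstacle is the weak formulation: the tests range over all of \<open>W1p\<close>, whose
  elements come without boundary values. The divergence identity is therefore proved for radial
  fields that vanish on the sphere, which is what the Neumann condition provides, against functions
  that merely have an integrable weak gradient. Moreover \<open>wgrad\<close> is an arbitrary choice
  of weak gradient, so computing with an explicit gradient requires uniqueness almost everywhere,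
  and hence a rich supply of test functions.\<close>

lemma frechet_derivative_eqI: "(f has_derivative f') (at x) \<Longrightarrow> frechet_derivative f (at x) = f'"
  by (rule frechet_derivative_at[symmetric])

lemma Ck_fun_frechetI:
  assumes "\<And>x. (f has_derivative D x) (at x)" "\<And>i. i \<in> Basis \<Longrightarrow> Ck_fun k (\<lambda>x. D x i)"
  shows "Ck_fun (Suc k) f"
proof -
  have "f differentiable_on UNIV"
    using assms(1) by (auto simp: differentiable_on_def differentiable_def)
  moreover have "(\<lambda>x. frechet_derivative f (at x) i) = (\<lambda>x. D x i)" for i
    using frechet_derivative_eqI[OF assms(1)] by simp
  ultimately show ?thesis using assms(2) by simp
qed

lemma Ck_fun_Suc_has_derivative:
  "Ck_fun (Suc k) f \<Longrightarrow> (f has_derivative frechet_derivative f (at x)) (at x)"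
  using frechet_derivative_works by (auto simp: differentiable_on_def)

text \<open>Needed because the product and chain rules multiply a derivative by an undifferentiated
  factor, which must be used at the lower order of smoothness.\<close>

lemma Ck_fun_Suc_imp: "Ck_fun (Suc k) f \<Longrightarrow> Ck_fun k f"
proof (induction k arbitrary: f)
  case 0
  then show ?case using differentiable_imp_continuous_on by auto
next
  case (Suc k)
  then have "f differentiable_on UNIV" "\<And>i. i \<in> Basis \<Longrightarrow> Ck_fun k (\<lambda>x. frechet_derivative f (at x) i)"
    unfolding Ck_fun.simps(2)[of "Suc k"] by blast+
  then show ?case by simp
qed

lemma Ck_fun_const: "Ck_fun k (\<lambda>x. c)"
proof (induction k arbitrary: c)
  case (Suc k)
  show ?case by (rule Ck_fun_frechetI[where D="\<lambda>x y. 0"]) (auto intro: Suc)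
qed auto

lemma Ck_fun_inner: "Ck_fun k (\<lambda>x. x \<bullet> i)"
proof (cases k)
  case (Suc k)
  show ?thesis unfolding Suc
    by (rule Ck_fun_frechetI[where D="\<lambda>x y. y \<bullet> i"]) (auto intro!: derivative_eq_intros Ck_fun_const)
qed (auto intro!: continuous_intros)

lemma Ck_fun_add: "Ck_fun k f \<Longrightarrow> Ck_fun k g \<Longrightarrow> Ck_fun k (\<lambda>x. f x + g x)"
proof (induction k arbitrary: f g)
  case (Suc k)
  note D = Suc.prems[THEN Ck_fun_Suc_has_derivative]
  show ?case
  proof (rule Ck_fun_frechetI, rule has_derivative_add[OF D])
    fix i :: 'a assume "i \<in> Basis"
    then show "Ck_fun k (\<lambda>x. frechet_derivative f (at x) i + frechet_derivative g (at x) i)"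
      using Suc.prems by (intro Suc.IH) simp_all
  qed
qed (auto intro!: continuous_intros)

lemma Ck_fun_mult: "Ck_fun k f \<Longrightarrow> Ck_fun k g \<Longrightarrow> Ck_fun k (\<lambda>x. f x * g x)"
proof (induction k arbitrary: f g)
  case (Suc k)
  note D = Suc.prems[THEN Ck_fun_Suc_has_derivative]
  show ?case
  proof (rule Ck_fun_frechetI, rule has_derivative_mult[OF D])
    fix i :: 'a assume "i \<in> Basis"
    then show "Ck_fun k (\<lambda>x. f x * frechet_derivative g (at x) i + frechet_derivative f (at x) i * g x)"
      using Suc.prems Suc.prems[THEN Ck_fun_Suc_imp] by (intro Ck_fun_add Suc.IH) simp_all
  qed
qed (auto intro!: continuous_intros)

lemma Ck_fun_diff:
  assumes "Ck_fun k f" "Ck_fun k g" shows "Ck_fun k (\<lambda>x. f x - g x)"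
  using Ck_fun_add[OF assms(1) Ck_fun_mult[OF Ck_fun_const[of k "-1"] assms(2)]] by simp

lemma Ck_fun_power: "Ck_fun k f \<Longrightarrow> Ck_fun k (\<lambda>x. f x ^ m)"
  by (induction m) (simp_all add: Ck_fun_const Ck_fun_mult)

lemma Ck_fun_sum: "finite A \<Longrightarrow> (\<And>i. i \<in> A \<Longrightarrow> Ck_fun k (f i)) \<Longrightarrow> Ck_fun k (\<lambda>x. \<Sum>i\<in>A. f i x)"
proof (induction A rule: finite_induct)
  case (insert j A)
  have "Ck_fun k (f j)" "Ck_fun k (\<lambda>x. \<Sum>i\<in>A. f i x)" using insert by blast+
  from Ck_fun_add[OF this] show ?case using insert(1,2) by simp
qed (simp add: Ck_fun_const)

lemma Ck_fun_prod: "finite A \<Longrightarrow> (\<And>i. i \<in> A \<Longrightarrow> Ck_fun k (f i)) \<Longrightarrow> Ck_fun k (\<lambda>x. \<Prod>i\<in>A. f i x)"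
proof (induction A rule: finite_induct)
  case (insert j A)
  have "Ck_fun k (f j)" "Ck_fun k (\<lambda>x. \<Prod>i\<in>A. f i x)" using insert by blast+
  from Ck_fun_mult[OF this] show ?case using insert(1,2) by simp
qed (simp add: Ck_fun_const)

lemma Ck_fun_inner_self: "Ck_fun k (\<lambda>x. x \<bullet> x)"
  by (subst euclidean_inner) (intro Ck_fun_sum Ck_fun_mult Ck_fun_inner finite_Basis)

section \<open>Smooth cutoffs built from \<open>exp (- (1 / t))\<close>\<close>

definition flat :: "real poly \<Rightarrow> real \<Rightarrow> real" where
  "flat P t = (if 0 < t then poly P (1 / t) * exp (- (1 / t)) else 0)"

text \<open>With \<open>y = 1 / t\<close>, differentiating \<open>P y * exp (- y)\<close> in
  \<open>t\<close> gives \<open>y^2 * (P y - P' y) * exp (- y)\<close>, so the family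
  \<open>flat\<close> is closed under differentiation.\<close>

definition flat_deriv :: "real poly \<Rightarrow> real poly" where
  "flat_deriv P = [:0, 0, 1:] * (P - pderiv P)"

lemma poly_exp_minus_tendsto_0: "((\<lambda>y. poly P y * exp (- y)) \<longlongrightarrow> (0::real)) at_top"
proof -
  have "((\<lambda>y. coeff P i * (y ^ i / exp y)) \<longlongrightarrow> coeff P i * 0) at_top" for i
    by (intro tendsto_mult tendsto_const tendsto_power_div_exp_0)
  then have "((\<lambda>y. \<Sum>i\<le>degree P. coeff P i * (y ^ i / exp y)) \<longlongrightarrow> (\<Sum>i\<le>degree P. coeff P i * 0)) at_top"
    by (intro tendsto_sum)
  then show ?thesis
    by (simp add: poly_altdef exp_minus sum_distrib_right divide_inverse mult.assoc)
qed

lemma flat_tendsto_0_right: "((\<lambda>t. poly P (1 / t) * exp (- (1 / t))) \<longlongrightarrow> 0) (at_right (0::real))"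
  using filterlim_compose[OF poly_exp_minus_tendsto_0 filterlim_inverse_at_top_right]
  by (simp add: inverse_eq_divide)

lemma flat_has_real_derivative: "(flat P has_real_derivative flat (flat_deriv P) t) (at t)"
proof -
  consider "t < 0" | "t = 0" | "t > 0" by linarith
  then show ?thesis
  proof cases
    case 1
    then have "((\<lambda>t. 0) has_real_derivative flat (flat_deriv P) t) (at t)" by (simp add: flat_def)
    then show ?thesis
      by (rule has_field_derivative_transform_within_open[where S="{..<0}"])
         (use 1 in \<open>auto simp: flat_def\<close>)
  next
    case 3
    have "((\<lambda>t. poly P (1 / t) * exp (- (1 / t))) has_real_derivative flat (flat_deriv P) t) (at t)"
      using 3 by (auto intro!: derivative_eq_intros poly_DERIV[THEN DERIV_chain2]
          simp: flat_def flat_deriv_def field_simps power2_eq_square)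
    then show ?thesis
      by (rule has_field_derivative_transform_within_open[where S="{0<..}"])
         (use 3 in \<open>auto simp: flat_def\<close>)
  next
    case 2
    \<comment> \<open>Dividing by \<open>t\<close> multiplies the polynomial by its own argument, so
      the difference quotient at \<open>0\<close> is again of flat type, with
      \<open>pCons 0 P\<close> for \<open>P\<close>.\<close>
    have "((\<lambda>t. flat P t / t) \<longlongrightarrow> 0) (at_right 0)"
      by (rule Lim_transform_eventually[OF flat_tendsto_0_right[of "pCons 0 P"]])
         (auto simp: flat_def eventually_at_right_less intro: eventually_at_rightI[of 0 1])
    moreover have "((\<lambda>t. flat P t / t) \<longlongrightarrow> 0) (at_left 0)"
      by (rule Lim_transform_eventually[of "\<lambda>_. 0"])
         (auto simp: flat_def intro: eventually_at_leftI[of "-1" 0])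
    ultimately have "((\<lambda>t. flat P t / t) \<longlongrightarrow> 0) (at 0)"
      by (simp add: filterlim_at_split)
    then show ?thesis using 2 by (simp add: has_field_derivative_iff flat_def)
  qed
qed

lemma continuous_on_flat: "continuous_on A (flat P)"
  using flat_has_real_derivative DERIV_isCont continuous_at_imp_continuous_on by blast

text \<open>The induction on the order runs over all polynomials at once, since each derivative
  replaces \<open>P\<close> by \<open>flat_deriv P\<close>.\<close>

lemma Ck_fun_flat: "Ck_fun k f \<Longrightarrow> Ck_fun k (\<lambda>x. flat P (f x))"
proof (induction k arbitrary: f P)
  case 0
  then show ?case using continuous_on_compose2[OF continuous_on_flat[of UNIV P]] by simp
next
  case (Suc k)
  note D = Ck_fun_Suc_has_derivative[OF Suc.prems]
  have "((\<lambda>x. flat P (f x)) has_derivative (\<lambda>y. flat (flat_deriv P) (f x) * frechet_derivative f (at x) y)) (at x)" for x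
    using has_derivative_compose[OF D flat_has_real_derivative[unfolded has_field_derivative_def]] .
  then show ?case
  proof (rule Ck_fun_frechetI)
    fix i :: 'a assume "i \<in> Basis"
    then show "Ck_fun k (\<lambda>x. flat (flat_deriv P) (f x) * frechet_derivative f (at x) i)"
      using Suc.prems Ck_fun_Suc_imp[OF Suc.prems] by (intro Ck_fun_mult Suc.IH) simp_all
  qed
qed

abbreviation bump :: "real \<Rightarrow> real" where
  "bump \<equiv> flat 1"

lemma bump_eq: "bump t = (if 0 < t then exp (- (1 / t)) else 0)"
  by (simp add: flat_def)

lemma bump_bounds: "0 \<le> bump t" "bump t \<le> 1"
  by (auto simp: bump_eq)

lemma bump_eq_0_iff: "bump t = 0 \<longleftrightarrow> t \<le> 0"
  by (auto simp: bump_eq)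

lemma bump_tendsto_indicator: "(\<lambda>n. bump (real n * t)) \<longlonglongrightarrow> (if 0 < t then 1 else 0)"
proof (cases "0 < t")
  case True
  have "(\<lambda>n. exp (- (1 / t * (1 / real n)))) \<longlonglongrightarrow> exp (- (1 / t * 0))"
    by (intro tendsto_intros lim_1_over_n)
  then have "(\<lambda>n. exp (- (1 / (real n * t)))) \<longlonglongrightarrow> 1"
    by (simp add: mult.commute)
  moreover have "\<forall>\<^sub>F n in sequentially. exp (- (1 / (real n * t))) = bump (real n * t)"
    using eventually_gt_at_top[of 0] by eventually_elim (use True in \<open>simp add: bump_eq\<close>)
  ultimately show ?thesis using True by (simp add: tendsto_cong)
next
  case False
  then have "bump (real n * t) = 0" for n
    by (simp add: bump_eq_0_iff mult_nonneg_nonpos)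
  then show ?thesis using False by simp
qed

section \<open>Uniqueness of weak gradients\<close>

lemma test_functionsI:
  assumes "\<And>k. Ck_fun k \<phi>" "compact S" "S \<subseteq> ball 0 1" "\<And>x. x \<notin> S \<Longrightarrow> \<phi> x = 0"
  shows "\<phi> \<in> test_functions"
proof -
  have "{x. \<phi> x \<noteq> 0} \<subseteq> S" using assms(4) by auto
  then have "closure {x. \<phi> x \<noteq> 0} \<subseteq> S"
    using assms(2) by (simp add: closure_minimal compact_imp_closed)
  then show ?thesis
    using assms compact_Int_closed[OF assms(2) closed_closure[of "{x. \<phi> x \<noteq> 0}"]]
    by (auto simp: test_functions_def Int_absorb1)
qed

text \<open>Boxes are stable under intersection and generate the Borel sets, so the integrals over
  all Borel sets vanish for a Borel representative \<open>g\<close>. The sets where \<open>g\<close>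
  is positive or negative then force \<open>g = 0\<close> almost everywhere.\<close>

lemma AE_eq_0_if_box_integrals_eq_0:
  fixes H :: "'a::euclidean_space \<Rightarrow> real"
  assumes H: "integrable lebesgue H"
    and box: "\<And>a b. (LINT x|lebesgue. indicator (box a b) x * H x) = 0"
  shows "AE x in lebesgue. H x = 0"
proof -
  obtain g where g: "g \<in> borel_measurable lborel" "AE x in lborel. H x = g x"
    using completion_ex_borel_measurable_real[of H lborel] borel_measurable_integrable[OF H] by auto
  have Hg: "AE x in lebesgue. H x = g x" using AE_completion[OF g(2)] .
  have g_leb: "g \<in> borel_measurable lebesgue" using g(1) by (rule measurable_completion)
  have "integrable lebesgue g"
    using H Hg integrable_cong_AE[OF borel_measurable_integrable[OF H] g_leb] by simp
  then have g_int: "integrable lborel g"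
    using integrable_completion[OF g(1)] by simp
  have g_box: "(LINT x:box a b|lborel. g x) = 0" for a b :: 'a
  proof -
    have [measurable]: "g \<in> borel_measurable borel" using g(1) by simp
    have "(LINT x|lborel. indicator (box a b) x * g x) = (LINT x|lebesgue. indicator (box a b) x * g x)"
      by (rule integral_completion[symmetric]) measurable
    also have "\<dots> = (LINT x|lebesgue. indicator (box a b) x * H x)"
      by (rule integral_cong_AE)
         (use Hg g_leb borel_measurable_integrable[OF H] in \<open>auto intro!: borel_measurable_times borel_measurable_indicator\<close>)
    finally show ?thesis using box by (simp add: set_lebesgue_integral_def)
  qed
  have g_set: "set_integrable lborel A g" if "A \<in> sets borel" for A
    unfolding set_integrable_def using integrable_mult_indicator[OF _ g_int, of A] that by simp
  \<comment> \<open>Complements in the induction on Borel sets need the integral over the whole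
    space, which is not a box and is reached by growing cubes.\<close>
  have g_total: "(LINT x|lborel. g x) = 0"
  proof -
    let ?B = "\<lambda>n::nat. box (- (real n *\<^sub>R One)) (real n *\<^sub>R One) :: 'a set"
    have "(\<lambda>n. LINT x|lborel. indicator (?B n) x *\<^sub>R g x) \<longlonglongrightarrow> (LINT x|lborel. g x)"
    proof (rule integral_dominated_convergence[where w="\<lambda>x. norm (g x)"])
      show "AE x in lborel. (\<lambda>n. indicator (?B n) x *\<^sub>R g x) \<longlonglongrightarrow> g x"
      proof (rule AE_I2)
        fix x :: 'a
        have "\<forall>\<^sub>F n in sequentially. norm x < real n"
          using filterlim_real_sequentially by (simp add: filterlim_at_top_dense)
        then have "\<forall>\<^sub>F n in sequentially. indicator (?B n) x *\<^sub>R g x = g x"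
        proof eventually_elim
          case (elim n)
          have "\<bar>x \<bullet> i\<bar> < real n" if "i \<in> Basis" for i
            using Basis_le_norm[OF that, of x] elim by simp
          then have "x \<in> ?B n" by (force simp: mem_box abs_less_iff)
          then show ?case by simp
        qed
        then show "(\<lambda>n. indicator (?B n) x *\<^sub>R g x) \<longlonglongrightarrow> g x" by (rule tendsto_eventually)
      qed
    qed (use g(1) g_int in \<open>auto split: split_indicator intro!: borel_measurable_scaleR borel_measurable_indicator\<close>)
    moreover have "(LINT x|lborel. indicator (?B n) x *\<^sub>R g x) = 0" for n
      using g_box by (simp add: set_lebesgue_integral_def)
    ultimately show ?thesis by (simp add: LIMSEQ_const_iff)
  qed
  have g_borel: "(LINT x:A|lborel. g x) = 0" if A: "A \<in> sets borel" for A
  proof -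
    have sets: "sets borel = sigma_sets UNIV (range (\<lambda>(a, b). box a b :: 'a set))"
      by (simp add: borel_eq_box)
    have "Int_stable (range (\<lambda>(a, b). box a b :: 'a set))"
      unfolding Int_stable_def by (auto simp: box_Int_box)
    moreover have "range (\<lambda>(a, b). box a b :: 'a set) \<subseteq> Pow UNIV" by simp
    moreover have "A \<in> sigma_sets UNIV (range (\<lambda>(a, b). box a b))" using A sets by simp
    ultimately show ?thesis
    proof (induction A rule: sigma_sets_induct_disjoint)
      case (compl A)
      then have A: "A \<in> sets borel" by (simp add: sets)
      have "(LINT x:UNIV - A|lborel. g x) = (LINT x|lborel. g x - indicator A x *\<^sub>R g x)"
        unfolding set_lebesgue_integral_def by (intro Bochner_Integration.integral_cong) (auto split: split_indicator)
      also have "\<dots> = 0"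
        using g_int g_set[OF A] g_total compl(2)
        by (subst Bochner_Integration.integral_diff) (auto simp: set_integrable_def set_lebesgue_integral_def)
      finally show ?case .
    next
      case (union A)
      then have A: "A i \<in> sets borel" for i by (auto simp: sets)
      show ?case
        by (subst lebesgue_integral_countable_add)
           (use A union in \<open>auto intro!: g_set simp: disjoint_family_on_def\<close>)
    qed (auto simp: g_box set_lebesgue_integral_def[of _ "{}"])
  qed
  have "AE x in lborel. g x = 0"
  proof -
    have [measurable]: "g \<in> borel_measurable borel" using g(1) by simp
    have "AE x in lborel. indicator {x. 0 < g x} x *\<^sub>R g x = 0"
      using g_borel[of "{x. 0 < g x}"] g_set[of "{x. 0 < g x}"]
      by (subst integral_nonneg_eq_0_iff_AE[symmetric])
         (auto simp: set_integrable_def set_lebesgue_integral_def split: split_indicator)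
    moreover have "AE x in lborel. indicator {x. g x < 0} x *\<^sub>R (- g x) = 0"
      using g_borel[of "{x. g x < 0}"] g_set[of "{x. g x < 0}"]
      by (subst integral_nonneg_eq_0_iff_AE[symmetric])
         (auto simp: set_integrable_def set_lebesgue_integral_def split: split_indicator)
    ultimately show ?thesis by eventually_elim (auto split: split_indicator_asm simp: indicator_def split: if_splits)
  qed
  then show ?thesis using Hg AE_completion by fastforce
qed

lemma LINT_ball_eq:
  fixes F :: "'a::euclidean_space \<Rightarrow> real"
  assumes S: "S \<subseteq> ball 0 1" "\<And>x. x \<notin> S \<Longrightarrow> F x = 0"
  shows "(LINT x|ball_leb. F x) = (LINT x|lebesgue. indicator S x * F x)"
proof -
  have "(LINT x|ball_leb. F x) = (LINT x|lebesgue. indicator (ball 0 1) x *\<^sub>R F x)"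
    by (rule integral_restrict_space) simp
  also have "\<dots> = (LINT x|lebesgue. indicator S x * F x)"
    by (rule Bochner_Integration.integral_cong[OF refl]) (use S in \<open>auto split: split_indicator\<close>)
  finally show ?thesis .
qed

text \<open>A smooth approximation of the indicator of an open box intersected with the ball of
  radius \<open>\<rho>\<close>: each factor \<open>bump (n * t)\<close> tends to \<open>1\<close>
  for \<open>t > 0\<close> and is \<open>0\<close> otherwise. The first factor gives compact support
  in the unit ball whatever the box is.\<close>

definition box_bump :: "real \<Rightarrow> 'a::euclidean_space \<Rightarrow> 'a \<Rightarrow> real \<Rightarrow> 'a \<Rightarrow> real" where
  "box_bump \<rho> a b n x = bump (n * (\<rho>\<^sup>2 - x \<bullet> x)) *
     (\<Prod>i\<in>Basis. bump (n * (x \<bullet> i - a \<bullet> i)) * bump (n * (b \<bullet> i - x \<bullet> i)))"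

lemma box_bump_eq_0: "0 \<le> n \<Longrightarrow> 0 < \<rho> \<Longrightarrow> x \<notin> ball 0 \<rho> \<Longrightarrow> box_bump \<rho> a b n x = 0"
proof -
  assume *: "0 \<le> n" "0 < \<rho>" "x \<notin> ball 0 \<rho>"
  then have "\<rho>\<^sup>2 \<le> x \<bullet> x" by (simp add: power2_norm_eq_inner[symmetric] power_mono)
  then have "n * (\<rho>\<^sup>2 - x \<bullet> x) \<le> 0" using * by (simp add: mult_nonneg_nonpos)
  then show ?thesis by (simp add: box_bump_def flat_def)
qed

lemma box_bump_bounds: "0 \<le> box_bump \<rho> a b n x" "box_bump \<rho> a b n x \<le> 1"
  unfolding box_bump_def
  by (auto intro!: mult_nonneg_nonneg prod_nonneg mult_le_one prod_le_1 bump_bounds)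

lemma box_bump_tendsto:
  assumes "0 < \<rho>"
  shows "(\<lambda>n. box_bump \<rho> a b (real n) x) \<longlonglongrightarrow> indicator (box a b \<inter> ball 0 \<rho>) x"
proof -
  have "(\<lambda>n. box_bump \<rho> a b (real n) x) \<longlonglongrightarrow> (if 0 < \<rho>\<^sup>2 - x \<bullet> x then 1 else 0) *
     (\<Prod>i\<in>Basis. (if 0 < x \<bullet> i - a \<bullet> i then 1 else 0) * (if 0 < b \<bullet> i - x \<bullet> i then 1 else 0))"
    unfolding box_bump_def by (intro tendsto_mult tendsto_prod bump_tendsto_indicator)
  moreover have "0 < \<rho>\<^sup>2 - x \<bullet> x \<longleftrightarrow> x \<in> ball 0 \<rho>"
    using assms power_mono_iff[of \<rho> "norm x" 2]
    by (auto simp: power2_norm_eq_inner not_le[symmetric] simp del: not_le)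
  moreover have "(\<Prod>i\<in>Basis. (if 0 < x \<bullet> i - a \<bullet> i then 1 else 0) * (if 0 < b \<bullet> i - x \<bullet> i then 1 else 0))
      = (indicator (box a b) x :: real)"
    by (auto simp: mem_box indicator_def intro!: prod.neutral prod_zero)
  ultimately show ?thesis by (auto simp: indicator_def split: if_splits)
qed

lemma box_bump_test_function:
  fixes a b :: "'a::euclidean_space"
  assumes "0 \<le> n" "0 < \<rho>" "\<rho> < 1"
  shows "box_bump \<rho> a b n \<in> test_functions"
proof (rule test_functionsI)
  show "Ck_fun k (box_bump \<rho> a b n)" for k
    unfolding box_bump_def
    by (intro Ck_fun_mult Ck_fun_prod Ck_fun_flat Ck_fun_diff Ck_fun_const Ck_fun_inner Ck_fun_inner_self finite_Basis)
  show "compact (cball (0::'a) \<rho>)" "cball (0::'a) \<rho> \<subseteq> ball 0 1" using assms by auto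
qed (use assms in \<open>auto intro!: box_bump_eq_0\<close>)

lemma Ck_fun_measurable: "Ck_fun 0 \<phi> \<Longrightarrow> \<phi> \<in> borel_measurable lebesgue"
  by (simp add: continuous_imp_measurable_on_sets_lebesgue[of UNIV, simplified] borel_measurable_continuous_onI measurable_completion)

lemma weak_gradient_absolutely_integrable:
  "is_weak_gradient u g \<Longrightarrow> compact K \<Longrightarrow> K \<subseteq> ball 0 1 \<Longrightarrow> g absolutely_integrable_on K"
  unfolding is_weak_gradient_def by blast

text \<open>Weak gradients are only locally integrable, so each component of the difference is cut
  to a ball of radius \<open>\<rho> < 1\<close>. Testing with \<open>box_bump\<close> and letting
  \<open>n\<close> grow shows that its integral over every box is zero.\<close>

lemma weak_gradient_AE_unique:
  fixes u :: "'a::euclidean_space \<Rightarrow> real"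
  assumes g1: "is_weak_gradient u g1" and g2: "is_weak_gradient u g2"
  shows "AE x in ball_leb. g1 x = g2 x"
proof -
  have ae: "AE x in lebesgue. x \<in> ball 0 \<rho> \<longrightarrow> g1 x \<bullet> i = g2 x \<bullet> i"
    if \<rho>: "0 < \<rho>" "\<rho> < 1" and i: "i \<in> Basis" for \<rho> i
  proof -
    have int: "integrable lebesgue (\<lambda>x. indicator (ball 0 \<rho>) x * (g x \<bullet> i))"
      if g: "is_weak_gradient u g" for g
    proof -
      have "g absolutely_integrable_on cball 0 \<rho>"
        using \<rho> by (intro weak_gradient_absolutely_integrable[OF g]) auto
      then have "set_integrable lebesgue (ball 0 \<rho>) g"
        by (rule set_integrable_subset) auto
      then have "integrable lebesgue (\<lambda>x. (indicator (ball 0 \<rho>) x *\<^sub>R g x) \<bullet> i)"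
        unfolding set_integrable_def by (rule integrable_inner_left)
      then show ?thesis by simp
    qed
    define H where "H x = indicator (ball 0 \<rho>) x * (g1 x \<bullet> i) - indicator (ball 0 \<rho>) x * (g2 x \<bullet> i)" for x
    have H: "integrable lebesgue H" unfolding H_def by (intro Bochner_Integration.integrable_diff int g1 g2)
    have "(LINT x|lebesgue. indicator (box a b) x * H x) = 0" for a b
    proof -
      let ?\<phi> = "\<lambda>n. box_bump \<rho> a b (real n)"
      have \<phi>_test: "?\<phi> n \<in> test_functions" for n
        by (intro box_bump_test_function \<rho>) simp
      have \<phi>_meas: "?\<phi> n \<in> borel_measurable lebesgue" for n
      proof (rule Ck_fun_measurable)
        show "Ck_fun 0 (?\<phi> n)"
          using \<phi>_test[of n] unfolding test_functions_def by blast
      qed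
      have \<phi>_int: "integrable lebesgue (\<lambda>x. indicator (ball 0 \<rho>) x * ((g x \<bullet> i) * ?\<phi> n x))"
        if "is_weak_gradient u g" for g n
        by (rule Bochner_Integration.integrable_bound[OF int[OF that]])
           (use \<phi>_meas[of n] borel_measurable_times[OF borel_measurable_integrable[OF int[OF that]] \<phi>_meas[of n]]
              box_bump_bounds[of \<rho> a b "real n"]
            in \<open>auto simp: abs_mult mult.assoc split: split_indicator intro!: mult_left_le\<close>)
      have zero: "(LINT x|lebesgue. H x * ?\<phi> n x) = 0" for n
      proof -
        have *: "(LINT x|lebesgue. indicator (ball 0 \<rho>) x * ((g x \<bullet> i) * ?\<phi> n x))
            = - (LINT x|ball_leb. u x * frechet_derivative (?\<phi> n) (at x) i)"
          if g: "is_weak_gradient u g" for g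
        proof -
          have "(LINT x|ball_leb. u x * frechet_derivative (?\<phi> n) (at x) i) = - (LINT x|ball_leb. (g x \<bullet> i) * ?\<phi> n x)"
            using g i \<phi>_test[of n] by (simp add: is_weak_gradient_def)
          then show ?thesis
            using \<rho> box_bump_eq_0[of "real n" \<rho> _ a b]
            by (subst LINT_ball_eq[symmetric]) auto
        qed
        have "(LINT x|lebesgue. H x * ?\<phi> n x) =
           (LINT x|lebesgue. indicator (ball 0 \<rho>) x * ((g1 x \<bullet> i) * ?\<phi> n x) -
              indicator (ball 0 \<rho>) x * ((g2 x \<bullet> i) * ?\<phi> n x))"
          by (simp add: H_def algebra_simps)
        also have "\<dots> = 0"
          using *[OF g1] *[OF g2]
          by (subst Bochner_Integration.integral_diff[OF \<phi>_int[OF g1] \<phi>_int[OF g2]]) simp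
        finally show ?thesis .
      qed
      have "(\<lambda>n. LINT x|lebesgue. H x * ?\<phi> n x) \<longlonglongrightarrow> (LINT x|lebesgue. indicator (box a b) x * H x)"
      proof (rule integral_dominated_convergence[where w="\<lambda>x. norm (H x)"])
        show "AE x in lebesgue. (\<lambda>n. H x * ?\<phi> n x) \<longlonglongrightarrow> indicator (box a b) x * H x"
        proof (rule AE_I2)
          fix x
          have "(\<lambda>n. H x * ?\<phi> n x) \<longlonglongrightarrow> H x * indicator (box a b \<inter> ball 0 \<rho>) x"
            by (intro tendsto_mult tendsto_const box_bump_tendsto \<rho>)
          also have "H x * indicator (box a b \<inter> ball 0 \<rho>) x = indicator (box a b) x * H x"
            by (auto simp: H_def split: split_indicator)
          finally show "(\<lambda>n. H x * ?\<phi> n x) \<longlonglongrightarrow> indicator (box a b) x * H x" .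
        qed
      qed (use H \<phi>_meas box_bump_bounds[of \<rho> a b] in \<open>auto simp: abs_mult abs_of_nonneg intro!: AE_I2 mult_left_le borel_measurable_times borel_measurable_indicator\<close>)
      then show ?thesis by (simp add: zero LIMSEQ_const_iff)
    qed
    from AE_eq_0_if_box_integrals_eq_0[OF H this] show ?thesis
      by eventually_elim (auto simp: H_def)
  qed
  \<comment> \<open>Countably many radii exhaust the ball, so the exceptional null sets can be
    united.\<close>
  have "AE x in lebesgue. \<forall>n. \<forall>i\<in>Basis. x \<in> ball 0 (1 - 1 / real (n + 2)) \<longrightarrow> g1 x \<bullet> i = g2 x \<bullet> i"
    unfolding AE_all_countable by (intro allI AE_finite_allI ae finite_Basis) (auto simp: divide_simps)
  then have "AE x in lebesgue. x \<in> ball 0 1 \<longrightarrow> g1 x = g2 x"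
  proof eventually_elim
    case (elim x)
    show ?case
    proof
      assume "x \<in> ball 0 1"
      then obtain n where n: "1 / real (Suc n) < 1 - norm x"
        using nat_approx_posE[of "1 - norm x"] by auto
      have "1 / real (n + 2) \<le> 1 / real (Suc n)" by (simp add: divide_simps)
      then have "x \<in> ball 0 (1 - 1 / real (n + 2))" using n by simp
      then show "g1 x = g2 x" using elim by - (rule euclidean_eqI, blast)
    qed
  qed
  then show ?thesis by (subst AE_restrict_space_iff) auto
qed

lemma wgrad_is_weak_gradient: "u \<in> W1p p \<Longrightarrow> is_weak_gradient u (wgrad u)"
  unfolding W1p_def wgrad_def using someI_ex[of "is_weak_gradient u"] by blast

section \<open>The radial initial value problem\<close>

text \<open>For \<open>r > 0\<close> this is \<open>r\<close> to the power \<open>-N\<close> times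
  the integral of \<open>t ^ (N - 1) * f t\<close> over \<open>{0..r}\<close>, that is,
  \<open>1 / N\<close> times the mean of the radial function over the ball of radius
  \<open>r\<close>. Rescaling to \<open>{0..1}\<close> makes it continuous at
  \<open>r = 0\<close>.\<close>

definition ravg :: "nat \<Rightarrow> (real \<Rightarrow> real) \<Rightarrow> real \<Rightarrow> real" where
  "ravg N f r = integral {0..1} (\<lambda>t. t ^ (N - 1) * f (r * t))"

lemma ravg_integrand_continuous:
  fixes f :: "real \<Rightarrow> real"
  assumes "continuous_on {0..1} f" "r \<in> {0..1}"
  shows "continuous_on {0..1} (\<lambda>t. t ^ (N - 1) * f (r * t))"
proof -
  have "continuous_on {0..1} (\<lambda>t. f (r * t))"
    by (rule continuous_on_compose2[OF assms(1)])
       (use assms(2) in \<open>auto intro!: continuous_intros intro: mult_le_one\<close>)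
  then show ?thesis by (intro continuous_intros)
qed

lemma continuous_on_ravg:
  assumes "continuous_on {0..1} f"
  shows "continuous_on {0..1} (ravg N f)"
proof -
  have "continuous_on ({0..1} \<times> cbox 0 1) (\<lambda>(r, t). t ^ (N - 1) * f (r * t))"
    unfolding case_prod_beta
    by (intro continuous_intros continuous_on_compose2[OF assms]) (auto intro: mult_le_one)
  from integral_continuous_on_param[OF this] show ?thesis
    by (simp add: ravg_def[abs_def])
qed

lemma ravg_diff:
  assumes "continuous_on {0..1} f" "continuous_on {0..1} g" "r \<in> {0..1}"
  shows "ravg N f r - ravg N g r = ravg N (\<lambda>t. f t - g t) r"
  unfolding ravg_def right_diff_distrib
  by (intro integral_diff[symmetric] integrable_continuous_real ravg_integrand_continuous assms)

lemma ravg_mono: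
  assumes "continuous_on {0..1} f" "continuous_on {0..1} g" "r \<in> {0..1}"
    "\<And>t. t \<in> {0..r} \<Longrightarrow> f t \<le> g t"
  shows "ravg N f r \<le> ravg N g r"
  unfolding ravg_def
proof (intro integral_le integrable_continuous_real ravg_integrand_continuous mult_left_mono assms)
  fix t :: real assume "t \<in> {0..1}"
  then show "r * t \<in> {0..r}" "0 \<le> t ^ (N - 1)" using assms(3) by (auto intro: mult_left_le)
qed

lemma ravg_const: "0 < N \<Longrightarrow> ravg N (\<lambda>_. c) r = c / N"
proof -
  assume N: "0 < N"
  have "((\<lambda>t. t ^ (N - 1)) has_integral 1 ^ N / N - 0 ^ N / N) {0..1::real}"
    using N by (intro fundamental_theorem_of_calculus)
      (auto intro!: derivative_eq_intros simp: has_real_derivative_iff_has_vector_derivative[symmetric])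
  then have "integral {0..1::real} (\<lambda>t. t ^ (N - 1)) = 1 / N"
    using N by (simp add: integral_unique)
  then show ?thesis by (simp add: ravg_def)
qed

lemma ravg_eq_integral:
  assumes "continuous_on {0..1} f" "r \<in> {0..1}" "0 < N"
  shows "r ^ N * ravg N f r = integral {0..r} (\<lambda>t. t ^ (N - 1) * f t)"
proof (cases "r = 0")
  case True
  then show ?thesis using assms by simp
next
  case False
  with assms have r: "0 < r" "r \<le> 1" by auto
  have "continuous_on {0..r} (\<lambda>t. t ^ (N - 1) * f t)"
    using r by (intro continuous_intros continuous_on_subset[OF assms(1)]) auto
  then have "((\<lambda>t. t ^ (N - 1) * f t) has_integral integral {0..r} (\<lambda>t. t ^ (N - 1) * f t)) (cbox 0 r)"
    by (simp add: integrable_integral integrable_continuous_real)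
  from has_integral_affinity'[OF this r(1), of 0]
  have "((\<lambda>t. (r * t) ^ (N - 1) * f (r * t)) has_integral integral {0..r} (\<lambda>t. t ^ (N - 1) * f t) / r) {0..1}"
    using r by (simp add: divide_inverse_commute)
  moreover have rN: "r ^ N = r * r ^ (N - 1)" using assms(3) by (cases N) auto
  ultimately have "((\<lambda>t. r * ((r * t) ^ (N - 1) * f (r * t))) has_integral r * (integral {0..r} (\<lambda>t. t ^ (N - 1) * f t) / r)) {0..1}"
    by (intro has_integral_mult_right)
  then
  have "((\<lambda>t. r ^ N * (t ^ (N - 1) * f (r * t))) has_integral integral {0..r} (\<lambda>t. t ^ (N - 1) * f t)) {0..1}"
    using r unfolding rN by (simp add: power_mult_distrib mult_ac)
  then have "integral {0..1} (\<lambda>t. r ^ N * (t ^ (N - 1) * f (r * t))) = integral {0..r} (\<lambda>t. t ^ (N - 1) * f t)"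
    by (rule integral_unique)
  then show ?thesis by (simp add: ravg_def)
qed

text \<open>The Picard operator is a contraction for the sup norm weighted by \<open>exp (-\<lambda>r)\<close>; the weight is
  carried by working with \<open>Y r = exp (-\<lambda>r) * U r\<close>.\<close>

lemma radial_ivp:
  fixes k \<Psi> :: "real \<Rightarrow> real"
  assumes k: "L-lipschitz_on UNIV k" and \<Psi>: "M-lipschitz_on UNIV \<Psi>"
  obtains U K where
    "\<And>d. continuous_on {0..1} (U d)"
    "\<And>d r. r \<in> {0..1} \<Longrightarrow>
       U d r = d + integral {0..r} (\<lambda>s. \<Psi> (s * ravg N (\<lambda>t. k (U d t)) s))"
    "\<And>d d' r. r \<in> {0..1} \<Longrightarrow> \<bar>U d r - U d' r\<bar> \<le> K * \<bar>d - d'\<bar>"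
proof -
  have L: "0 \<le> L" "\<And>x y. \<bar>k x - k y\<bar> \<le> L * \<bar>x - y\<bar>"
    using k by (auto simp: lipschitz_on_def dist_real_def)
  have M: "0 \<le> M" "\<And>x y. \<bar>\<Psi> x - \<Psi> y\<bar> \<le> M * \<bar>x - y\<bar>"
    using \<Psi> by (auto simp: lipschitz_on_def dist_real_def)
  have k_cont: "continuous_on A k" and \<Psi>_cont: "continuous_on A \<Psi>" for A
    using k \<Psi> lipschitz_on_continuous_on continuous_on_subset by blast+
  \<comment> \<open>Integrating the weight \<open>exp (lam * s)\<close> yields a factor
    \<open>1 / lam\<close>; this choice makes the contraction constant \<open>L * M / lam\<close> at
    most \<open>1/2\<close>.\<close>
  define lam where "lam = 2 * (L * M) + 1"
  have lam: "0 < lam" "L * M / lam \<le> 1 / 2" using mult_nonneg_nonneg[OF L(1) M(1)] by (auto simp: lam_def divide_simps)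
  \<comment> \<open>Clamping the radius to \<open>{0..1}\<close> extends functions on the interval
    to bounded continuous ones on the line, where the complete space of bounded continuous functions
    is available.\<close>
  define c :: "real \<Rightarrow> real" where "c = (\<lambda>r. max 0 (min 1 r))"
  have c: "c r \<in> {0..1}" "r \<in> {0..1} \<Longrightarrow> c r = r" for r by (auto simp: c_def)
  have c_cont: "continuous_on UNIV c" unfolding c_def by (intro continuous_intros)
  define W where "W = (\<lambda>(Y :: real \<Rightarrow>\<^sub>C real) t. exp (lam * t) * apply_bcontfun Y t)"
  have W_cont: "continuous_on A (W Y)" for A Y unfolding W_def by (intro continuous_intros) auto
  define A where "A = (\<lambda>Y s. s * ravg N (\<lambda>t. k (W Y t)) s)"
  have kW_cont: "continuous_on B (\<lambda>t. k (W Y t))" for B Y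
    using continuous_on_compose2[OF k_cont W_cont] by blast
  have \<Psi>A_cont: "continuous_on {0..1} (\<lambda>s. \<Psi> (A Y s))" for Y unfolding A_def
    by (intro continuous_on_compose2[OF \<Psi>_cont[of UNIV]] continuous_intros continuous_on_ravg kW_cont) auto
  define R where "R = (\<lambda>d Y r. d + integral {0..r} (\<lambda>s. \<Psi> (A Y s)))"
  have R_cont: "continuous_on {0..1} (R d Y)" for d Y unfolding R_def
    by (intro continuous_intros indefinite_integral_continuous_1 integrable_continuous_real \<Psi>A_cont)
  define S where "S = (\<lambda>d Y. Bcontfun (\<lambda>r. exp (- (lam * c r)) * R d Y (c r)))"
  have S: "apply_bcontfun (S d Y) r = exp (- (lam * c r)) * R d Y (c r)" for d Y r
  proof -
    have cont: "continuous_on {0..1} (\<lambda>r. exp (- (lam * r)) * R d Y r)"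
      by (intro continuous_intros R_cont)
    have "bounded ((\<lambda>r. exp (- (lam * r)) * R d Y r) ` {0..1})"
      by (rule compact_imp_bounded[OF compact_continuous_image[OF cont]]) simp
    then have "bounded (range (\<lambda>r. exp (- (lam * c r)) * R d Y (c r)))"
      by (rule bounded_subset) (use c in auto)
    moreover have "continuous_on UNIV (\<lambda>r. exp (- (lam * c r)) * R d Y (c r))"
      by (rule continuous_on_compose2[OF cont c_cont]) (use c in auto)
    ultimately show ?thesis unfolding S_def by (subst Bcontfun_inverse) (auto simp: bcontfun_def)
  qed
  have A_diff: "\<bar>A Y s - A Z s\<bar> \<le> L * dist Y Z * exp (lam * s)" if s: "s \<in> {0..1}" for Y Z s
  proof -
    have *: "\<bar>k (W Y (s * t)) - k (W Z (s * t))\<bar> \<le> L * dist Y Z * exp (lam * s)" if t: "t \<in> {0..1}" for t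
    proof -
      have "\<bar>W Y (s * t) - W Z (s * t)\<bar> = exp (lam * (s * t)) * dist (Y (s * t)) (Z (s * t))"
        by (simp add: W_def dist_real_def abs_mult right_diff_distrib[symmetric])
      also have "\<dots> \<le> exp (lam * s) * dist Y Z"
        using lam s t by (intro mult_mono dist_bounded) (auto intro: mult_left_le)
      finally have "L * \<bar>W Y (s * t) - W Z (s * t)\<bar> \<le> L * (exp (lam * s) * dist Y Z)"
        using L(1) by (rule mult_left_mono)
      then show ?thesis using L(2)[of "W Y (s * t)" "W Z (s * t)"] by (simp add: mult_ac)
    qed
    have "\<bar>ravg N (\<lambda>t. k (W Y t) - k (W Z t)) s\<bar> \<le> L * dist Y Z * exp (lam * s) * (1 - 0)"
      unfolding ravg_def real_norm_def[symmetric]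
    proof (intro integral_bound ravg_integrand_continuous continuous_on_diff kW_cont s)
      fix t :: real assume t: "t \<in> {0..1}"
      have "norm (t ^ (N - 1) * (k (W Y (s * t)) - k (W Z (s * t))))
          \<le> 1 * \<bar>k (W Y (s * t)) - k (W Z (s * t))\<bar>"
        using t unfolding real_norm_def abs_mult by (intro mult_right_mono) (auto intro: power_le_one)
      then show "norm (t ^ (N - 1) * (k (W Y (s * t)) - k (W Z (s * t)))) \<le> L * dist Y Z * exp (lam * s)"
        using *[OF t] by simp
    qed simp
    then have *: "\<bar>ravg N (\<lambda>t. k (W Y t)) s - ravg N (\<lambda>t. k (W Z t)) s\<bar> \<le> L * dist Y Z * exp (lam * s)"
      using s by (subst ravg_diff) (auto intro: kW_cont)
    have "\<bar>A Y s - A Z s\<bar> = s * \<bar>ravg N (\<lambda>t. k (W Y t)) s - ravg N (\<lambda>t. k (W Z t)) s\<bar>"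
      using s by (simp add: A_def abs_mult right_diff_distrib[symmetric])
    also have "\<dots> \<le> 1 * (L * dist Y Z * exp (lam * s))"
      using s * by (intro mult_mono) auto
    finally show ?thesis by simp
  qed
  have R_diff: "\<bar>R d Y r - R d Z r\<bar> \<le> 1 / 2 * dist Y Z * exp (lam * r)" if r: "r \<in> {0..1}" for d Y Z r
  proof -
    have int: "(\<lambda>s. \<Psi> (A Y s)) integrable_on {0..r}" for Y
      by (rule integrable_continuous_real, rule continuous_on_subset[OF \<Psi>A_cont]) (use r in auto)
    have ftc: "((\<lambda>s. M * L * dist Y Z * exp (lam * s)) has_integral
        M * L * dist Y Z * exp (lam * r) / lam - M * L * dist Y Z * exp (lam * 0) / lam) {0..r}"
      using r lam(1) by (intro fundamental_theorem_of_calculus)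
        (auto intro!: derivative_eq_intros simp: has_real_derivative_iff_has_vector_derivative[symmetric])
    have "\<bar>R d Y r - R d Z r\<bar> = \<bar>integral {0..r} (\<lambda>s. \<Psi> (A Y s) - \<Psi> (A Z s))\<bar>"
      unfolding R_def by (subst integral_diff) (auto intro: int)
    also have "\<dots> \<le> integral {0..r} (\<lambda>s. M * L * dist Y Z * exp (lam * s))"
      unfolding real_norm_def[symmetric]
    proof (intro integral_norm_bound_integral integrable_diff int)
      fix s assume s: "s \<in> {0..r}"
      have "\<bar>\<Psi> (A Y s) - \<Psi> (A Z s)\<bar> \<le> M * \<bar>A Y s - A Z s\<bar>" by (rule M)
      also have "\<dots> \<le> M * (L * dist Y Z * exp (lam * s))"
        using A_diff[of s Y Z] s r M(1) by (intro mult_left_mono) auto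
      finally show "norm (\<Psi> (A Y s) - \<Psi> (A Z s)) \<le> M * L * dist Y Z * exp (lam * s)" by simp
    qed (use ftc in blast)
    also have "\<dots> = M * L * dist Y Z * exp (lam * r) / lam - M * L * dist Y Z * exp (lam * 0) / lam"
      using ftc by (rule integral_unique)
    also have "\<dots> \<le> (L * M / lam) * (dist Y Z * exp (lam * r))"
      using L M lam by (simp add: field_simps)
    also have "\<dots> \<le> 1 / 2 * (dist Y Z * exp (lam * r))"
      by (intro mult_right_mono lam) auto
    finally show ?thesis by simp
  qed
  have S_diff: "dist (S d Y) (S d' Z) \<le> 1 / 2 * dist Y Z + \<bar>d - d'\<bar>" for d d' Y Z
  proof (rule dist_bound)
    fix r
    have R': "R d Y (c r) - R d' Z (c r) = (R d Y (c r) - R d Z (c r)) + (d - d')"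
      by (simp add: R_def)
    have "dist (S d Y r) (S d' Z r) = exp (- (lam * c r)) * \<bar>R d Y (c r) - R d' Z (c r)\<bar>"
      by (simp add: S dist_real_def abs_mult right_diff_distrib[symmetric])
    also have "\<dots> \<le> exp (- (lam * c r)) * (1 / 2 * dist Y Z * exp (lam * c r) + \<bar>d - d'\<bar>)"
      unfolding R' by (intro mult_left_mono order_trans[OF abs_triangle_ineq] add_right_mono R_diff c) auto
    also have "\<dots> = 1 / 2 * dist Y Z + exp (- (lam * c r)) * \<bar>d - d'\<bar>"
      by (simp add: exp_minus field_simps)
    also have "\<dots> \<le> 1 / 2 * dist Y Z + \<bar>d - d'\<bar>"
      using c(1)[of r] lam by (auto intro!: mult_left_le_one_le)
    finally show "dist (S d Y r) (S d' Z r) \<le> 1 / 2 * dist Y Z + \<bar>d - d'\<bar>" .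
  qed
  have "\<exists>!Y. S d Y = Y" for d
    by (rule banach_fix_type[where c="1/2"]) (use S_diff[of d _ d] in auto)
  then obtain Y where Y: "\<And>d. S d (Y d) = Y d" by metis
  \<comment> \<open>Two fixed points of maps with contraction constant \<open>1/2\<close> that
    differ by at most \<open>\<bar>d - d'\<bar>\<close> are within twice that distance. This gives
    the Lipschitz dependence on the start value.\<close>
  have Y_diff: "dist (Y d) (Y d') \<le> 2 * \<bar>d - d'\<bar>" for d d'
    using S_diff[of d "Y d" d' "Y d'"] by (simp add: Y)
  have W_eq: "W (Y d) r = R d (Y d) r" if "r \<in> {0..1}" for d r
    using S[of d "Y d" r] that by (simp add: Y c(2) W_def exp_minus field_simps)
  show thesis
  proof
    show "continuous_on {0..1} (W (Y d))" for d by (rule W_cont)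
    show "W (Y d) r = d + integral {0..r} (\<lambda>s. \<Psi> (s * ravg N (\<lambda>t. k (W (Y d) t)) s))"
      if "r \<in> {0..1}" for d r
      using W_eq[OF that] by (simp add: R_def A_def)
    show "\<bar>W (Y d) r - W (Y d') r\<bar> \<le> 2 * exp lam * \<bar>d - d'\<bar>" if r: "r \<in> {0..1}" for d d' r
    proof -
      have "\<bar>W (Y d) r - W (Y d') r\<bar> = exp (lam * r) * dist (Y d r) (Y d' r)"
        by (simp add: W_def dist_real_def abs_mult right_diff_distrib[symmetric])
      also have "\<dots> \<le> exp lam * (2 * \<bar>d - d'\<bar>)"
        using r lam order_trans[OF dist_bounded Y_diff] by (intro mult_mono) (auto intro: mult_left_le)
      finally show ?thesis by simp
    qed
  qed
qed

section \<open>The divergence theorem for radial fields\<close>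

lemma integrable_bounded_mult:
  fixes f b :: "'a \<Rightarrow> real"
  assumes f: "integrable M f" and b: "b \<in> borel_measurable M" "\<And>x. x \<in> space M \<Longrightarrow> \<bar>b x\<bar> \<le> B"
  shows "integrable M (\<lambda>x. f x * b x)"
proof (rule Bochner_Integration.integrable_bound)
  show "integrable M (\<lambda>x. f x * B)" using f by simp
  show "AE x in M. norm (f x * b x) \<le> norm (f x * B)"
    using b(2) by (intro AE_I2) (force simp: abs_mult intro!: mult_left_mono)
qed (use f b in measurable)

lemma ball_leb_continuous_measurable:
  fixes f :: "'a::euclidean_space \<Rightarrow> 'b::euclidean_space"
  assumes "continuous_on (ball 0 1) f"
  shows "f \<in> borel_measurable ball_leb"
  using assms by (intro continuous_imp_measurable_on_sets_lebesgue) auto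

lemma integrable_inner_id:
  fixes g :: "'a::euclidean_space \<Rightarrow> 'a"
  assumes g_int: "integrable ball_leb g"
  shows "integrable ball_leb (\<lambda>x. x \<bullet> g x)"
proof (rule Bochner_Integration.integrable_bound[OF g_int])
  show "(\<lambda>x. x \<bullet> g x) \<in> borel_measurable ball_leb"
    by (intro borel_measurable_inner ball_leb_continuous_measurable continuous_intros borel_measurable_integrable[OF g_int])
  show "AE x in ball_leb. norm (x \<bullet> g x) \<le> norm (g x)"
  proof (rule AE_I2)
    fix x :: 'a assume "x \<in> space ball_leb"
    then show "norm (x \<bullet> g x) \<le> norm (g x)"
      using Cauchy_Schwarz_ineq2[of x "g x"] mult_right_mono[of "norm x" 1 "norm (g x)"] by simp
  qed
qed

section \<open>Cutoff estimates near the sphere\<close>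

abbreviation "bump' \<equiv> flat (flat_deriv 1)"

lemma bump'_eq: "bump' t = (if 0 < t then (1 / t)\<^sup>2 * exp (- (1 / t)) else 0)"
  by (simp add: flat_def flat_deriv_def power2_eq_square pderiv_1)

text \<open>With \<open>y = 1 / t\<close> the product is \<open>(y^2 + y) * exp (- y)\<close>, and
  \<open>exp y\<close> dominates \<open>1 + y + y^2 / 2\<close>. The factor \<open>1 + t\<close> is
  what \<open>n * (1 - x \<bullet> x)\<close> becomes at the cutoff argument
  \<open>t\<close>.\<close>

lemma bump'_bounds: "0 \<le> (1 + t) * bump' t" "(1 + t) * bump' t \<le> 3"
proof -
  show "0 \<le> (1 + t) * bump' t" by (simp add: bump'_eq)
  show "(1 + t) * bump' t \<le> 3"
  proof (cases "0 < t")
    case True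
    define y where "y = 1 / t"
    have y: "0 < y" "t = 1 / y" using True by (auto simp: y_def)
    have "1 + y + y\<^sup>2 / 2 \<le> exp y" using y exp_lower_Taylor_quadratic[of y] by simp
    then have "y\<^sup>2 + y \<le> 3 * exp y" using y zero_le_power2[of y] by linarith
    then have "(y\<^sup>2 + y) / exp y \<le> 3" by (simp add: divide_simps)
    moreover have "bump' t = y\<^sup>2 * exp (- y)" using True by (simp add: bump'_eq y_def)
    moreover have "(1 + t) * y\<^sup>2 = y\<^sup>2 + y" using y by (simp add: field_simps power2_eq_square)
    ultimately show ?thesis by (simp add: exp_minus divide_inverse mult.assoc[symmetric])
  qed (simp add: bump'_eq)
qed

lemma bump'_tendsto_0: "((\<lambda>t. (1 + t) * bump' t) \<longlongrightarrow> 0) at_top"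
proof -
  have "((\<lambda>t::real. ((1 / t)\<^sup>2 + 1 / t) * exp (- (1 / t))) \<longlongrightarrow> (0\<^sup>2 + 0) * exp (- 0)) at_top"
    by (intro tendsto_intros tendsto_divide_0[OF tendsto_const] filterlim_at_top_imp_at_infinity filterlim_ident)
  moreover have "\<forall>\<^sub>F t::real in at_top. ((1 / t)\<^sup>2 + 1 / t) * exp (- (1 / t)) = (1 + t) * bump' t"
    using eventually_gt_at_top[of 0] by eventually_elim (simp add: bump'_eq field_simps power2_eq_square)
  ultimately show ?thesis by (simp add: tendsto_cong)
qed

lemma bump_tendsto_1: "(bump \<longlongrightarrow> 1) at_top"
proof -
  have "((\<lambda>t::real. exp (- (1 / t))) \<longlongrightarrow> exp (- 0)) at_top"
    by (intro tendsto_intros tendsto_divide_0[OF tendsto_const] filterlim_at_top_imp_at_infinity filterlim_ident)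
  moreover have "\<forall>\<^sub>F t::real in at_top. exp (- (1 / t)) = bump t"
    using eventually_gt_at_top[of 0] by eventually_elim (simp add: bump_eq)
  ultimately show ?thesis by (simp add: tendsto_cong)
qed

lemma one_minus_power_le:
  fixes t :: real
  assumes "0 \<le> t" "t \<le> 1"
  shows "1 - t ^ k \<le> k * (1 - t)"
proof (induction k)
  case (Suc k)
  have "1 - t ^ Suc k = 1 - t ^ k + t ^ k * (1 - t)" by (simp add: algebra_simps)
  also have "\<dots> \<le> k * (1 - t) + 1 * (1 - t)"
    using Suc assms by (intro add_mono mult_right_mono) (auto intro: power_le_one)
  finally show ?case by (simp add: algebra_simps)
qed simp

text \<open>The divergence identity for the field \<open>(\<bar>x\<bar>\<^sup>2\<^sup>k - 1) x\<close>, which vanishes on the sphere. It is cut off by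
  \<open>bump (n (1 - \<bar>x\<bar>\<^sup>2) - 1)\<close>, whose gradient times \<open>1 - \<bar>x\<bar>\<^sup>2\<close> stays bounded and tends to \<open>0\<close>.\<close>

lemma monomial_flux_identity:
  fixes \<psi> :: "'a::euclidean_space \<Rightarrow> real"
  assumes g: "is_weak_gradient \<psi> g" and \<psi>_int: "integrable ball_leb \<psi>" and g_int: "integrable ball_leb g"
  shows "(LINT x|ball_leb. \<psi> x * ((DIM('a) + 2 * real k) * (x \<bullet> x) ^ k - DIM('a)))
    = - (LINT x|ball_leb. (x \<bullet> g x) * ((x \<bullet> x) ^ k - 1))"
proof -
  \<comment> \<open>The shift by \<open>-1\<close> makes the cutoff vanish as soon as
    \<open>x \<bullet> x \<ge> 1 - 1 / n\<close>, so its support is compact inside the open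
    ball.\<close>
  define T where "T n x = real n * (1 - x \<bullet> x) - 1" for n and x :: 'a
  define G where "G n x = ((x \<bullet> x) ^ k - 1) * bump (T n x)" for n and x :: 'a
  define D where "D n x = 2 * k * (x \<bullet> x) ^ (k - 1) * bump (T n x)
      - 2 * real n * ((x \<bullet> x) ^ k - 1) * bump' (T n x)" for n and x :: 'a
  have T_deriv: "(T n has_derivative (\<lambda>y. - (2 * real n * (x \<bullet> y)))) (at x)" for n x
    unfolding T_def by (auto intro!: derivative_eq_intros simp: inner_commute)
  have bump_deriv: "((\<lambda>x. bump (T n x)) has_derivative (\<lambda>y. bump' (T n x) * (- (2 * real n * (x \<bullet> y))))) (at x)" for n x
    using has_derivative_compose[OF T_deriv flat_has_real_derivative[unfolded has_field_derivative_def]] .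
  have pow_deriv: "((\<lambda>x. (x \<bullet> x) ^ k - 1) has_derivative (\<lambda>y. 2 * k * (x \<bullet> x) ^ (k - 1) * (x \<bullet> y))) (at x)" for x :: 'a
    by (auto intro!: derivative_eq_intros simp: inner_commute algebra_simps)
  have G_deriv: "(G n has_derivative (\<lambda>y. D n x * (x \<bullet> y))) (at x)" for n x
    unfolding G_def[abs_def]
    by (rule has_derivative_eq_rhs[OF has_derivative_mult[OF pow_deriv bump_deriv]])
       (simp add: D_def fun_eq_iff algebra_simps)
  have frechet: "frechet_derivative (\<lambda>x. (x \<bullet> i) * G n x) (at x) i = G n x + D n x * (x \<bullet> i)\<^sup>2" if "i \<in> Basis" for n i x
  proof -
    have "((\<lambda>x. (x \<bullet> i) * G n x) has_derivative (\<lambda>y. (x \<bullet> i) * (D n x * (x \<bullet> y)) + (y \<bullet> i) * G n x)) (at x)"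
      by (intro has_derivative_mult G_deriv) (auto intro!: derivative_eq_intros)
    from frechet_derivative_eqI[OF this] show ?thesis
      using that by (simp add: power2_eq_square inner_commute)
  qed
  have test: "(\<lambda>x. (x \<bullet> i) * G n x) \<in> test_functions" if n: "0 < n" for n i
  proof (rule test_functionsI)
    show "Ck_fun m (\<lambda>x. (x \<bullet> i) * G n x)" for m
      unfolding G_def T_def
      by (intro Ck_fun_mult Ck_fun_flat Ck_fun_diff Ck_fun_const Ck_fun_inner Ck_fun_inner_self Ck_fun_power)
    define \<rho> where "\<rho> = sqrt (1 - 1 / n)"
    have \<rho>: "0 \<le> \<rho>" "\<rho> < 1" using n by (auto simp: \<rho>_def)
    show "compact (cball (0::'a) \<rho>)" "cball (0::'a) \<rho> \<subseteq> ball 0 1" using \<rho> by auto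
    fix x :: 'a assume "x \<notin> cball 0 \<rho>"
    then have "\<rho>\<^sup>2 \<le> x \<bullet> x" using \<rho> by (simp add: power2_norm_eq_inner[symmetric] power_mono)
    then have "T n x \<le> 0" using n by (simp add: \<rho>_def T_def field_simps)
    then show "(x \<bullet> i) * G n x = 0" by (simp add: G_def bump_eq)
  qed
  have xx: "0 \<le> x \<bullet> x" "x \<bullet> x < 1" if "x \<in> ball 0 1" for x :: 'a
    using that abs_square_less_1[of "norm x"] by (auto simp: power2_norm_eq_inner[symmetric])
  have G_bound: "\<bar>G n x\<bar> \<le> 1" if "x \<in> ball 0 1" for n x
    unfolding G_def abs_mult using xx[OF that] bump_bounds[of "T n x"] power_le_one[of "x \<bullet> x" k]
    by (intro mult_le_one) auto
  \<comment> \<open>The factor \<open>n\<close> from differentiating the cutoff is absorbed because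
    \<open>(x \<bullet> x) ^ k - 1\<close> vanishes to first order at the sphere:
    \<open>n * (1 - x \<bullet> x) = 1 + T n x\<close>.\<close>
  have edge_bound: "\<bar>real n * ((x \<bullet> x) ^ k - 1) * bump' (T n x)\<bar> \<le> k * ((1 + T n x) * bump' (T n x))"
    if "x \<in> ball 0 1" for n x
  proof -
    have "\<bar>(x \<bullet> x) ^ k - 1\<bar> \<le> k * (1 - x \<bullet> x)"
      using one_minus_power_le[of "x \<bullet> x" k] xx[OF that] power_le_one[of "x \<bullet> x" k] by simp
    then have "real n * \<bar>(x \<bullet> x) ^ k - 1\<bar> * bump' (T n x) \<le> real n * (k * (1 - x \<bullet> x)) * bump' (T n x)"
      by (intro mult_right_mono mult_left_mono) (auto simp: bump'_eq)
    moreover have "\<bar>real n * ((x \<bullet> x) ^ k - 1) * bump' (T n x)\<bar> = real n * \<bar>(x \<bullet> x) ^ k - 1\<bar> * bump' (T n x)"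
      by (simp add: abs_mult bump'_eq)
    moreover have "real n * (1 - x \<bullet> x) = 1 + T n x" by (simp add: T_def)
    ultimately show ?thesis by (metis mult.assoc mult.left_commute)
  qed
  have D_bound: "\<bar>D n x * (x \<bullet> x)\<bar> \<le> 8 * k" if x: "x \<in> ball 0 1" for n x
  proof -
    have "k * ((1 + T n x) * bump' (T n x)) \<le> real k * 3" by (intro mult_left_mono bump'_bounds) auto
    then have 1: "\<bar>real n * ((x \<bullet> x) ^ k - 1) * bump' (T n x)\<bar> \<le> 3 * k" using edge_bound[OF x, of n] by simp
    have "(x \<bullet> x) ^ (k - 1) * bump (T n x) \<le> 1"
      using xx[OF x] bump_bounds[of "T n x"] by (intro mult_le_one) (auto intro: power_le_one)
    then have "2 * k * ((x \<bullet> x) ^ (k - 1) * bump (T n x)) \<le> real (2 * k) * 1" by (intro mult_left_mono) auto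
    moreover have "0 \<le> 2 * k * ((x \<bullet> x) ^ (k - 1) * bump (T n x))"
      using xx[OF x] bump_bounds[of "T n x"] by simp
    moreover have "D n x = 2 * k * ((x \<bullet> x) ^ (k - 1) * bump (T n x)) - 2 * (real n * ((x \<bullet> x) ^ k - 1) * bump' (T n x))"
      by (simp add: D_def)
    ultimately have "\<bar>D n x\<bar> \<le> 8 * k" using 1 by linarith
    then show ?thesis unfolding abs_mult using xx[OF x] mult_mono[of "\<bar>D n x\<bar>" "8 * k" "\<bar>x \<bullet> x\<bar>" 1] by simp
  qed
  have T_lim: "filterlim (\<lambda>n. T n x) at_top sequentially" if "x \<in> ball 0 1" for x
  proof -
    have "filterlim (\<lambda>n. (1 - x \<bullet> x) * real n) at_top sequentially"
      using xx[OF that] by (intro filterlim_tendsto_pos_mult_at_top[OF tendsto_const _ filterlim_real_sequentially]) auto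
    from filterlim_tendsto_add_at_top[OF tendsto_const[of "-1"] this]
    show ?thesis by (simp add: T_def mult.commute)
  qed
  have bump_lim: "(\<lambda>n. bump (T n x)) \<longlonglongrightarrow> 1" if "x \<in> ball 0 1" for x
    using filterlim_compose[OF bump_tendsto_1 T_lim[OF that]] .
  have G_lim: "(\<lambda>n. G n x) \<longlonglongrightarrow> (x \<bullet> x) ^ k - 1" if "x \<in> ball 0 1" for x
    unfolding G_def using tendsto_mult[OF tendsto_const bump_lim[OF that]] by simp
  have D_lim: "(\<lambda>n. D n x * (x \<bullet> x)) \<longlonglongrightarrow> 2 * k * (x \<bullet> x) ^ k" if x: "x \<in> ball 0 1" for x
  proof -
    have "(\<lambda>n. k * ((1 + T n x) * bump' (T n x))) \<longlonglongrightarrow> real k * 0"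
      by (intro tendsto_mult tendsto_const filterlim_compose[OF bump'_tendsto_0 T_lim[OF x]])
    then have lim: "(\<lambda>n. k * ((1 + T n x) * bump' (T n x))) \<longlonglongrightarrow> 0" by simp
    have "(\<lambda>n. real n * ((x \<bullet> x) ^ k - 1) * bump' (T n x)) \<longlonglongrightarrow> 0"
      by (rule Lim_null_comparison[OF _ lim]) (use edge_bound[OF x] in simp)
    then have "(\<lambda>n. (2 * k * (x \<bullet> x) ^ (k - 1) * bump (T n x) -
       2 * (real n * ((x \<bullet> x) ^ k - 1) * bump' (T n x))) * (x \<bullet> x)) \<longlonglongrightarrow>
       (2 * k * (x \<bullet> x) ^ (k - 1) * 1 - 2 * 0) * (x \<bullet> x)"
      by (intro tendsto_intros bump_lim x)
    moreover have "(2 * k * (x \<bullet> x) ^ (k - 1) * 1 - 2 * 0) * (x \<bullet> x) = 2 * k * (x \<bullet> x) ^ k"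
      by (cases k) auto
    ultimately show ?thesis by (cases "k = 0") (simp_all add: D_def mult.assoc)
  qed
  have cont: "continuous_on A (G n)" "continuous_on A (D n)" for A n
    unfolding G_def[abs_def] D_def[abs_def] T_def
    by (intro continuous_intros continuous_on_compose2[OF continuous_on_flat[of UNIV]]; simp)+
  have meas: "G n \<in> borel_measurable ball_leb" "D n \<in> borel_measurable ball_leb"
    "(\<lambda>x. x \<bullet> x) \<in> borel_measurable (ball_leb :: 'a measure)" for n
    by (intro ball_leb_continuous_measurable cont continuous_intros)+
  have gi_int: "integrable ball_leb (\<lambda>x. g x \<bullet> i)" for i using g_int by simp
  have xi: "\<bar>(x \<bullet> i) * G n x\<bar> \<le> 1" if "x \<in> ball 0 1" "i \<in> Basis" for x i n
    unfolding abs_mult using Basis_le_norm[OF that(2), of x] that G_bound[OF that(1)]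
    by (intro mult_le_one) auto
  have xi_meas: "(\<lambda>x. (x \<bullet> i) * G n x) \<in> borel_measurable ball_leb" for i n
    by (intro ball_leb_continuous_measurable continuous_intros cont)
  have xii: "\<bar>G n x + D n x * (x \<bullet> i)\<^sup>2\<bar> \<le> 1 + 8 * k" if "x \<in> ball 0 1" "i \<in> Basis" for x i n
  proof -
    have "(x \<bullet> i)\<^sup>2 \<le> x \<bullet> x"
      using Basis_le_norm[OF that(2), of x] by (simp add: power2_norm_eq_inner[symmetric] abs_le_square_iff[symmetric])
    then have "\<bar>D n x * (x \<bullet> i)\<^sup>2\<bar> \<le> \<bar>D n x * (x \<bullet> x)\<bar>" by (simp add: abs_mult mult_left_mono)
    then show ?thesis using D_bound[OF that(1), of n] G_bound[OF that(1), of n] by linarith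
  qed
  have xii_meas: "(\<lambda>x. G n x + D n x * (x \<bullet> i)\<^sup>2) \<in> borel_measurable ball_leb" for i n
    by (intro ball_leb_continuous_measurable continuous_intros cont)
  have xx_sum: "(\<Sum>i\<in>Basis. (x \<bullet> i)\<^sup>2) = x \<bullet> x" for x :: 'a
    by (subst euclidean_inner) (simp add: power2_eq_square)
  have xg_sum: "(\<Sum>i\<in>Basis. (g x \<bullet> i) * ((x \<bullet> i) * c)) = (x \<bullet> g x) * c" for x c
    by (simp add: euclidean_inner[of x "g x"] sum_distrib_left mult_ac)
  \<comment> \<open>The component functions \<open>(x \<bullet> i) * G n x\<close> are admissible
    tests. Summing their identities over \<open>i\<close> assembles the divergence
    \<open>N * G + D * (x \<bullet> x)\<close> of the field
    \<open>G n x *\<^sub>R x\<close>.\<close>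
  have step: "(LINT x|ball_leb. \<psi> x * (DIM('a) * G n x + D n x * (x \<bullet> x))) = - (LINT x|ball_leb. (x \<bullet> g x) * G n x)"
    if n: "0 < n" for n
  proof -
    have "(LINT x|ball_leb. \<psi> x * (DIM('a) * G n x + D n x * (x \<bullet> x)))
        = (LINT x|ball_leb. (\<Sum>i\<in>Basis. \<psi> x * (G n x + D n x * (x \<bullet> i)\<^sup>2)))"
      by (simp add: sum_distrib_left[symmetric] sum.distrib xx_sum)
    also have "\<dots> = (\<Sum>i\<in>Basis. LINT x|ball_leb. \<psi> x * (G n x + D n x * (x \<bullet> i)\<^sup>2))"
      by (intro Bochner_Integration.integral_sum integrable_bounded_mult[OF \<psi>_int xii_meas xii]) auto
    also have "\<dots> = (\<Sum>i\<in>Basis. - (LINT x|ball_leb. (g x \<bullet> i) * ((x \<bullet> i) * G n x)))"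
      using g test[OF n] by (intro sum.cong refl) (simp add: is_weak_gradient_def frechet[symmetric])
    also have "\<dots> = - (LINT x|ball_leb. (\<Sum>i\<in>Basis. (g x \<bullet> i) * ((x \<bullet> i) * G n x)))"
      unfolding sum_negf
      by (subst Bochner_Integration.integral_sum) (auto intro!: integrable_bounded_mult[OF gi_int xi_meas xi])
    also have "(\<lambda>x. \<Sum>i\<in>Basis. (g x \<bullet> i) * ((x \<bullet> i) * G n x)) = (\<lambda>x. (x \<bullet> g x) * G n x)"
      using xg_sum by simp
    finally show ?thesis .
  qed
  note xg_int = integrable_inner_id[OF g_int]
  have lim1: "(\<lambda>n. LINT x|ball_leb. \<psi> x * (DIM('a) * G n x + D n x * (x \<bullet> x))) \<longlonglongrightarrow>
      (LINT x|ball_leb. \<psi> x * (DIM('a) * ((x \<bullet> x) ^ k - 1) + 2 * k * (x \<bullet> x) ^ k))"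
  proof (rule integral_dominated_convergence[where w="\<lambda>x. \<bar>\<psi> x\<bar> * (DIM('a) + 8 * k)"])
    show "AE x in ball_leb. (\<lambda>n. \<psi> x * (DIM('a) * G n x + D n x * (x \<bullet> x))) \<longlonglongrightarrow>
        \<psi> x * (DIM('a) * ((x \<bullet> x) ^ k - 1) + 2 * k * (x \<bullet> x) ^ k)"
      by (intro AE_I2 tendsto_intros G_lim D_lim) auto
    show "AE x in ball_leb. norm (\<psi> x * (DIM('a) * G n x + D n x * (x \<bullet> x))) \<le> \<bar>\<psi> x\<bar> * (DIM('a) + 8 * k)" for n
    proof (rule AE_I2)
      fix x :: 'a assume "x \<in> space ball_leb"
      then have x: "x \<in> ball 0 1" by simp
      have "\<bar>DIM('a) * G n x\<bar> \<le> real DIM('a) * 1" unfolding abs_mult using G_bound[OF x] by (intro mult_mono) auto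
      then have "\<bar>DIM('a) * G n x + D n x * (x \<bullet> x)\<bar> \<le> DIM('a) + 8 * k" using D_bound[OF x, of n] by linarith
      then show "norm (\<psi> x * (DIM('a) * G n x + D n x * (x \<bullet> x))) \<le> \<bar>\<psi> x\<bar> * (DIM('a) + 8 * k)"
        unfolding real_norm_def abs_mult by (intro mult_left_mono) auto
    qed
    show "integrable ball_leb (\<lambda>x. \<bar>\<psi> x\<bar> * (DIM('a) + 8 * k))" using \<psi>_int by simp
  qed (intro borel_measurable_times borel_measurable_add borel_measurable_const meas
      borel_measurable_integrable[OF \<psi>_int] ball_leb_continuous_measurable continuous_intros)+
  have lim2: "(\<lambda>n. - (LINT x|ball_leb. (x \<bullet> g x) * G n x)) \<longlonglongrightarrow> - (LINT x|ball_leb. (x \<bullet> g x) * ((x \<bullet> x) ^ k - 1))"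
  proof (intro tendsto_minus integral_dominated_convergence[where w="\<lambda>x. \<bar>x \<bullet> g x\<bar>"])
    show "AE x in ball_leb. (\<lambda>n. (x \<bullet> g x) * G n x) \<longlonglongrightarrow> (x \<bullet> g x) * ((x \<bullet> x) ^ k - 1)"
      by (intro AE_I2 tendsto_intros G_lim) auto
    show "AE x in ball_leb. norm ((x \<bullet> g x) * G n x) \<le> \<bar>x \<bullet> g x\<bar>" for n
      using G_bound by (intro AE_I2) (auto simp: abs_mult intro!: mult_left_le)
    show "integrable ball_leb (\<lambda>x. \<bar>x \<bullet> g x\<bar>)" using xg_int by simp
  qed (intro borel_measurable_times borel_measurable_integrable[OF xg_int] meas
      ball_leb_continuous_measurable continuous_intros)+
  have ev: "\<forall>\<^sub>F n in sequentially. (LINT x|ball_leb. \<psi> x * (DIM('a) * G n x + D n x * (x \<bullet> x)))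
      = - (LINT x|ball_leb. (x \<bullet> g x) * G n x)"
    using eventually_gt_at_top[of 0] by eventually_elim (rule step)
  have "(LINT x|ball_leb. \<psi> x * (DIM('a) * ((x \<bullet> x) ^ k - 1) + 2 * k * (x \<bullet> x) ^ k))
      = - (LINT x|ball_leb. (x \<bullet> g x) * ((x \<bullet> x) ^ k - 1))"
    by (rule LIMSEQ_unique[OF iffD1[OF tendsto_cong[OF ev] lim1] lim2])
  then show ?thesis by (simp add: algebra_simps)
qed

text \<open>Approximating \<open>H\<close> composed with the square root leaves only even powers of
  the radius, whose radial extensions are smooth at the origin and can enter test functions.\<close>

lemma sqrt_polynomial_approx:
  fixes H :: "real \<Rightarrow> real"
  assumes H: "continuous_on {0..1} H" and \<epsilon>: "0 < \<epsilon>"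
  obtains c :: "nat \<Rightarrow> real" and m where "\<And>r. r \<in> {0..1} \<Longrightarrow> \<bar>H r - (\<Sum>k\<le>m. c k * (r\<^sup>2) ^ k)\<bar> < \<epsilon>"
proof -
  have "continuous_on {0..1} (\<lambda>t. H (sqrt t))"
    by (rule continuous_on_compose2[OF H]) (auto intro!: continuous_intros)
  then obtain P where P: "real_polynomial_function P" "\<And>t. t \<in> {0..1} \<Longrightarrow> \<bar>H (sqrt t) - P t\<bar> < \<epsilon>"
    using Stone_Weierstrass_real_polynomial_function[OF compact_Icc _ \<epsilon>] by metis
  from P(1) obtain c m where c: "P = (\<lambda>t. \<Sum>k\<le>m. c k * t ^ k)"
    unfolding real_polynomial_function_iff_sum by blast
  show thesis
  proof (rule that)
    fix r :: real assume "r \<in> {0..1}"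
    then show "\<bar>H r - (\<Sum>k\<le>m. c k * (r\<^sup>2) ^ k)\<bar> < \<epsilon>"
      using P(2)[of "r\<^sup>2"] by (simp add: c power_le_one)
  qed
qed

lemma ravg_monomial: "0 < N \<Longrightarrow> ravg N (\<lambda>r. (r\<^sup>2) ^ k) r = (r\<^sup>2) ^ k / (N + 2 * k)"
proof -
  assume N: "0 < N"
  have "((\<lambda>t. t ^ (N - 1 + 2 * k)) has_integral 1 ^ (N + 2 * k) / (N + 2 * k) - 0 ^ (N + 2 * k) / (N + 2 * k)) {0..1::real}"
  proof (intro fundamental_theorem_of_calculus)
    fix t :: real
    have "((\<lambda>t. t ^ (N + 2 * k) / (N + 2 * k)) has_real_derivative real (N + 2 * k) * t ^ (N + 2 * k - 1) / (N + 2 * k)) (at t within {0..1})"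
      by (auto intro!: derivative_eq_intros)
    moreover have "N + 2 * k - 1 = N - 1 + 2 * k" using N by simp
    ultimately show "((\<lambda>t. t ^ (N + 2 * k) / (N + 2 * k)) has_vector_derivative t ^ (N - 1 + 2 * k)) (at t within {0..1})"
      using N by (simp add: has_real_derivative_iff_has_vector_derivative[symmetric])
  qed simp
  then have "integral {0..1::real} (\<lambda>t. t ^ (N - 1 + 2 * k)) = 1 / (N + 2 * k)"
    using N by (simp add: integral_unique)
  moreover have "(\<lambda>t. t ^ (N - 1) * ((r * t)\<^sup>2) ^ k) = (\<lambda>t. (r\<^sup>2) ^ k * t ^ (N - 1 + 2 * k))"
    by (simp add: power_mult_distrib power_add mult_ac flip: power_mult)
  ultimately show ?thesis by (simp add: ravg_def)
qed

lemma ravg_cmult: "ravg N (\<lambda>t. c * f t) r = c * ravg N f r"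
proof -
  have "(\<lambda>t. t ^ (N - 1) * (c * f (r * t))) = (\<lambda>t. c * (t ^ (N - 1) * f (r * t)))" by (simp add: mult_ac)
  then show ?thesis unfolding ravg_def by (simp only: integral_mult_right)
qed

lemma ravg_add:
  assumes "continuous_on {0..1} f" "continuous_on {0..1} g" "r \<in> {0..1}"
  shows "ravg N (\<lambda>t. f t + g t) r = ravg N f r + ravg N g r"
proof -
  have "ravg N (\<lambda>t. f t + g t) r - ravg N g r = ravg N f r"
    using assms by (subst ravg_diff) (auto intro!: continuous_intros)
  then show ?thesis by simp
qed

lemma ravg_abs_le:
  assumes f: "continuous_on {0..1} f" and r: "r \<in> {0..1}" and N: "0 < N"
    and le: "\<And>t. t \<in> {0..1} \<Longrightarrow> \<bar>f t\<bar> \<le> B"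
  shows "\<bar>ravg N f r\<bar> \<le> B"
proof -
  have le': "- B \<le> f t" "f t \<le> B" if "t \<in> {0..r}" for t using le[of t] that r by auto
  have "ravg N (\<lambda>_. - B) r \<le> ravg N f r" "ravg N f r \<le> ravg N (\<lambda>_. B) r"
    by (intro ravg_mono continuous_on_const f r le'; assumption)+
  then have "\<bar>ravg N f r\<bar> \<le> B / N" using N by (simp add: ravg_const abs_le_iff)
  moreover have "0 \<le> B" using le[of 0] by simp
  then have "B / N \<le> B" using mult_left_mono[of 1 "real N" B] N by (simp add: divide_simps)
  ultimately show ?thesis by simp
qed

text \<open>\<open>ravg N H (\<bar>x\<bar>) x\<close> is the radial field with divergence \<open>H (\<bar>x\<bar>)\<close>; subtracting the constant
  \<open>ravg N H 1\<close> makes it vanish on the sphere, so both sides are linear in an unrestricted \<open>H\<close>.\<close>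

lemma radial_flux_identity:
  fixes \<psi> :: "'a::euclidean_space \<Rightarrow> real"
  assumes g: "is_weak_gradient \<psi> g" and \<psi>_int: "integrable ball_leb \<psi>" and g_int: "integrable ball_leb g"
    and H: "continuous_on {0..1} H" "ravg DIM('a) H 1 = 0"
  shows "(LINT x|ball_leb. \<psi> x * H (norm x)) = - (LINT x|ball_leb. (x \<bullet> g x) * ravg DIM('a) H (norm x))"
proof -
  let ?N = "DIM('a)"
  have N: "0 < ?N" by simp
  note xg_int = integrable_inner_id[OF g_int]
  \<comment> \<open>With \<open>c = ravg N K 1\<close>, the field
    \<open>(ravg N K (norm x) - c) x\<close> has divergence \<open>K (norm x) - N * c\<close>;
    \<open>L2\<close> and \<open>L1\<close> are these two coefficients.\<close>
  define L1 where "L1 K x = K (norm x) - ?N * ravg ?N K 1" for K and x :: 'a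
  define L2 where "L2 K x = ravg ?N K (norm x) - ravg ?N K 1" for K and x :: 'a
  \<comment> \<open>This is the defect in the divergence identity. It is linear in \<open>K\<close>,
    zero on even monomials and bounded by a multiple of the sup norm, hence zero on all continuous
    \<open>K\<close>.\<close>
  define \<Lambda> where "\<Lambda> K = (LINT x|ball_leb. \<psi> x * L1 K x + (x \<bullet> g x) * L2 K x)" for K
  have norm_cont: "continuous_on (ball 0 1) (\<lambda>x::'a. K (norm x))" if "continuous_on {0..1} K" for K :: "real \<Rightarrow> real"
    by (rule continuous_on_compose2[OF that]) (auto intro!: continuous_intros)
  have L_meas: "L1 K \<in> borel_measurable ball_leb" "L2 K \<in> borel_measurable ball_leb" if K: "continuous_on {0..1} K" for K
    unfolding L1_def[abs_def] L2_def[abs_def]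
    by (intro ball_leb_continuous_measurable continuous_intros norm_cont continuous_on_ravg K)+
  have L_bound: "\<bar>L1 K x\<bar> \<le> (1 + real ?N) * B" "\<bar>L2 K x\<bar> \<le> 2 * B"
    if K: "continuous_on {0..1} K" and B: "\<And>t. t \<in> {0..1} \<Longrightarrow> \<bar>K t\<bar> \<le> B" and x: "x \<in> space ball_leb" for K B x
  proof -
    have x': "norm x \<in> {0..1}" using x by simp
    have 1: "\<bar>ravg ?N K 1\<bar> \<le> B" and 2: "\<bar>ravg ?N K (norm x)\<bar> \<le> B"
      using x' by (auto intro!: ravg_abs_le[OF K _ N B])
    have "\<bar>?N * ravg ?N K 1\<bar> \<le> ?N * B" using 1 by (simp add: abs_mult)
    then show "\<bar>L1 K x\<bar> \<le> (1 + real ?N) * B"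
      using B[OF x'] unfolding L1_def distrib_right by linarith
    show "\<bar>L2 K x\<bar> \<le> 2 * B" using 1 2 unfolding L2_def by linarith
  qed
  have bounded: "\<exists>B. \<forall>t\<in>{0..1}. \<bar>K t\<bar> \<le> B" if "continuous_on {0..1} K" for K :: "real \<Rightarrow> real"
    using compact_imp_bounded[OF compact_continuous_image[OF that compact_Icc]]
    by (auto simp: bounded_iff)
  have L_int: "integrable ball_leb (\<lambda>x. \<psi> x * L1 K x)" "integrable ball_leb (\<lambda>x. (x \<bullet> g x) * L2 K x)"
    if K: "continuous_on {0..1} K" for K
  proof -
    obtain B where B: "\<And>t. t \<in> {0..1} \<Longrightarrow> \<bar>K t\<bar> \<le> B" using bounded[OF K] by blast
    show "integrable ball_leb (\<lambda>x. \<psi> x * L1 K x)"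
      by (rule integrable_bounded_mult[OF \<psi>_int L_meas(1)[OF K] L_bound(1)[OF K B]])
    show "integrable ball_leb (\<lambda>x. (x \<bullet> g x) * L2 K x)"
      by (rule integrable_bounded_mult[OF xg_int L_meas(2)[OF K] L_bound(2)[OF K B]])
  qed
  have \<Lambda>_eq: "\<Lambda> K = (LINT x|ball_leb. \<psi> x * L1 K x) + (LINT x|ball_leb. (x \<bullet> g x) * L2 K x)"
    if "continuous_on {0..1} K" for K
    unfolding \<Lambda>_def by (rule Bochner_Integration.integral_add[OF L_int[OF that]])
  have \<Lambda>_monomial: "\<Lambda> (\<lambda>r. (r\<^sup>2) ^ k) = 0" for k
  proof -
    let ?c = "?N + 2 * real k"
    have c: "0 < ?c" using N by (simp add: add_pos_nonneg)
    have L1: "L1 (\<lambda>r. (r\<^sup>2) ^ k) x = (?c * (x \<bullet> x) ^ k - ?N) / ?c" for x :: 'a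
      using c by (simp add: L1_def ravg_monomial[OF N] power2_norm_eq_inner diff_divide_distrib)
    have L2: "L2 (\<lambda>r. (r\<^sup>2) ^ k) x = ((x \<bullet> x) ^ k - 1) / ?c" for x :: 'a
      using c by (simp add: L2_def ravg_monomial[OF N] power2_norm_eq_inner diff_divide_distrib)
    have "\<Lambda> (\<lambda>r. (r\<^sup>2) ^ k) = (LINT x|ball_leb. \<psi> x * (?c * (x \<bullet> x) ^ k - ?N)) / ?c
        + (LINT x|ball_leb. (x \<bullet> g x) * ((x \<bullet> x) ^ k - 1)) / ?c"
      by (subst \<Lambda>_eq) (auto intro!: continuous_intros simp: L1 L2)
    also have "\<dots> = 0" using monomial_flux_identity[OF g \<psi>_int g_int, of k] by simp
    finally show ?thesis .
  qed
  have \<Lambda>_cmult: "\<Lambda> (\<lambda>r. c * K r) = c * \<Lambda> K" for c K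
  proof -
    have "(\<lambda>x. \<psi> x * L1 (\<lambda>r. c * K r) x + (x \<bullet> g x) * L2 (\<lambda>r. c * K r) x)
        = (\<lambda>x. c * (\<psi> x * L1 K x + (x \<bullet> g x) * L2 K x))"
      by (simp add: L1_def L2_def ravg_cmult algebra_simps)
    then show ?thesis by (simp add: \<Lambda>_def)
  qed
  have \<Lambda>_add: "\<Lambda> (\<lambda>r. J r + K r) = \<Lambda> J + \<Lambda> K"
    if J: "continuous_on {0..1} J" and K: "continuous_on {0..1} K" for J K
  proof -
    have "\<Lambda> (\<lambda>r. J r + K r) = (LINT x|ball_leb. (\<psi> x * L1 J x + (x \<bullet> g x) * L2 J x) + (\<psi> x * L1 K x + (x \<bullet> g x) * L2 K x))"
      unfolding \<Lambda>_def
      by (intro Bochner_Integration.integral_cong refl)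
         (simp add: L1_def L2_def ravg_add[OF J K] algebra_simps)
    then show ?thesis
      unfolding \<Lambda>_def using L_int[OF J] L_int[OF K]
      by (simp add: Bochner_Integration.integral_add Bochner_Integration.integrable_add)
  qed
  have \<Lambda>_poly: "\<Lambda> (\<lambda>r. \<Sum>k\<le>m. c k * (r\<^sup>2) ^ k) = 0" for c :: "nat \<Rightarrow> real" and m
  proof (induction m)
    case 0
    show ?case using \<Lambda>_cmult[of "c 0" "\<lambda>r. (r\<^sup>2) ^ 0"] \<Lambda>_monomial[of 0] by simp
  next
    case (Suc m)
    have cont: "continuous_on {0..1} (\<lambda>r::real. \<Sum>k\<le>m. c k * (r\<^sup>2) ^ k)"
      "continuous_on {0..1} (\<lambda>r::real. c (Suc m) * (r\<^sup>2) ^ Suc m)"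
      by (intro continuous_intros)+
    have "\<Lambda> (\<lambda>r. (\<Sum>k\<le>m. c k * (r\<^sup>2) ^ k) + c (Suc m) * (r\<^sup>2) ^ Suc m) = 0 + c (Suc m) * 0"
      by (simp only: \<Lambda>_add[OF cont] \<Lambda>_cmult \<Lambda>_monomial Suc)
    then show ?case by simp
  qed
  define C where "C = (LINT x|ball_leb. \<bar>\<psi> x\<bar> * (1 + real ?N) + \<bar>x \<bullet> g x\<bar> * 2)"
  have \<Lambda>_bound: "\<bar>\<Lambda> K\<bar> \<le> C * B" if K: "continuous_on {0..1} K" and B: "\<And>t. t \<in> {0..1} \<Longrightarrow> \<bar>K t\<bar> \<le> B" for K B
  proof -
    have "\<bar>\<Lambda> K\<bar> \<le> (LINT x|ball_leb. \<bar>\<psi> x\<bar> * ((1 + real ?N) * B) + \<bar>x \<bullet> g x\<bar> * (2 * B))"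
      unfolding \<Lambda>_def
    proof (rule Bochner_Integration.integral_abs_bound_integral)
      fix x :: 'a assume x: "x \<in> space ball_leb"
      have "\<bar>\<psi> x * L1 K x + (x \<bullet> g x) * L2 K x\<bar> \<le> \<bar>\<psi> x\<bar> * \<bar>L1 K x\<bar> + \<bar>x \<bullet> g x\<bar> * \<bar>L2 K x\<bar>"
        unfolding abs_mult[symmetric] by (rule abs_triangle_ineq)
      also have "\<dots> \<le> \<bar>\<psi> x\<bar> * ((1 + real ?N) * B) + \<bar>x \<bullet> g x\<bar> * (2 * B)"
        by (intro add_mono mult_left_mono L_bound[OF K B x]) auto
      finally show "\<bar>\<psi> x * L1 K x + (x \<bullet> g x) * L2 K x\<bar> \<le> \<bar>\<psi> x\<bar> * ((1 + real ?N) * B) + \<bar>x \<bullet> g x\<bar> * (2 * B)" .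
    qed (use L_int[OF K] \<psi>_int xg_int in simp_all)
    also have "\<dots> = (LINT x|ball_leb. (\<bar>\<psi> x\<bar> * (1 + real ?N) + \<bar>x \<bullet> g x\<bar> * 2) * B)"
      by (simp add: distrib_right mult.assoc)
    also have "\<dots> = C * B" unfolding C_def by simp
    finally show ?thesis .
  qed
  have C: "0 \<le> C" unfolding C_def by (intro Bochner_Integration.integral_nonneg) auto
  have "\<bar>\<Lambda> H\<bar> \<le> C * \<epsilon>" if \<epsilon>: "0 < \<epsilon>" for \<epsilon>
  proof -
    obtain c m where c: "\<And>r. r \<in> {0..1} \<Longrightarrow> \<bar>H r - (\<Sum>k\<le>m. c k * (r\<^sup>2) ^ k)\<bar> < \<epsilon>"
      using sqrt_polynomial_approx[OF H(1) \<epsilon>] by blast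
    have P: "continuous_on {0..1} (\<lambda>r. \<Sum>k\<le>m. c k * (r\<^sup>2) ^ k)"
      by (intro continuous_intros)
    have "\<Lambda> H = \<Lambda> (\<lambda>r. (H r - (\<Sum>k\<le>m. c k * (r\<^sup>2) ^ k)) + (\<Sum>k\<le>m. c k * (r\<^sup>2) ^ k))" by simp
    also have "\<dots> = \<Lambda> (\<lambda>r. H r - (\<Sum>k\<le>m. c k * (r\<^sup>2) ^ k)) + 0"
      by (subst \<Lambda>_add[OF continuous_on_diff[OF H(1) P] P]) (simp only: \<Lambda>_poly)
    finally show ?thesis
      using \<Lambda>_bound[OF continuous_on_diff[OF H(1) P], of \<epsilon>] c by (force intro: less_imp_le)
  qed
  note small = this
  have "\<Lambda> H = 0"
  proof (cases "C = 0")
    case True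
    then show ?thesis using small[of 1] by simp
  next
    case False
    then have "0 < C" using C by simp
    then show ?thesis using small[of "\<bar>\<Lambda> H\<bar> / (2 * C)"] by (cases "\<Lambda> H = 0") simp_all
  qed
  then show ?thesis unfolding \<Lambda>_eq[OF H(1)] by (simp add: L1_def L2_def H(2))
qed

section \<open>Weak gradients of Lipschitz functions\<close>

lemma integral_lborel_translation:
  fixes f :: "'a::euclidean_space \<Rightarrow> real"
  assumes "f \<in> borel_measurable borel"
  shows "(LINT x|lborel. f (c + x)) = (LINT x|lborel. f x)"
proof -
  have "(LINT x|lborel. f x) = (LINT x|distr lborel borel ((+) c). f x)" by (simp add: lborel_distr_plus)
  also have "\<dots> = (LINT x|lborel. f (c + x))" using assms by (intro integral_distr) auto
  finally show ?thesis by simp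
qed

lemma has_derivative_imp_quotient_tendsto:
  fixes w :: "'a::euclidean_space \<Rightarrow> real"
  assumes "(w has_derivative D) (at x)"
  shows "(\<lambda>n. (w (x + (1 / (real n + 1)) *\<^sub>R i) - w x) / (1 / (real n + 1))) \<longlonglongrightarrow> D i"
proof -
  have D: "(w has_derivative D) (at (x + 0 *\<^sub>R i))" using assms by simp
  have "((\<lambda>t. w (x + t *\<^sub>R i)) has_derivative (\<lambda>t. D (t *\<^sub>R i))) (at 0)"
    using D by (intro has_derivative_compose[of "\<lambda>t. x + t *\<^sub>R i" "\<lambda>t. t *\<^sub>R i" 0 UNIV w D])
      (auto intro!: derivative_eq_intros)
  moreover have "(\<lambda>t. D (t *\<^sub>R i)) = (*) (D i)"
    using has_derivative_linear[OF assms] by (auto simp: linear_scale mult.commute)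
  ultimately have "((\<lambda>h. (w (x + h *\<^sub>R i) - w x) / h) \<longlongrightarrow> D i) (at 0)"
    by (simp add: has_field_derivative_def[symmetric] DERIV_def)
  moreover have "filterlim (\<lambda>n. 1 / (real n + 1)) (at 0) sequentially"
    unfolding filterlim_at using LIMSEQ_inverse_real_of_nat
    by (auto simp: inverse_eq_divide add.commute)
  ultimately show ?thesis by (rule filterlim_compose)
qed

lemma LINT_ball_compact:
  fixes F :: "'a::euclidean_space \<Rightarrow> real"
  assumes S: "compact S" "S \<subseteq> ball 0 1" "\<And>x. x \<notin> S \<Longrightarrow> F x = 0" and F: "continuous_on S F"
  shows "integrable lborel F" "(LINT x|ball_leb. F x) = (LINT x|lborel. F x)"
proof -
  have eq: "(\<lambda>x. indicator S x *\<^sub>R F x) = F" using S(3) by (auto simp: fun_eq_iff split: split_indicator)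
  show int: "integrable lborel F" using borel_integrable_compact[OF S(1) F] by (simp only: eq)
  have "(LINT x|ball_leb. F x) = (LINT x|lebesgue. F x)"
    using LINT_ball_eq[OF S(2,3)] eq by simp
  also have "\<dots> = (LINT x|lborel. F x)" using int by (intro integral_completion) auto
  finally show "(LINT x|ball_leb. F x) = (LINT x|lborel. F x)" .
qed

text \<open>The integrals of the difference quotients of \<open>u \<phi>\<close> vanish by translation invariance.\<close>

lemma lipschitz_is_weak_gradient:
  fixes u :: "'a::euclidean_space \<Rightarrow> real"
  assumes lip: "L-lipschitz_on UNIV u" and bound: "\<And>x. \<bar>u x\<bar> \<le> M"
    and deriv: "\<And>x. x \<in> ball 0 1 \<Longrightarrow> x \<noteq> 0 \<Longrightarrow> (u has_derivative (\<lambda>y. g x \<bullet> y)) (at x)"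
    and g: "continuous_on (ball 0 1) g"
  shows "is_weak_gradient u g"
  unfolding is_weak_gradient_def
proof (intro conjI allI impI ballI)
  have u_cont: "continuous_on A u" for A
    using lipschitz_on_continuous_on[OF lip] continuous_on_subset by blast
  have abs_int: "f absolutely_integrable_on K"
    if "compact K" "continuous_on K f" for K and f :: "'a \<Rightarrow> 'b::euclidean_space"
    using borel_integrable_compact[OF that] unfolding set_integrable_def
    by (subst integrable_completion) auto
  show "u absolutely_integrable_on K" "g absolutely_integrable_on K" if "compact K \<and> K \<subseteq> ball 0 1" for K
    using that by (auto intro!: abs_int u_cont continuous_on_subset[OF g])
  fix \<phi> :: "'a \<Rightarrow> real" and i :: 'a
  assume \<phi>: "\<phi> \<in> test_functions" and i: "i \<in> Basis"
  define S where "S = closure {x. \<phi> x \<noteq> 0}"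
  have S: "compact S" "S \<subseteq> ball 0 1" "\<And>x. x \<notin> S \<Longrightarrow> \<phi> x = 0"
    using \<phi> closure_subset[of "{x. \<phi> x \<noteq> 0}"] by (auto simp: S_def test_functions_def)
  have Ck: "Ck_fun k \<phi>" for k using \<phi> unfolding test_functions_def by blast
  note \<phi>_deriv = Ck_fun_Suc_has_derivative[OF Ck[of "Suc 0"]]
  define \<phi>' where "\<phi>' x = frechet_derivative \<phi> (at x) i" for x
  have \<phi>'_cont: "continuous_on A \<phi>'" for A
    using Ck[of "Suc 0"] i continuous_on_subset by (auto simp: \<phi>'_def[abs_def])
  have \<phi>_cont: "continuous_on A \<phi>" for A using Ck[of 0] continuous_on_subset by auto
  have \<phi>'_0: "\<phi>' x = 0" if x: "x \<notin> S" for x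
  proof -
    have "(\<phi> has_derivative (\<lambda>_. 0)) (at x)"
      by (rule has_derivative_transform_within_open[where s="- S", OF has_derivative_const[of 0]])
         (use S x compact_imp_closed[OF S(1)] in auto)
    then show ?thesis unfolding \<phi>'_def by (simp add: frechet_derivative_eqI)
  qed
  have "bounded (\<phi> ` S)" "bounded (\<phi>' ` S)"
    using S(1) \<phi>_cont \<phi>'_cont by (auto intro!: compact_imp_bounded compact_continuous_image)
  then obtain B B' where "\<And>x. x \<in> S \<Longrightarrow> \<bar>\<phi> x\<bar> \<le> B" "\<And>x. x \<in> S \<Longrightarrow> \<bar>\<phi>' x\<bar> \<le> B'"
    by (auto simp: bounded_iff)
  then have B: "\<bar>\<phi> x\<bar> \<le> max 0 B" "\<bar>\<phi>' x\<bar> \<le> max 0 B'" for x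
    using S(3)[of x] \<phi>'_0[of x] by (cases "x \<in> S"; fastforce)+
  have \<phi>_lip: "\<bar>\<phi> (x + h *\<^sub>R i) - \<phi> x\<bar> \<le> max 0 B' * \<bar>h\<bar>" for x h
  proof -
    have D: "((\<lambda>t. \<phi> (x + t *\<^sub>R i)) has_field_derivative \<phi>' (x + t *\<^sub>R i)) (at t within UNIV)" for t
    proof -
      have "((\<lambda>t. \<phi> (x + t *\<^sub>R i)) has_derivative (\<lambda>s. frechet_derivative \<phi> (at (x + t *\<^sub>R i)) (s *\<^sub>R i))) (at t)"
        using \<phi>_deriv by (intro has_derivative_compose[of "\<lambda>t. x + t *\<^sub>R i" "\<lambda>t. t *\<^sub>R i" t UNIV \<phi>])
          (auto intro!: derivative_eq_intros)
      moreover have "(\<lambda>s. frechet_derivative \<phi> (at (x + t *\<^sub>R i)) (s *\<^sub>R i)) = (*) (\<phi>' (x + t *\<^sub>R i))"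
        using has_derivative_linear[OF \<phi>_deriv] by (auto simp: linear_scale mult.commute \<phi>'_def)
      ultimately show ?thesis by (simp add: has_field_derivative_def)
    qed
    have "norm (\<phi> (x + h *\<^sub>R i) - \<phi> (x + 0 *\<^sub>R i)) \<le> max 0 B' * norm (h - 0)"
      by (rule field_differentiable_bound[OF convex_UNIV D]) (use B(2) in auto)
    then show ?thesis by simp
  qed
  have L: "0 \<le> L" "\<And>x y. \<bar>u x - u y\<bar> \<le> L * dist x y"
    using lip by (auto simp: lipschitz_on_def dist_real_def)
  define w where "w x = u x * \<phi> x" for x
  define C where "C = \<bar>M\<bar> * max 0 B' + max 0 B * L"
  have w_lip: "\<bar>w (x + h *\<^sub>R i) - w x\<bar> \<le> C * \<bar>h\<bar>" for x h
  proof -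
    have "w (x + h *\<^sub>R i) - w x = u (x + h *\<^sub>R i) * (\<phi> (x + h *\<^sub>R i) - \<phi> x) + \<phi> x * (u (x + h *\<^sub>R i) - u x)"
      by (simp add: w_def algebra_simps)
    also have "\<bar>\<dots>\<bar> \<le> \<bar>u (x + h *\<^sub>R i)\<bar> * \<bar>\<phi> (x + h *\<^sub>R i) - \<phi> x\<bar> + \<bar>\<phi> x\<bar> * \<bar>u (x + h *\<^sub>R i) - u x\<bar>"
      unfolding abs_mult[symmetric] by (rule abs_triangle_ineq)
    also have "\<dots> \<le> \<bar>M\<bar> * (max 0 B' * \<bar>h\<bar>) + max 0 B * (L * \<bar>h\<bar>)"
      using bound[of "x + h *\<^sub>R i"] B(1)[of x] \<phi>_lip[of x h] L(2)[of "x + h *\<^sub>R i" x] i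
      by (intro add_mono mult_mono) (auto simp: dist_norm)
    finally show ?thesis by (simp add: C_def algebra_simps)
  qed
  have C: "0 \<le> C" using L by (simp add: C_def)
  have w_cont: "continuous_on A w" for A unfolding w_def by (intro continuous_intros u_cont \<phi>_cont)
  have w_0: "w x = 0" if "x \<notin> S" for x using S(3)[OF that] by (simp add: w_def)
  have w_meas: "w \<in> borel_measurable borel" by (rule borel_measurable_continuous_onI[OF w_cont])
  \<comment> \<open>Steps of length at most \<open>1\<close> keep the shifted support inside
    \<open>cball 0 2\<close>, so one integrable function dominates all difference quotients.\<close>
  define h where "h n = 1 / (real n + 1)" for n
  have h: "0 < h n" "h n \<le> 1" for n by (auto simp: h_def)
  define Q where "Q n x = (w (x + h n *\<^sub>R i) - w x) / h n" for n x
  define G where "G x = (g x \<bullet> i) * \<phi> x" for x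
  have G_cont: "continuous_on S G" unfolding G_def
    by (intro continuous_intros \<phi>_cont continuous_on_subset[OF g] S)
  have G: "integrable lborel G" "(LINT x|ball_leb. G x) = (LINT x|lborel. G x)"
    by (rule LINT_ball_compact[OF S(1,2) _ G_cont], simp add: G_def S(3))+
  have u\<phi>': "integrable lborel (\<lambda>x. u x * \<phi>' x)" "(LINT x|ball_leb. u x * \<phi>' x) = (LINT x|lborel. u x * \<phi>' x)"
    by (rule LINT_ball_compact[OF S(1,2)], auto simp: \<phi>'_0 intro!: continuous_intros u_cont \<phi>'_cont)+
  have "(\<lambda>n. LINT x|lborel. Q n x) \<longlonglongrightarrow> (LINT x|lborel. u x * \<phi>' x + G x)"
  proof (rule integral_dominated_convergence[where w="\<lambda>x. indicator (cball 0 2) x *\<^sub>R C"])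
    show "(\<lambda>x. u x * \<phi>' x + G x) \<in> borel_measurable lborel"
      using u\<phi>'(1) G(1) by (intro borel_measurable_add) auto
    show "Q n \<in> borel_measurable lborel" for n
    proof -
      have "continuous_on UNIV (\<lambda>x. w (x + h n *\<^sub>R i))"
        by (rule continuous_on_compose2[OF w_cont[of UNIV]]) (auto intro!: continuous_intros)
      then have "continuous_on UNIV (Q n)"
        unfolding Q_def[abs_def] using h[of n] by (intro continuous_intros w_cont) auto
      then show ?thesis using borel_measurable_continuous_onI by simp
    qed
    show "integrable lborel (\<lambda>x::'a. indicator (cball 0 2) x *\<^sub>R C)"
      by (rule borel_integrable_compact) auto
    show "AE x in lborel. norm (Q n x) \<le> indicator (cball 0 2) x *\<^sub>R C" for n
    proof (rule AE_I2)
      fix x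
      show "norm (Q n x) \<le> indicator (cball 0 2) x *\<^sub>R C"
      proof (cases "x \<in> cball 0 2")
        case True
        then show ?thesis using w_lip[of x "h n"] h[of n] by (simp add: Q_def divide_simps)
      next
        case False
        have "norm x \<le> norm (x + h n *\<^sub>R i) + norm (h n *\<^sub>R i)"
          using norm_triangle_ineq4[of "x + h n *\<^sub>R i" "h n *\<^sub>R i"] by simp
        then have "1 < norm (x + h n *\<^sub>R i)" using False h[of n] i by simp
        then have "x \<notin> S" "x + h n *\<^sub>R i \<notin> S" using S(2) False by auto
        then show ?thesis using w_0 False by (simp add: Q_def)
      qed
    qed
    \<comment> \<open>Differentiability of \<open>u\<close> may fail at the origin, a null set; off
      the support of \<open>\<phi>\<close> the product is locally zero.\<close>
    have "AE x in lborel. x \<noteq> (0::'a)" by (rule AE_lborel_singleton)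
    then show "AE x in lborel. (\<lambda>n. Q n x) \<longlonglongrightarrow> u x * \<phi>' x + G x"
    proof eventually_elim
      case (elim x)
      show ?case
      proof (cases "x \<in> S")
        case True
        have "(w has_derivative (\<lambda>y. u x * frechet_derivative \<phi> (at x) y + (g x \<bullet> y) * \<phi> x)) (at x)"
          unfolding w_def[abs_def] using True S(2) elim by (intro has_derivative_mult deriv \<phi>_deriv) auto
        from has_derivative_imp_quotient_tendsto[OF this, of i] show ?thesis
          by (simp add: Q_def h_def G_def \<phi>'_def)
      next
        case False
        have "(w has_derivative (\<lambda>_. 0)) (at x)"
          by (rule has_derivative_transform_within_open[where s="- S", OF has_derivative_const[of 0]])
             (use S w_0 False compact_imp_closed[OF S(1)] in auto)
        from has_derivative_imp_quotient_tendsto[OF this, of i] show ?thesis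
          using False \<phi>'_0 S(3) by (simp add: Q_def h_def G_def)
      qed
    qed
  qed
  moreover have "(LINT x|lborel. Q n x) = 0" for n
  proof -
    have w_int: "integrable lborel w"
      by (rule LINT_ball_compact(1)[OF S(1,2) w_0 w_cont])
    have "integrable lborel (\<lambda>x. w (h n *\<^sub>R i + x))"
      using w_int integrable_distr_eq[of "(+) (h n *\<^sub>R i)" lborel borel w] w_meas by (simp add: lborel_distr_plus)
    then show ?thesis
      unfolding Q_def using w_int integral_lborel_translation[OF w_meas, of "h n *\<^sub>R i"]
      by (simp add: add.commute)
  qed
  ultimately have "(LINT x|lborel. u x * \<phi>' x + G x) = 0" by (simp add: LIMSEQ_const_iff)
  then have "(LINT x|lborel. u x * \<phi>' x) = - (LINT x|lborel. G x)"
    using u\<phi>'(1) G(1) by simp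
  then show "(LINT x|ball_leb. u x * frechet_derivative \<phi> (at x) i) = - (LINT x|ball_leb. (g x \<bullet> i) * \<phi> x)"
    using u\<phi>'(2) G(2) by (simp add: \<phi>'_def G_def)
qed

section \<open>Shooting\<close>

text \<open>The mean value theorem on the interval is composed with the clamp, which is 1-Lipschitz.
  Derivatives are requested only in the open interval because a power may fail to be differentiable
  at \<open>0\<close>.\<close>

lemma lipschitz_on_clip:
  fixes f :: "real \<Rightarrow> real"
  assumes ab: "a \<le> b" and cont: "continuous_on {a..b} f"
    and deriv: "\<And>x. a < x \<Longrightarrow> x < b \<Longrightarrow> (f has_real_derivative f' x) (at x)"
    and bound: "\<And>x. a < x \<Longrightarrow> x < b \<Longrightarrow> \<bar>f' x\<bar> \<le> B" and B: "0 \<le> B"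
  shows "B-lipschitz_on UNIV (\<lambda>s. f (max a (min b s)))"
proof (rule lipschitz_onI)
  have less: "\<bar>f y - f x\<bar> \<le> B * (y - x)" if "a \<le> x" "x < y" "y \<le> b" for x y
  proof -
    have "continuous_on {x..y} f" using that by (intro continuous_on_subset[OF cont]) auto
    moreover have "(f has_derivative (*) (f' z)) (at z)" if "x < z" "z < y" for z
      using deriv[of z] that \<open>a \<le> x\<close> \<open>y \<le> b\<close> by (simp add: has_field_derivative_def)
    ultimately obtain \<xi> where \<xi>: "x < \<xi>" "\<xi> < y" "f y - f x = f' \<xi> * (y - x)"
      using mvt[OF \<open>x < y\<close>, of f "\<lambda>z. (*) (f' z)"] by blast
    then show ?thesis using that bound[of \<xi>] by (auto simp: abs_mult intro: mult_right_mono)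
  qed
  have le: "\<bar>f x - f y\<bar> \<le> B * \<bar>x - y\<bar>" if "x \<in> {a..b}" "y \<in> {a..b}" for x y
    using less[of x y] less[of y x] that
    by (cases x y rule: linorder_cases) (auto simp: abs_minus_commute)
  fix s t :: real
  let ?c = "\<lambda>s. max a (min b s)"
  have "\<bar>f (?c s) - f (?c t)\<bar> \<le> B * \<bar>?c s - ?c t\<bar>"
    using ab by (intro le) auto
  also have "\<dots> \<le> B * \<bar>s - t\<bar>" using B by (intro mult_left_mono) auto
  finally show "dist (f (?c s)) (f (?c t)) \<le> B * dist s t" by (simp add: dist_real_def)
qed (rule B)

definition nlin :: "real \<Rightarrow> real \<Rightarrow> real \<Rightarrow> real" where
  "nlin p q s = s powr (p - 1) - s powr (q - 1)"

text \<open>The truncations below are inactive along the solutions that are finally used: these take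
  values in \<open>[1/4, 2]\<close> and have fluxes in \<open>[0, 1]\<close>.\<close>

definition nlin_clip :: "real \<Rightarrow> real \<Rightarrow> real \<Rightarrow> real" where
  "nlin_clip p q s = nlin p q (max (1/4) (min 2 s))"

definition flux_inv :: "real \<Rightarrow> real \<Rightarrow> real" where
  "flux_inv p y = max 0 (min 1 y) powr (1 / (p - 1))"

text \<open>The lower clamp avoids the infinite slope of \<open>s powr (p - 1)\<close> at
  \<open>0\<close>, the upper one the growth of \<open>s powr (q - 1)\<close>.\<close>

lemma nlin_clip_lipschitz:
  assumes "1 < p" "p < 2" "2 < q"
  obtains L where "1 \<le> L" "L-lipschitz_on UNIV (nlin_clip p q)"
proof -
  define B where "B = (p - 1) * (1/4) powr (p - 2) + (q - 1) * 2 powr (q - 2)"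
  have "B-lipschitz_on UNIV (\<lambda>s. nlin p q (max (1/4) (min 2 s)))"
  proof (rule lipschitz_on_clip)
    fix s :: real assume s: "1/4 < s" "s < 2"
    show "(nlin p q has_real_derivative (p - 1) * s powr (p - 2) - (q - 1) * s powr (q - 2)) (at s)"
      unfolding nlin_def[abs_def] using s by (auto intro!: derivative_eq_intros)
    have "s powr (p - 2) \<le> (1/4) powr (p - 2)" using s assms by (intro powr_mono2') auto
    moreover have "s powr (q - 2) \<le> 2 powr (q - 2)" using s assms by (intro powr_mono2) auto
    ultimately have "(p - 1) * s powr (p - 2) + (q - 1) * s powr (q - 2) \<le> B"
      unfolding B_def using assms by (intro add_mono mult_left_mono) auto
    moreover have "0 \<le> (p - 1) * s powr (p - 2)" "0 \<le> (q - 1) * s powr (q - 2)" using assms by auto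
    ultimately show "\<bar>(p - 1) * s powr (p - 2) - (q - 1) * s powr (q - 2)\<bar> \<le> B" by linarith
  qed (auto simp: nlin_def[abs_def] B_def intro!: continuous_intros add_nonneg_nonneg mult_nonneg_nonneg, use assms in auto)
  then have "(max 1 B)-lipschitz_on UNIV (nlin_clip p q)"
    unfolding nlin_clip_def[abs_def] by (rule lipschitz_on_mono) auto
  then show thesis using that by (metis max.cobounded1)
qed

text \<open>The condition \<open>p < 2\<close> enters here: the inverse of the map taking
  \<open>s\<close> to \<open>s powr (p - 1)\<close> has exponent \<open>1 / (p - 1) > 1\<close>, so
  its slope stays bounded at \<open>0\<close>.\<close>

lemma flux_inv_lipschitz:
  assumes "1 < p" "p < 2"
  shows "(1 / (p - 1))-lipschitz_on UNIV (flux_inv p)"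
  unfolding flux_inv_def[abs_def]
proof (rule lipschitz_on_clip[where f="\<lambda>y. y powr (1 / (p - 1))"])
  have e: "1 \<le> 1 / (p - 1)" using assms by (simp add: divide_simps)
  show "continuous_on {0..1} (\<lambda>y. y powr (1 / (p - 1)))"
    using assms by (intro continuous_on_powr') (auto intro: continuous_intros)
  fix y :: real assume y: "0 < y" "y < 1"
  show "((\<lambda>y. y powr (1 / (p - 1))) has_real_derivative 1 / (p - 1) * y powr (1 / (p - 1) - 1)) (at y)"
    using y by (auto intro!: derivative_eq_intros)
  have "y powr (1 / (p - 1) - 1) \<le> 1" using y e by (intro powr_le1) auto
  then show "\<bar>1 / (p - 1) * y powr (1 / (p - 1) - 1)\<bar> \<le> 1 / (p - 1)"
    using assms by (simp add: abs_mult divide_right_mono)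
qed (use assms in auto)

lemma flux_inv_bounds: "0 \<le> flux_inv p y" "1 < p \<Longrightarrow> flux_inv p y \<le> 1"
  by (auto simp: flux_inv_def intro: powr_le1)

lemma flux_inv_mono: "1 < p \<Longrightarrow> x \<le> y \<Longrightarrow> flux_inv p x \<le> flux_inv p y"
  unfolding flux_inv_def by (intro powr_mono2) auto

lemma flux_inv_eq: "0 \<le> y \<Longrightarrow> y \<le> 1 \<Longrightarrow> flux_inv p y = y powr (1 / (p - 1))"
  by (simp add: flux_inv_def)

section \<open>Sign and monotonicity of the truncated nonlinearity\<close>

context
  fixes p q :: real
  assumes p: "1 < p" "p < 2" and q: "2 < q"
begin

lemma nlin_factor: "0 < s \<Longrightarrow> nlin p q s = s powr (p - 1) * (1 - s powr (q - p))"
  by (simp add: nlin_def right_diff_distrib powr_add[symmetric])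

lemma nlin_clip_1: "nlin_clip p q 1 = 0"
  by (simp add: nlin_clip_def nlin_def)

lemma nlin_clip_pos: "s < 1 \<Longrightarrow> 0 < nlin_clip p q s"
proof -
  assume "s < 1"
  then have "max (1/4) (min 2 s) powr (q - p) < 1 powr (q - p)"
    using p q by (intro powr_less_mono2) auto
  then show ?thesis by (simp add: nlin_clip_def nlin_factor)
qed

text \<open>Above \<open>1\<close> its negative is a product of two nonnegative nondecreasing
  factors, \<open>s powr (p - 1)\<close> and \<open>s powr (q - p) - 1\<close>.\<close>

lemma nlin_clip_antimono: "1 \<le> s \<Longrightarrow> s \<le> t \<Longrightarrow> nlin_clip p q t \<le> nlin_clip p q s"
proof -
  assume st: "1 \<le> s" "s \<le> t"
  let ?s = "min 2 s" and ?t = "min 2 t"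
  have 1: "?s powr (p - 1) \<le> ?t powr (p - 1)" using st p by (intro powr_mono2) auto
  have 2: "?s powr (q - p) \<le> ?t powr (q - p)" using st p q by (intro powr_mono2) auto
  have 3: "1 \<le> ?s powr (q - p)" using st p q by (intro ge_one_powr_ge_zero) auto
  have "?s powr (p - 1) * (?s powr (q - p) - 1) \<le> ?t powr (p - 1) * (?t powr (q - p) - 1)"
    using 1 2 3 by (intro mult_mono) auto
  then show ?thesis using st by (simp add: nlin_clip_def nlin_factor algebra_simps)
qed

lemma nlin_clip_neg: "1 < s \<Longrightarrow> nlin_clip p q s < 0"
proof -
  assume s: "1 < s"
  then have "1 < min 2 s powr (q - p)" using p q by (intro gr_one_powr) auto
  moreover have "0 < min 2 s powr (p - 1)" using s by simp
  ultimately show ?thesis using s by (simp add: nlin_clip_def nlin_factor mult_less_0_iff max_def)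
qed

lemma nlin_clip_le_powr: "1/4 \<le> s \<Longrightarrow> nlin_clip p q s \<le> s powr (p - 1)"
proof -
  assume s: "1/4 \<le> s"
  have "nlin_clip p q s \<le> max (1/4) (min 2 s) powr (p - 1)" by (simp add: nlin_clip_def nlin_def)
  also have "\<dots> \<le> s powr (p - 1)" using s p by (intro powr_mono2) auto
  finally show ?thesis .
qed

lemma nlin_clip_le_1: "nlin_clip p q s \<le> 1"
proof (cases "s \<le> 1")
  case True
  have "nlin_clip p q s \<le> max (1/4) (min 2 s) powr (p - 1)" by (simp add: nlin_clip_def nlin_def)
  also have "\<dots> \<le> 1" using True p by (intro powr_le1) auto
  finally show ?thesis .
qed (use nlin_clip_neg[of s] in simp)

end

text \<open>One truncated trajectory. Since \<open>flux_inv\<close> sends negative fluxes to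
  \<open>0\<close>, \<open>U\<close> is nondecreasing in any case; it follows the original radial
  equation only as long as the average \<open>a\<close> is nonnegative.\<close>

locale radial_profile =
  fixes p q d :: real and N :: nat and U :: "real \<Rightarrow> real"
  assumes p: "1 < p" "p < 2" and q: "2 < q" and N: "0 < N" and d: "1/4 \<le> d" "d < 1"
    and U_cont: "continuous_on {0..1} U"
    and U_eq: "\<And>r. r \<in> {0..1} \<Longrightarrow>
      U r = d + integral {0..r} (\<lambda>s. flux_inv p (s * ravg N (\<lambda>t. nlin_clip p q (U t)) s))"
begin

definition f where "f t = nlin_clip p q (U t)"
text \<open>The product \<open>r * a r\<close> is the flux before truncation. At the centre
  \<open>a 0 = f 0 / N\<close> is positive because \<open>d < 1\<close>.\<close>

definition a where "a = ravg N f"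

lemma f_cont: "continuous_on {0..1} f"
proof -
  obtain L where "L-lipschitz_on UNIV (nlin_clip p q)" using nlin_clip_lipschitz[OF p q] .
  from continuous_on_compose2[OF lipschitz_on_continuous_on[OF this] U_cont]
  show ?thesis by (simp add: f_def[abs_def])
qed

lemma a_cont: "continuous_on {0..1} a"
  unfolding a_def by (intro continuous_on_ravg f_cont)

lemma U'_cont: "continuous_on {0..1} (\<lambda>s. flux_inv p (s * a s))"
  by (rule continuous_on_compose2[OF lipschitz_on_continuous_on[OF flux_inv_lipschitz[OF p]]])
     (auto intro!: continuous_intros a_cont)

lemma U_integral: "r \<in> {0..1} \<Longrightarrow> U r = d + integral {0..r} (\<lambda>s. flux_inv p (s * a s))"
  using U_eq by (simp add: a_def f_def[abs_def])

lemma U_0: "U 0 = d"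
  using U_integral[of 0] by simp

lemma U_deriv:
  assumes "r \<in> {0..1}"
  shows "(U has_real_derivative flux_inv p (r * a r)) (at r within {0..1})"
proof -
  have "((\<lambda>r. d + integral {0..r} (\<lambda>s. flux_inv p (s * a s))) has_real_derivative
      0 + flux_inv p (r * a r)) (at r within {0..1})"
    by (intro DERIV_add DERIV_const integral_has_real_derivative U'_cont assms)
  then show ?thesis
    using has_field_derivative_transform_within[of _ _ r "{0..1}" 1 U] U_integral assms by simp
qed

lemma U_diff: "0 \<le> x \<Longrightarrow> x \<le> y \<Longrightarrow> y \<le> 1 \<Longrightarrow> U y - U x = integral {x..y} (\<lambda>s. flux_inv p (s * a s))"
  using U_integral[of x] U_integral[of y]
    Henstock_Kurzweil_Integration.integral_combine[of 0 x y "\<lambda>s. flux_inv p (s * a s)"]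
  by (simp add: integrable_continuous_real continuous_on_subset[OF U'_cont])

lemma U_diff_bounds:
  assumes xy: "0 \<le> x" "x \<le> y" "y \<le> 1"
  shows "(\<And>s. s \<in> {x..y} \<Longrightarrow> flux_inv p (s * a s) \<le> c) \<Longrightarrow> U y - U x \<le> c * (y - x)"
    and "(\<And>s. s \<in> {x..y} \<Longrightarrow> c \<le> flux_inv p (s * a s)) \<Longrightarrow> c * (y - x) \<le> U y - U x"
proof -
  have int: "(\<lambda>s. flux_inv p (s * a s)) integrable_on {x..y}"
    by (rule integrable_continuous_real, rule continuous_on_subset[OF U'_cont]) (use xy in auto)
  show "U y - U x \<le> c * (y - x)" if "\<And>s. s \<in> {x..y} \<Longrightarrow> flux_inv p (s * a s) \<le> c"
    using integral_le[OF int integrable_const_ivl[of c] that] xy by (simp add: U_diff[OF xy] mult.commute)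
  show "c * (y - x) \<le> U y - U x" if "\<And>s. s \<in> {x..y} \<Longrightarrow> c \<le> flux_inv p (s * a s)"
    using integral_le[OF integrable_const_ivl[of c] int that] xy by (simp add: U_diff[OF xy] mult.commute)
qed

lemma U_mono: "0 \<le> x \<Longrightarrow> x \<le> y \<Longrightarrow> y \<le> 1 \<Longrightarrow> U x \<le> U y"
  using U_diff_bounds(2)[of x y 0] flux_inv_bounds(1) by simp

lemma U_lipschitz: "0 \<le> x \<Longrightarrow> x \<le> y \<Longrightarrow> y \<le> 1 \<Longrightarrow> U y - U x \<le> y - x"
  using U_diff_bounds(1)[of x y 1] flux_inv_bounds(2) p by simp

lemma U_range: "r \<in> {0..1} \<Longrightarrow> d \<le> U r \<and> U r \<le> d + r"
  using U_mono[of 0 r] U_lipschitz[of 0 r] U_0 by simp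

lemma a_le_1: "r \<in> {0..1} \<Longrightarrow> a r \<le> 1"
proof -
  assume r: "r \<in> {0..1}"
  have "a r \<le> ravg N (\<lambda>_. 1) r" unfolding a_def
    by (rule ravg_mono[OF f_cont _ r]) (simp_all add: f_def nlin_clip_le_1[OF p q])
  also have "\<dots> = 1 / N" using N by (rule ravg_const)
  also have "\<dots> \<le> 1" using N by simp
  finally show ?thesis .
qed

text \<open>Up to the area of the unit sphere, \<open>r ^ N * a r\<close> is the total source in the
  ball of radius \<open>r\<close>. It is additive over shells, which makes it the quantity to track
  from one radius to another.\<close>

lemma vol_diff:
  assumes xy: "0 \<le> x" "x \<le> y" "y \<le> 1"
  shows "y ^ N * a y - x ^ N * a x = integral {x..y} (\<lambda>t. t ^ (N - 1) * f t)"
proof -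
  have "(\<lambda>t. t ^ (N - 1) * f t) integrable_on {0..y}"
    using xy by (intro integrable_continuous_real continuous_intros continuous_on_subset[OF f_cont]) auto
  from Henstock_Kurzweil_Integration.integral_combine[OF xy(1,2) this] show ?thesis
    unfolding a_def using xy ravg_eq_integral[OF f_cont _ N, of x] ravg_eq_integral[OF f_cont _ N, of y] by simp
qed

lemma vol_int: "0 \<le> x \<Longrightarrow> y \<le> 1 \<Longrightarrow> (\<lambda>t. t ^ (N - 1) * f t) integrable_on {x..y}"
  by (intro integrable_continuous_real continuous_intros continuous_on_subset[OF f_cont]) auto

text \<open>By monotonicity \<open>U\<close> stays at most \<open>1\<close> up to \<open>r\<close>,
  so the source is nonnegative there. A zero average would force \<open>U = 1\<close> on the way,
  against \<open>U 0 = d < 1\<close>.\<close>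

lemma a_pos:
  assumes r: "r \<in> {0..1}" and U1: "U r \<le> 1"
  shows "0 < a r"
proof (rule ccontr)
  assume "\<not> 0 < a r"
  have le1: "U (r * t) \<le> 1" if "t \<in> {0..1}" for t
    using U_mono[of "r * t" r] r that U1 by (auto intro: mult_left_le mult_nonneg_nonneg order_trans)
  have nonneg: "0 \<le> t ^ (N - 1) * f (r * t)" if "t \<in> {0..1}" for t
    using le1[OF that] that nlin_clip_pos[OF p q, of "U (r * t)"] nlin_clip_1[OF p q]
    by (cases "U (r * t) = 1") (auto simp: f_def)
  note cont = ravg_integrand_continuous[OF f_cont r, of N]
  have "0 \<le> a r" unfolding a_def ravg_def
    by (intro integral_nonneg integrable_continuous_real cont nonneg)
  with \<open>\<not> 0 < a r\<close> have "integral {0..1} (\<lambda>t. t ^ (N - 1) * f (r * t)) = 0"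
    by (simp add: a_def ravg_def)
  then have *: "t ^ (N - 1) * f (r * t) = 0" if "t \<in> {0..1}" for t
    using integral_eq_0_iff[OF cont _ nonneg] that by auto
  \<comment> \<open>The weight \<open>t ^ (N - 1)\<close> may vanish at \<open>t = 0\<close>, so the
    value at the centre is recovered by continuity.\<close>
  have eq1: "U (r * t) = 1" if "0 < t" "t \<le> 1" for t
    using *[of t] that le1[of t] nlin_clip_pos[OF p q, of "U (r * t)"] by (fastforce simp: f_def)
  have "continuous_on {0..1} (\<lambda>t. U (r * t))"
    using r by (intro continuous_on_compose2[OF U_cont] continuous_intros) (auto intro: mult_le_one)
  then have "((\<lambda>t. U (r * t)) \<longlongrightarrow> U (r * 0)) (at 0 within {0..1})"
    unfolding continuous_on_def by (rule bspec) simp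
  then have lim: "((\<lambda>t. U (r * t)) \<longlongrightarrow> U 0) (at_right 0)"
    by (simp add: at_within_Icc_at_right)
  have "((\<lambda>t. U (r * t)) \<longlongrightarrow> 1) (at_right 0)"
    by (rule tendsto_eventually) (auto intro!: eventually_at_rightI[of 0 1] eq1)
  from tendsto_unique[OF _ lim this] show False using U_0 d by simp
qed

text \<open>Where the average vanishes, \<open>U\<close> already exceeds \<open>1\<close>. From
  there on the source is at most the negative constant \<open>nlin_clip p q (U r)\<close>, so any
  remaining shell would make the total source negative at radius \<open>1\<close>.\<close>

lemma zero_only_at_1:
  assumes nonneg: "\<And>r. r \<in> {0..1} \<Longrightarrow> 0 \<le> a r" and r: "r \<in> {0..1}" "a r = 0"
  shows "r = 1" "1 < U 1"
proof -
  have U_r: "1 < U r" using a_pos[OF r(1)] r(2) by force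
  then show "1 < U 1" using U_mono[of r 1] r by auto
  show "r = 1"
  proof (rule ccontr)
    assume "r \<noteq> 1"
    with r have r': "0 \<le> r" "r < 1" by auto
    have "1 ^ N * a 1 - r ^ N * a r = integral {r..1} (\<lambda>t. t ^ (N - 1) * f t)"
      using r' by (intro vol_diff) auto
    also have "\<dots> \<le> integral {r..1} (\<lambda>t. t ^ (N - 1) * nlin_clip p q (U r))"
    proof (intro integral_le vol_int)
      show "(\<lambda>t. t ^ (N - 1) * nlin_clip p q (U r)) integrable_on {r..1}"
        by (intro integrable_continuous_real continuous_intros)
      fix t assume t: "t \<in> {r..1}"
      then show "t ^ (N - 1) * f t \<le> t ^ (N - 1) * nlin_clip p q (U r)"
        unfolding f_def using r' U_r U_mono[of r t]
        by (intro mult_left_mono nlin_clip_antimono[OF p q]) auto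
    qed (use r' in auto)
    also have "\<dots> = (1 ^ N / N - r ^ N / N) * nlin_clip p q (U r)"
    proof (intro integral_unique has_integral_mult_left fundamental_theorem_of_calculus)
      show "((\<lambda>t. t ^ N / N) has_vector_derivative t ^ (N - 1)) (at t within {r..1})" for t :: real
        using N by (auto intro!: derivative_eq_intros simp: has_real_derivative_iff_has_vector_derivative[symmetric])
    qed (use r' in auto)
    also have "\<dots> < 0"
      using U_r r' N nlin_clip_neg[OF p q U_r] power_strict_mono[of r 1 N]
      by (intro mult_pos_neg) (auto simp: divide_simps)
    finally show False using nonneg[of 1] r(2) by simp
  qed
qed

end

text \<open>The power \<open>1 / (p - 1)\<close> undoes \<open>c powr (p - 1)\<close> and can only
  decrease \<open>s\<close>, since \<open>s \<le> 1\<close> and the exponent is at least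
  \<open>1\<close>.\<close>

lemma flux_inv_le:
  assumes p: "1 < p" "p < 2" and y: "y \<le> s * c powr (p - 1)" and s: "0 \<le> s" "s \<le> 1" and c: "0 \<le> c"
  shows "flux_inv p y \<le> s * c"
proof -
  have e: "1 \<le> 1 / (p - 1)" using p by (simp add: divide_simps)
  have "flux_inv p y \<le> (s * c powr (p - 1)) powr (1 / (p - 1))"
    unfolding flux_inv_def using y s p by (intro powr_mono2) auto
  also have "\<dots> = s powr (1 / (p - 1)) * c"
    using s c p by (simp add: powr_mult powr_powr)
  also have "\<dots> \<le> s powr 1 * c"
    using s e c by (intro mult_right_mono powr_mono') auto
  finally show ?thesis using s by simp
qed

section \<open>Start heights that stay below level 1 and start heights that overshoot\<close>

context radial_profile
begin

lemma a_le_const: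
  assumes r: "r \<in> {0..1}" and le: "\<And>t. t \<in> {0..r} \<Longrightarrow> f t \<le> c" and c: "0 \<le> c"
  shows "a r \<le> c"
proof -
  have "a r \<le> c / N" using ravg_mono[OF f_cont continuous_on_const r le, of N] ravg_const[OF N] by (simp add: a_def)
  also have "\<dots> \<le> c" using mult_left_mono[of 1 "real N" c] c N by (simp add: divide_simps)
  finally show ?thesis .
qed

lemma a_ge_const:
  assumes r: "r \<in> {0..1}" and le: "\<And>t. t \<in> {0..r} \<Longrightarrow> c \<le> f t"
  shows "c / N \<le> a r"
  using ravg_mono[OF continuous_on_const f_cont r le, of N] ravg_const[OF N] by (simp add: a_def)

text \<open>The slope at \<open>s\<close> is at most \<open>s * U 1\<close>. Bounding
  \<open>s\<close> by \<open>1/2\<close> and by \<open>1\<close> on the two halves of the interval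
  gives \<open>U 1 \<le> 1/4 + 3/4 * U 1\<close>, which is exactly what the start value
  \<open>1/4\<close> permits.\<close>

lemma U_le_1_small_start:
  assumes d: "d = 1/4"
  shows "U 1 \<le> 1"
proof -
  have U1: "1/4 \<le> U 1" using U_range[of 1] d by simp
  have flux: "flux_inv p (s * a s) \<le> s * U 1" if s: "s \<in> {0..1}" for s
  proof (rule flux_inv_le[OF p])
    have "a s \<le> U 1 powr (p - 1)"
    proof (rule a_le_const[OF s])
      fix t assume t: "t \<in> {0..s}"
      then have Ut: "1/4 \<le> U t" "U t \<le> U 1" using U_range[of t] U_mono[of t 1] s d by auto
      have "f t \<le> U t powr (p - 1)" unfolding f_def using nlin_clip_le_powr[OF p q Ut(1)] .
      also have "\<dots> \<le> U 1 powr (p - 1)" using Ut p by (intro powr_mono2) auto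
      finally show "f t \<le> U 1 powr (p - 1)" .
    qed simp
    then show "s * a s \<le> s * U 1 powr (p - 1)" using s by (intro mult_left_mono) auto
  qed (use s U1 in auto)
  have "U (1/2) - U 0 \<le> U 1 / 2 * (1/2 - 0)"
  proof (rule U_diff_bounds(1))
    fix s :: real assume s: "s \<in> {0..1/2}"
    then have "s * U 1 \<le> 1/2 * U 1" using U1 by (intro mult_right_mono) auto
    then show "flux_inv p (s * a s) \<le> U 1 / 2" using flux[of s] s by simp
  qed auto
  moreover have "U 1 - U (1/2) \<le> U 1 * (1 - 1/2)"
  proof (rule U_diff_bounds(1))
    fix s :: real assume s: "s \<in> {1/2..1}"
    then have "s * U 1 \<le> 1 * U 1" using U1 by (intro mult_right_mono) auto
    then show "flux_inv p (s * a s) \<le> U 1" using flux[of s] s by simp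
  qed auto
  ultimately show ?thesis using U_0 d by simp
qed

text \<open>The source is at most \<open>L * (1 - d)\<close>, so the slope is at most this bound
  raised to \<open>1 / (p - 1)\<close>. As that exponent exceeds \<open>1\<close>, the condition
  \<open>le\<close> holds for all \<open>d\<close> close enough to \<open>1\<close>, and then the
  climb is at most \<open>1 - d\<close>.\<close>

lemma U_le_1_near_1:
  assumes L: "L-lipschitz_on UNIV (nlin_clip p q)" "0 \<le> L"
    and le: "(L * (1 - d)) powr (1 / (p - 1)) \<le> 1 - d"
  shows "U 1 \<le> 1"
proof -
  have f_le: "f t \<le> L * (1 - d)" if "t \<in> {0..1}" for t
  proof (cases "U t \<le> 1")
    case True
    have "\<bar>nlin_clip p q (U t) - nlin_clip p q 1\<bar> \<le> L * \<bar>U t - 1\<bar>"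
      using lipschitz_onD[OF L(1), of "U t" 1] by (simp add: dist_real_def)
    also have "\<dots> \<le> L * (1 - d)" using True U_range[OF that] L by (intro mult_left_mono) auto
    finally show ?thesis using nlin_clip_1[OF p q] by (simp add: f_def)
  next
    case False
    then have "f t < 0" using nlin_clip_neg[OF p q] by (simp add: f_def)
    also have "0 \<le> L * (1 - d)" using L d by simp
    finally show ?thesis by simp
  qed
  have "U 1 - U 0 \<le> (1 - d) * (1 - 0)"
  proof (rule U_diff_bounds(1))
    fix s :: real assume s: "s \<in> {0..1}"
    have Ld: "0 \<le> L * (1 - d)" using L d by simp
    have "a s \<le> L * (1 - d)" using s f_le Ld by (intro a_le_const) auto
    then have "s * a s \<le> 1 * (L * (1 - d))"
      using s Ld order_trans[OF mult_left_mono[of "a s" "L * (1 - d)" s] mult_right_mono[of s 1 "L * (1 - d)"]] by auto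
    then have "flux_inv p (s * a s) \<le> (L * (1 - d)) powr (1 / (p - 1))"
      unfolding flux_inv_def using Ld p by (intro powr_mono2) auto
    then show "flux_inv p (s * a s) \<le> 1 - d" using le by simp
  qed auto
  then show ?thesis using U_0 by simp
qed

lemma vol_drop:
  assumes xy: "0 \<le> x" "x \<le> y" "y \<le> 1" and f: "\<And>t. t \<in> {x..y} \<Longrightarrow> f t \<le> - b" and b: "0 \<le> b"
  shows "y ^ N * a y \<le> x ^ N * a x - b * x ^ (N - 1) * (y - x)"
proof -
  have "integral {x..y} (\<lambda>t. t ^ (N - 1) * f t) \<le> integral {x..y} (\<lambda>t. - (b * x ^ (N - 1)))"
  proof (intro integral_le vol_int xy integrable_const_ivl)
    fix t assume t: "t \<in> {x..y}"
    have "t ^ (N - 1) * f t \<le> t ^ (N - 1) * (- b)"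
      using f[OF t] t xy by (intro mult_left_mono) auto
    also have "\<dots> \<le> x ^ (N - 1) * (- b)"
      using t xy b by (intro mult_right_mono_neg power_mono) auto
    finally show "t ^ (N - 1) * f t \<le> - (b * x ^ (N - 1))" by (simp add: mult.commute)
  qed
  then show ?thesis using vol_diff[OF xy] xy by (simp add: mult_ac)
qed

lemma vol_lower:
  assumes xy: "0 \<le> x" "x \<le> y" "y \<le> 1" and f: "\<And>t. t \<in> {x..y} \<Longrightarrow> - b \<le> f t" and b: "0 \<le> b"
  shows "x ^ N * a x - b \<le> y ^ N * a y"
proof -
  have "integral {x..y} (\<lambda>t. - b) \<le> integral {x..y} (\<lambda>t. t ^ (N - 1) * f t)"
  proof (intro integral_le vol_int xy integrable_const_ivl)
    fix t assume t: "t \<in> {x..y}"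
    have "1 * (- b) \<le> t ^ (N - 1) * (- b)"
      using t xy b by (intro mult_right_mono_neg power_le_one) auto
    also have "\<dots> \<le> t ^ (N - 1) * f t" using f[OF t] t xy by (intro mult_left_mono) auto
    finally show "- b \<le> t ^ (N - 1) * f t" by simp
  qed
  moreover have "b * (y - x) \<le> b" using xy b by (intro mult_left_le) auto
  ultimately show ?thesis using vol_diff[OF xy] xy by (simp add: algebra_simps)
qed

text \<open>For large \<open>q\<close> the profile reaches the level \<open>1\<close> early with a definite flux and is then pinned near
  \<open>1\<close>: it loses that flux within a short time, after which the source stays negative.\<close>

lemma overshoot:
  fixes \<sigma> \<omega> \<delta> \<kappa> :: real
  assumes \<sigma>: "0 < \<sigma>" "8 * \<sigma> \<le> flux_inv p (1 / (32 * N))" and d\<sigma>: "d = 1 - \<sigma> / 2"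
    and \<omega>: "\<omega> = (\<sigma> / 4) ^ N / (4 * N)" and \<delta>: "\<delta> = \<omega> * (3/4) ^ (N - 1) / 8"
    and \<kappa>: "0 < \<kappa>" "\<kappa> \<le> \<sigma> / 4" "4 * \<kappa> < flux_inv p \<delta>"
    and q1: "(1 - \<kappa>) powr (q - 1) \<le> 1/4"
    and q2: "nlin_clip p q (1 + \<kappa>) * (3/4) ^ (N - 1) < -4"
  shows "\<exists>r\<in>{0..1}. a r < 0"
proof (rule ccontr)
  assume "\<not> (\<exists>r\<in>{0..1}. a r < 0)"
  then have nonneg: "0 \<le> a r" if "r \<in> {0..1}" for r using that linorder_not_less by blast
  have \<sigma>_le: "\<sigma> \<le> 1/8" using \<sigma>(2) flux_inv_bounds(2)[OF p(1), of "1 / (32 * N)"] by linarith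
  have \<omega>_pos: "0 < \<omega>" using \<sigma> N by (simp add: \<omega>)
  have le1: "(3/4::real) ^ (N - 1) \<le> 1" by (rule power_le_one) auto
  have \<delta>_le: "\<delta> \<le> \<omega> / 2" using \<omega>_pos le1 mult_left_mono[OF le1, of \<omega>] by (simp add: \<delta>)
  \<comment> \<open>Here \<open>1/2 \<le> U t \<le> 1\<close>, so
    \<open>U t powr (p - 1) \<ge> U t \<ge> 1/2\<close>, while \<open>q1\<close> bounds the
    subtracted power by \<open>1/4\<close>.\<close>
  have f_ge: "1/4 \<le> f t" if t: "t \<in> {0..1}" and U: "U t \<le> 1 - \<kappa>" for t
  proof -
    have U': "1/2 \<le> U t" "U t \<le> 1" using U_range[OF t] d\<sigma> \<sigma>_le U \<kappa> by auto
    have "U t powr 1 \<le> U t powr (p - 1)" using U' p by (intro powr_mono') auto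
    moreover have "U t powr (q - 1) \<le> (1 - \<kappa>) powr (q - 1)" using U U' q by (intro powr_mono2) auto
    ultimately show ?thesis using q1 U' by (simp add: f_def nlin_clip_def nlin_def)
  qed
  have a_ge: "1 / (4 * N) \<le> a r" if "r \<in> {0..1}" "U r \<le> 1 - \<kappa>" for r
  proof -
    have "1/4 \<le> f t" if t: "t \<in> {0..r}" for t
      using t \<open>r \<in> {0..1}\<close> \<open>U r \<le> 1 - \<kappa>\<close> U_mono[of t r] by (intro f_ge) auto
    from a_ge_const[OF that(1) this] show ?thesis by simp
  qed
  \<comment> \<open>Otherwise the flux is at least \<open>1 / (32 * N)\<close> on
    \<open>{1/8..1/4}\<close>, hence the slope at least \<open>8 * \<sigma>\<close> and the gain at
    least \<open>\<sigma>\<close>, more than the initial deficit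
    \<open>\<sigma> / 2\<close>.\<close>
  have U_14: "1 - \<kappa> < U (1/4)"
  proof (rule ccontr)
    assume *: "\<not> 1 - \<kappa> < U (1/4)"
    have "8 * \<sigma> * (1/4 - 1/8) \<le> U (1/4) - U (1/8)"
    proof (rule U_diff_bounds(2))
      fix s :: real assume s: "s \<in> {1/8..1/4}"
      have "1/8 * (1 / (4 * N)) \<le> s * a s"
        using s * U_mono[of s "1/4"] by (intro mult_mono a_ge) auto
      then show "8 * \<sigma> \<le> flux_inv p (s * a s)"
        using \<sigma>(2) flux_inv_mono[OF p(1), of "1 / (32 * N)" "s * a s"] by simp
    qed auto
    then show False using U_range[of "1/8"] * d\<sigma> \<sigma> \<kappa> by simp
  qed
  \<comment> \<open>The slope is at most \<open>1\<close>, so at radius \<open>\<sigma> / 4\<close>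
    the profile is still at most \<open>1 - \<sigma> / 4 \<le> 1 - \<kappa>\<close>. The total
    source gathered by then is at least \<open>\<omega>\<close>, a bound that does not involve
    \<open>q\<close>.\<close>
  have v_\<sigma>: "\<omega> \<le> (\<sigma> / 4) ^ N * a (\<sigma> / 4)"
  proof -
    have "U (\<sigma> / 4) \<le> 1 - \<kappa>" using U_range[of "\<sigma> / 4"] \<sigma> \<sigma>_le d\<sigma> \<kappa> by simp
    then have "1 / (4 * N) \<le> a (\<sigma> / 4)" using \<sigma> \<sigma>_le by (intro a_ge) auto
    from mult_left_mono[OF this, of "(\<sigma> / 4) ^ N"] show ?thesis using \<sigma> by (simp add: \<omega>)
  qed
  \<comment> \<open>The total source at \<open>3/4\<close> is at most \<open>1\<close>. Above level
    \<open>1 + \<kappa>\<close>, \<open>q2\<close> would remove more than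
    \<open>4 * (1/4) = 1\<close> of it on the last quarter.\<close>
  have U_34: "U (3/4) \<le> 1 + \<kappa>"
  proof (rule ccontr)
    assume *: "\<not> U (3/4) \<le> 1 + \<kappa>"
    have "1 ^ N * a 1 \<le> (3/4) ^ N * a (3/4) - (- nlin_clip p q (1 + \<kappa>)) * (3/4) ^ (N - 1) * (1 - 3/4)"
    proof (rule vol_drop)
      fix t :: real assume "t \<in> {3/4..1}"
      then show "f t \<le> - (- nlin_clip p q (1 + \<kappa>))"
        using * U_mono[of "3/4" t] \<kappa> unfolding f_def by (auto intro!: nlin_clip_antimono[OF p q])
    qed (use nlin_clip_neg[OF p q, of "1 + \<kappa>"] \<kappa> in auto)
    moreover have "(3/4) ^ N * a (3/4) \<le> 1 * 1"
      using nonneg[of "3/4"] a_le_1[of "3/4"] by (intro mult_mono) (auto intro: power_le_one)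
    ultimately show False using q2 nonneg[of 1] by simp
  qed
  \<comment> \<open>Between \<open>1/4\<close> and \<open>3/4\<close> the profile rises by less than
    \<open>2 * \<kappa>\<close>, so the slope is somewhere at most \<open>4 * \<kappa>\<close>,
    which is below \<open>flux_inv p \<delta>\<close>.\<close>
  obtain s where s: "s \<in> {1/4..3/4}" "s * a s < \<delta>"
  proof (rule ccontr)
    assume "\<not> thesis"
    with that have *: "\<delta> \<le> s * a s" if "s \<in> {1/4..3/4}" for s using \<open>s \<in> {1/4..3/4}\<close> by force
    have "flux_inv p \<delta> * (3/4 - 1/4) \<le> U (3/4) - U (1/4)"
      by (rule U_diff_bounds(2)) (use flux_inv_mono[OF p(1) *] in auto)
    then show False using U_14 U_34 \<kappa> by simp
  qed
  have v_s: "s ^ N * a s < \<delta>"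
  proof -
    have "s ^ N \<le> s ^ 1" using s N by (intro power_decreasing) auto
    then have "s ^ N * a s \<le> s * a s" using nonneg[of s] s by (intro mult_right_mono) auto
    then show ?thesis using s by simp
  qed
  \<comment> \<open>The total source has dropped from at least \<open>\<omega>\<close> to below
    \<open>\<delta> \<le> \<omega> / 2\<close>, a loss of more than \<open>\<omega> / 2\<close>
    within a shell of width at most \<open>1\<close>.\<close>
  obtain t where t: "t \<in> {\<sigma> / 4..s}" "f t < - (\<omega> / 2)"
  proof (rule ccontr)
    assume "\<not> thesis"
    with that have *: "- (\<omega> / 2) \<le> f t" if "t \<in> {\<sigma> / 4..s}" for t using \<open>t \<in> {\<sigma> / 4..s}\<close> by force
    have "(\<sigma> / 4) ^ N * a (\<sigma> / 4) - \<omega> / 2 \<le> s ^ N * a s"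
      by (rule vol_lower[OF _ _ _ *]) (use \<sigma> \<sigma>_le s \<omega>_pos in auto)
    then show False using v_\<sigma> v_s \<delta>_le by simp
  qed
  have "1 \<le> U t"
    using nlin_clip_pos[OF p q, of "U t"] t(2) \<omega>_pos by (force simp: f_def)
  then have f_le: "f r \<le> - (\<omega> / 2)" if "r \<in> {s..1}" for r
    using t U_mono[of t r] that \<sigma> nlin_clip_antimono[OF p q, of "U t" "U r"] by (auto simp: f_def)
  \<comment> \<open>Up to \<open>3/4\<close> it is enough that the total source does not increase.
    On the last quarter it loses at least \<open>\<omega> / 2 * (3/4) ^ (N - 1) / 4\<close>, which
    is \<open>\<delta>\<close> by its definition, and so ends below zero.\<close>
  have "(3/4) ^ N * a (3/4) \<le> s ^ N * a s - 0 * s ^ (N - 1) * (3/4 - s)"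
    by (rule vol_drop) (use s f_le \<omega>_pos in \<open>force+\<close>)
  moreover have "1 ^ N * a 1 \<le> (3/4) ^ N * a (3/4) - \<omega> / 2 * (3/4) ^ (N - 1) * (1 - 3/4)"
    by (rule vol_drop) (use s f_le \<omega>_pos in auto)
  ultimately show False using v_s nonneg[of 1] by (simp add: \<delta>)
qed

end

text \<open>The constants \<open>\<sigma>\<close>, \<open>\<omega>\<close>, \<open>\<delta>\<close>
  and \<open>\<kappa>\<close> depend on \<open>p\<close> and \<open>N\<close> alone and
  \<open>q0\<close> is fixed after them, so a single height \<open>d\<close> serves every
  \<open>q > q0\<close>.\<close>

lemma overshoot_height:
  assumes p: "1 < p" "p < 2" and N: "0 < N"
  obtains d q0 where "1/4 < d" "d < 1" "2 \<le> q0"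
    "\<And>q U. q0 < q \<Longrightarrow> radial_profile p q d N U \<Longrightarrow> \<exists>r\<in>{0..1}. radial_profile.a p q N U r < 0"
proof -
  have flux_pos: "0 < flux_inv p y" if "0 < y" for y using that by (simp add: flux_inv_def)
  define \<sigma> where "\<sigma> = flux_inv p (1 / (32 * N)) / 8"
  have \<sigma>: "0 < \<sigma>" "\<sigma> \<le> 1/8"
    using flux_pos[of "1 / (32 * N)"] flux_inv_bounds(2)[OF p(1), of "1 / (32 * N)"] N by (auto simp: \<sigma>_def)
  define \<omega> where "\<omega> = (\<sigma> / 4) ^ N / (4 * N)"
  define \<delta> where "\<delta> = \<omega> * (3/4) ^ (N - 1) / 8"
  have "0 < \<delta>" using \<sigma> N by (simp add: \<delta>_def \<omega>_def)
  define \<kappa> where "\<kappa> = min (\<sigma> / 4) (flux_inv p \<delta> / 8)"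
  have \<kappa>: "0 < \<kappa>" "\<kappa> \<le> \<sigma> / 4" "4 * \<kappa> < flux_inv p \<delta>"
    using \<sigma> flux_pos[OF \<open>0 < \<delta>\<close>] by (auto simp: \<kappa>_def)
  have \<kappa>1: "\<kappa> < 1" using \<kappa> \<sigma> by simp
  \<comment> \<open>The summand \<open>2\<close> compensates
    \<open>(1 + \<kappa>) powr (p - 1) \<le> 1 + \<kappa> < 2\<close>; the rest is the negative
    source that \<open>q2\<close> asks for. The logarithms in \<open>q0\<close> are the exponents at
    which the two powers reach \<open>4\<close> and \<open>B\<close>.\<close>
  define B :: real where "B = 2 + 4 / (3/4) ^ (N - 1)"
  have B: "0 < B" by (simp add: B_def add_pos_pos)
  define q0 where "q0 = 2 + max 0 (max (log (1 / (1 - \<kappa>)) 4) (log (1 + \<kappa>) B))"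
  have main: "\<exists>r\<in>{0..1}. radial_profile.a p q N U r < 0"
    if q0: "q0 < q" and U: "radial_profile p q (1 - \<sigma> / 2) N U" for q U
  proof -
    interpret radial_profile p q "1 - \<sigma> / 2" N U by (rule U)
    have base: "1 < 1 / (1 - \<kappa>)" using \<kappa> \<kappa>1 by simp
    have "4 = (1 / (1 - \<kappa>)) powr (log (1 / (1 - \<kappa>)) 4)" using base \<kappa>1 by (subst powr_log_cancel) auto
    also have "\<dots> \<le> (1 / (1 - \<kappa>)) powr (q - 1)" using base q0 by (intro powr_mono) (auto simp: q0_def)
    also have "\<dots> = 1 / (1 - \<kappa>) powr (q - 1)" using \<kappa>1 by (simp add: powr_divide)
    finally have q1: "(1 - \<kappa>) powr (q - 1) \<le> 1/4" using \<kappa>1 by (simp add: divide_simps)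
    have "B = (1 + \<kappa>) powr (log (1 + \<kappa>) B)" using \<kappa> B by (subst powr_log_cancel) auto
    also have "\<dots> \<le> (1 + \<kappa>) powr (q - 1)" using \<kappa> q0 by (intro powr_mono) (auto simp: q0_def)
    finally have "B \<le> (1 + \<kappa>) powr (q - 1)" .
    moreover have "(1 + \<kappa>) powr (p - 1) \<le> (1 + \<kappa>) powr 1" using p \<kappa> by (intro powr_mono) auto
    ultimately have "nlin_clip p q (1 + \<kappa>) < - (4 / (3/4) ^ (N - 1))"
      using \<kappa>1 \<kappa> by (simp add: nlin_clip_def nlin_def B_def)
    then have "nlin_clip p q (1 + \<kappa>) * (3/4) ^ (N - 1) < - (4 / (3/4) ^ (N - 1)) * (3/4) ^ (N - 1)"
      by (intro mult_strict_right_mono) auto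
    then have q2: "nlin_clip p q (1 + \<kappa>) * (3/4) ^ (N - 1) < -4" by simp
    show ?thesis
      by (rule overshoot[OF \<sigma>(1) _ refl \<omega>_def \<delta>_def \<kappa> q1 q2]) (simp add: \<sigma>_def)
  qed
  show thesis
    by (rule that[of "1 - \<sigma> / 2" q0]) (use main \<sigma> in \<open>auto simp: q0_def\<close>)
qed

text \<open>Nonnegative averages mean that no flux has been cut off, the zero at \<open>1\<close> is
  the Neumann condition, and \<open>1 < U 1\<close> excludes constants because the start value lies
  below \<open>1\<close>.\<close>

definition neumann_profile :: "real \<Rightarrow> real \<Rightarrow> nat \<Rightarrow> real \<Rightarrow> (real \<Rightarrow> real) \<Rightarrow> bool" where
  "neumann_profile p q N d U \<longleftrightarrow> radial_profile p q d N U \<and>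
     (\<forall>r\<in>{0..1}. 0 \<le> radial_profile.a p q N U r) \<and> radial_profile.a p q N U 1 = 0 \<and> 1 < U 1"

section \<open>Intermediate values of the minimal average\<close>

lemma two_neumann_profiles:
  assumes p: "1 < p" "p < 2" and N: "0 < N"
  shows "\<exists>q0\<ge>2. \<forall>q>q0. \<exists>d1 d2 U1 U2. d1 < d2 \<and> neumann_profile p q N d1 U1 \<and> neumann_profile p q N d2 U2"
proof -
  obtain d q0 where d: "1/4 < d" "d < 1" "2 \<le> q0"
    and over: "\<And>q U. q0 < q \<Longrightarrow> radial_profile p q d N U \<Longrightarrow> \<exists>r\<in>{0..1}. radial_profile.a p q N U r < 0"
    using overshoot_height[OF p N] by metis
  have "\<exists>d1 d2 U1 U2. d1 < d2 \<and> neumann_profile p q N d1 U1 \<and> neumann_profile p q N d2 U2"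
    if q0: "q0 < q" for q
  proof -
    have q: "2 < q" using d q0 by simp
    obtain L where L: "1 \<le> L" "L-lipschitz_on UNIV (nlin_clip p q)"
      using nlin_clip_lipschitz[OF p q] .
    obtain U K where U: "\<And>d. continuous_on {0..1} (U d)"
        "\<And>d r. r \<in> {0..1} \<Longrightarrow>
          U d r = d + integral {0..r} (\<lambda>s. flux_inv p (s * ravg N (\<lambda>t. nlin_clip p q (U d t)) s))"
      and K: "\<And>d d' r. r \<in> {0..1} \<Longrightarrow> \<bar>U d r - U d' r\<bar> \<le> K * \<bar>d - d'\<bar>"
      using radial_ivp[OF L(2) flux_inv_lipschitz[OF p], of N] by blast
    have prof: "radial_profile p q x N (U x)" if "1/4 \<le> x" "x < 1" for x
      using that U p q N by unfold_locales auto
    define a where "a x = radial_profile.a p q N (U x)" for x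
    have a_cont: "continuous_on {0..1} (a x)" if "1/4 \<le> x" "x < 1" for x
      unfolding a_def using radial_profile.a_cont[OF prof[OF that]] .
    have "\<exists>r\<in>{0..1}. \<forall>s\<in>{0..1}. a x r \<le> a x s" if "1/4 \<le> x" "x < 1" for x
      by (rule continuous_attains_inf[OF _ _ a_cont[OF that]]) auto
    then obtain \<rho> where \<rho>: "\<And>x. 1/4 \<le> x \<Longrightarrow> x < 1 \<Longrightarrow> \<rho> x \<in> {0..1}"
        "\<And>x s. 1/4 \<le> x \<Longrightarrow> x < 1 \<Longrightarrow> s \<in> {0..1} \<Longrightarrow> a x (\<rho> x) \<le> a x s"
      by metis
    define m where "m x = a x (\<rho> x)" for x
    have a_lip: "a x r \<le> a y r + L * K * \<bar>x - y\<bar>"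
      if x: "1/4 \<le> x" "x < 1" and y: "1/4 \<le> y" "y < 1" and r: "r \<in> {0..1}" for x y r
    proof -
      interpret x: radial_profile p q x N "U x" by (rule prof[OF x])
      interpret y: radial_profile p q y N "U y" by (rule prof[OF y])
      have K0: "0 \<le> K * \<bar>x - y\<bar>" using K[of 0 x y] by (rule order_trans[rotated]) auto
      have "a x r - a y r = ravg N (\<lambda>t. x.f t - y.f t) r"
        unfolding a_def x.a_def y.a_def by (rule ravg_diff[OF x.f_cont y.f_cont r])
      also have "\<dots> \<le> ravg N (\<lambda>t. L * K * \<bar>x - y\<bar>) r"
      proof (rule ravg_mono[OF continuous_on_diff[OF x.f_cont y.f_cont] continuous_on_const r])
        fix t assume t: "t \<in> {0..r}"
        have "x.f t - y.f t \<le> L * \<bar>U x t - U y t\<bar>"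
          using lipschitz_onD[OF L(2), of "U x t" "U y t"] by (simp add: x.f_def y.f_def dist_real_def)
        also have "\<dots> \<le> L * (K * \<bar>x - y\<bar>)" using K[of t x y] t r L by (intro mult_left_mono) auto
        finally show "x.f t - y.f t \<le> L * K * \<bar>x - y\<bar>" by simp
      qed
      also have "\<dots> = L * K * \<bar>x - y\<bar> / N" by (rule ravg_const[OF N])
      also have "\<dots> \<le> L * K * \<bar>x - y\<bar>"
        using mult_left_mono[of 1 "real N" "L * (K * \<bar>x - y\<bar>)"] mult_nonneg_nonneg[of L "K * \<bar>x - y\<bar>"] K0 L N
        by (simp add: divide_simps mult_ac)
      finally show ?thesis by simp
    qed
    \<comment> \<open>The minimum for \<open>x\<close> is compared with the value of
      \<open>a x\<close> at the minimiser for \<open>y\<close>, so no continuity of the minimiser is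
      required.\<close>
    have m_lip: "m x \<le> m y + L * K * \<bar>x - y\<bar>"
      if x: "1/4 \<le> x" "x < 1" and y: "1/4 \<le> y" "y < 1" for x y
      using \<rho>(2)[OF x \<rho>(1)[OF y]] a_lip[OF x y \<rho>(1)[OF y]] by (simp add: m_def)
    have K0: "0 \<le> K" using K[of 0 1 0] by (simp; linarith)
    have m_cont: "continuous_on A m" if "A \<subseteq> {1/4..<1}" for A
    proof (rule lipschitz_on_continuous_on, rule lipschitz_onI)
      fix x y assume "x \<in> A" "y \<in> A"
      with that have xy: "1/4 \<le> x" "x < 1" "1/4 \<le> y" "y < 1" by auto
      show "dist (m x) (m y) \<le> L * K * dist x y"
        using m_lip[OF xy] m_lip[OF xy(3,4,1,2)] by (simp add: dist_real_def abs_le_iff abs_minus_commute)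
    qed (use K0 L in simp)
    have m_pos: "0 < m x" if "1/4 \<le> x" "x < 1" "U x 1 \<le> 1" for x
      using radial_profile.a_pos[OF prof[OF that(1,2)] \<rho>(1)[OF that(1,2)]]
        radial_profile.U_mono[OF prof[OF that(1,2)], of "\<rho> x" 1] \<rho>(1)[OF that(1,2)] that(3)
      by (simp add: m_def a_def)
    have sol: "neumann_profile p q N x (U x)" if x: "1/4 \<le> x" "x < 1" and m: "m x = 0" for x
    proof -
      interpret S: radial_profile p q x N "U x" by (rule prof[OF x])
      have nonneg: "0 \<le> a x r" if "r \<in> {0..1}" for r
        using \<rho>(2)[OF x that] m by (simp add: m_def)
      note zero = S.zero_only_at_1[OF nonneg[unfolded a_def] \<rho>(1)[OF x] m[unfolded m_def a_def]]
      have "a x 1 = 0" using zero(1) m by (simp add: m_def)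
      then show ?thesis unfolding neumann_profile_def
        using prof[OF x] nonneg zero(2) by (auto simp: a_def)
    qed
    have m_d: "m d < 0"
    proof -
      obtain r where "r \<in> {0..1}" "a d r < 0"
        using over[OF q0 prof[of d]] d by (auto simp: a_def)
      then show ?thesis using \<rho>(2)[of d r] d by (simp add: m_def)
    qed
    have m_14: "0 < m (1/4)"
      using radial_profile.U_le_1_small_start[OF prof[of "1/4"]] by (intro m_pos) auto
    define e where "e = 1 / (p - 1)"
    have e: "1 < e" using p by (simp add: e_def divide_simps)
    \<comment> \<open>Solving \<open>(L * \<epsilon>) powr e \<le> \<epsilon>\<close> for
      \<open>\<epsilon>\<close>, with \<open>e > 1\<close>, gives the second bound; the first keeps
      \<open>1 - \<epsilon>\<close> above \<open>d\<close>.\<close>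
    define \<epsilon> where "\<epsilon> = min ((1 - d) / 2) (L powr (- e / (e - 1)))"
    have \<epsilon>: "0 < \<epsilon>" "\<epsilon> \<le> (1 - d) / 2" "\<epsilon> \<le> L powr (- e / (e - 1))"
      unfolding \<epsilon>_def by (use d L in simp) (rule min.cobounded1 min.cobounded2)+
    have "(L * \<epsilon>) powr e \<le> \<epsilon>"
    proof -
      have "\<epsilon> powr (e - 1) \<le> (L powr (- e / (e - 1))) powr (e - 1)"
        using \<epsilon> e by (intro powr_mono2) auto
      also have "\<dots> = L powr (- e)" using e by (simp add: powr_powr)
      finally have "L powr e * \<epsilon> powr (e - 1) \<le> L powr e * L powr (- e)" by (intro mult_left_mono) auto
      also have "\<dots> = 1" using L by (simp add: powr_add[symmetric])
      finally have "L powr e * \<epsilon> powr (e - 1) * \<epsilon> \<le> 1 * \<epsilon>" using \<epsilon> by (intro mult_right_mono) auto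
      moreover have "\<epsilon> powr (e - 1) * \<epsilon> = \<epsilon> powr e"
        using \<epsilon> powr_add[of \<epsilon> "e - 1" 1] by simp
      ultimately show ?thesis using \<epsilon> L by (simp add: powr_mult mult.assoc)
    qed
    then have m_\<epsilon>: "0 < m (1 - \<epsilon>)"
      using radial_profile.U_le_1_near_1[OF prof[of "1 - \<epsilon>"] L(2)] \<epsilon> d L
      by (intro m_pos) (auto simp: e_def)
    have cont: "continuous_on {1/4..d} m" "continuous_on {d..1 - \<epsilon>} m"
      using d \<epsilon> by (intro m_cont, auto)+
    obtain d1 where d1: "1/4 \<le> d1" "d1 \<le> d" "m d1 = 0"
      using IVT2'[of m d 0 "1/4"] m_d m_14 d cont by auto
    obtain d2 where d2: "d \<le> d2" "d2 \<le> 1 - \<epsilon>" "m d2 = 0"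
      using IVT'[of m d 0 "1 - \<epsilon>"] m_d m_\<epsilon> d \<epsilon> cont by auto
    have "d1 < d2" using d1 d2 m_d by (cases "d1 = d") auto
    moreover have "neumann_profile p q N d1 (U d1)" "neumann_profile p q N d2 (U d2)"
      using d1 d2 d \<epsilon> by (auto intro!: sol)
    ultimately show ?thesis by blast
  qed
  then show ?thesis using d(3) by blast
qed

section \<open>From profiles to weak solutions\<close>

text \<open>Integrability is given only on compact subsets, so measurability is obtained from
  pointwise limits of restrictions to exhausting closed balls.\<close>

lemma weak_gradient_measurable:
  fixes u :: "'a::euclidean_space \<Rightarrow> real"
  assumes g: "is_weak_gradient u g"
  shows "g \<in> borel_measurable ball_leb"
proof (rule borel_measurable_LIMSEQ_metric)
  let ?K = "\<lambda>n. cball (0::'a) (1 - 1 / real (n + 2))"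
  show "(\<lambda>x. indicator (?K n) x *\<^sub>R g x) \<in> borel_measurable ball_leb" for n
  proof (rule measurable_restrict_space1)
    have "?K n \<subseteq> ball 0 1" by (auto elim!: le_less_trans)
    then have "g absolutely_integrable_on ?K n"
      by (intro weak_gradient_absolutely_integrable[OF g]) auto
    then show "(\<lambda>x. indicator (?K n) x *\<^sub>R g x) \<in> borel_measurable lebesgue"
      unfolding set_integrable_def by (rule borel_measurable_integrable)
  qed
  fix x :: 'a assume "x \<in> space ball_leb"
  then have "norm x < 1" by simp
  moreover have "(\<lambda>n. 1 - 1 / real (n + 2)) \<longlonglongrightarrow> 1 - 0"
    by (intro tendsto_intros LIMSEQ_ignore_initial_segment[OF lim_1_over_n])
  ultimately have "\<forall>\<^sub>F n in sequentially. norm x < 1 - 1 / real (n + 2)"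
    by (intro order_tendstoD) auto
  then have "\<forall>\<^sub>F n in sequentially. indicator (?K n) x *\<^sub>R g x = g x"
    by eventually_elim auto
  then show "(\<lambda>n. indicator (?K n) x *\<^sub>R g x) \<longlonglongrightarrow> g x" by (rule tendsto_eventually)
qed

lemma finite_measure_ball_leb: "finite_measure (ball_leb :: 'a::euclidean_space measure)"
  by (rule finite_measure_lebesgue_on) simp

text \<open>The ball has finite measure and
  \<open>norm (f x) \<le> 1 + norm (f x) powr p\<close>.\<close>

lemma integrable_ball_leb_if_powr:
  fixes f :: "'a::euclidean_space \<Rightarrow> 'b::euclidean_space"
  assumes p: "1 \<le> p" and f: "f \<in> borel_measurable ball_leb" "integrable ball_leb (\<lambda>x. norm (f x) powr p)"
  shows "integrable ball_leb f"
proof (rule Bochner_Integration.integrable_bound[OF _ f(1)])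
  show "integrable ball_leb (\<lambda>x. 1 + norm (f x) powr p)"
    by (intro Bochner_Integration.integrable_add f(2) finite_measure.integrable_const finite_measure_ball_leb)
  show "AE x in ball_leb. norm (f x) \<le> norm (1 + norm (f x) powr p)"
  proof (rule AE_I2)
    fix x
    have "norm (f x) \<le> 1 + norm (f x) powr p"
    proof (cases "norm (f x) \<le> 1")
      case False
      then have "norm (f x) powr 1 \<le> norm (f x) powr p" using p by (intro powr_mono) auto
      then show ?thesis by simp
    qed (simp add: add_increasing2)
    then show "norm (f x) \<le> norm (1 + norm (f x) powr p)" by simp
  qed
qed

text \<open>Membership in \<open>W1p\<close> bounds the \<open>p\<close>-th power of some weak
  gradient; uniqueness almost everywhere carries integrability over to the chosen
  \<open>wgrad\<close>.\<close>

lemma W1p_integrable: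
  assumes "1 \<le> p" "\<phi> \<in> W1p p"
  shows "integrable ball_leb \<phi>" "integrable ball_leb (wgrad \<phi>)"
proof -
  from assms(2) obtain g where g: "is_weak_gradient \<phi> g" "integrable ball_leb (\<lambda>x. norm (g x) powr p)"
    and \<phi>: "\<phi> \<in> borel_measurable ball_leb" "integrable ball_leb (\<lambda>x. \<bar>\<phi> x\<bar> powr p)"
    by (auto simp: W1p_def)
  show "integrable ball_leb \<phi>" using integrable_ball_leb_if_powr[OF assms(1) \<phi>(1)] \<phi>(2) by simp
  note w = wgrad_is_weak_gradient[OF assms(2)]
  have "integrable ball_leb g"
    by (rule integrable_ball_leb_if_powr[OF assms(1) weak_gradient_measurable[OF g(1)] g(2)])
  then show "integrable ball_leb (wgrad \<phi>)"
    using integrable_cong_AE[OF weak_gradient_measurable[OF w] weak_gradient_measurable[OF g(1)]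
        weak_gradient_AE_unique[OF w g(1)]] by simp
qed

lemma integrable_ball_leb_bounded:
  fixes f :: "'a::euclidean_space \<Rightarrow> real"
  assumes "f \<in> borel_measurable ball_leb" "\<And>x. x \<in> ball 0 1 \<Longrightarrow> \<bar>f x\<bar> \<le> B"
  shows "integrable ball_leb f"
proof -
  have "integrable ball_leb (\<lambda>x. 1 * f x)"
    by (rule integrable_bounded_mult[OF finite_measure.integrable_const[OF finite_measure_ball_leb] assms(1), where B=B])
       (use assms(2) in simp)
  then show ?thesis by simp
qed

text \<open>The field \<open>norm (g x) powr (p - 2) *\<^sub>R g x\<close> of the gradient
  \<open>g\<close> equals \<open>a (norm x) *\<^sub>R x\<close>, with divergence
  \<open>f (norm x)\<close>, and vanishes on the sphere. Freezing the profile at its boundary value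
  outside the ball makes \<open>u\<close> globally Lipschitz.\<close>

lemma neumann_profile_solution:
  fixes u :: "'a::euclidean_space \<Rightarrow> real"
  assumes prof: "neumann_profile p q DIM('a) d U"
    and u_def: "u = (\<lambda>x. U (min 1 (norm x)))"
  shows "u \<in> rad_cone p" "solves_P p q u" "nonconstant u" "u 0 = d"
proof -
  let ?N = "DIM('a)"
  interpret radial_profile p q d ?N U using prof by (simp add: neumann_profile_def)
  have a_nonneg: "0 \<le> a r" if "r \<in> {0..1}" for r using prof that by (simp add: neumann_profile_def)
  have a_1: "a 1 = 0" and U_1: "1 < U 1" using prof by (auto simp: neumann_profile_def)
  have U_bounds: "1/4 \<le> U r" "U r \<le> 2" if "r \<in> {0..1}" for r
    using U_range[OF that] d that by auto
  have f_eq: "f r = U r powr (p - 1) - U r powr (q - 1)" if "r \<in> {0..1}" for r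
    using U_bounds[OF that] by (simp add: f_def nlin_clip_def nlin_def)
  have u_bounds: "1/4 \<le> u x" "u x \<le> 2" for x using U_bounds[of "min 1 (norm x)"] by (auto simp: u_def)
  have u_lip: "1-lipschitz_on UNIV u"
  proof (rule lipschitz_onI)
    fix x y :: 'a
    have U: "\<bar>U s - U r\<bar> \<le> \<bar>s - r\<bar>" if "s \<in> {0..1}" "r \<in> {0..1}" for r s
      using U_lipschitz[of r s] U_lipschitz[of s r] U_mono[of r s] U_mono[of s r] that
      by (cases r s rule: linorder_cases) auto
    have "\<bar>u x - u y\<bar> \<le> \<bar>min 1 (norm x) - min 1 (norm y)\<bar>" unfolding u_def by (rule U) auto
    also have "\<dots> \<le> \<bar>norm x - norm y\<bar>" by auto
    also have "\<dots> \<le> norm (x - y)" by (rule norm_triangle_ineq3)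
    finally show "dist (u x) (u y) \<le> 1 * dist x y" by (simp add: dist_real_def dist_norm)
  qed simp
  have u_cont: "continuous_on A u" for A
    using lipschitz_on_continuous_on[OF u_lip] continuous_on_subset by blast
  \<comment> \<open>This is \<open>1 / (p - 1) - 1\<close>, so that
    \<open>g = norm V powr e *\<^sub>R V\<close> inverts
    \<open>V = norm g powr (p - 2) *\<^sub>R g\<close>.\<close>
  define e where "e = (2 - p) / (p - 1)"
  have e: "0 < e" "1 / (p - 1) = e + 1" "(e + 1) * (p - 2) + e = 0"
    using p by (auto simp: e_def field_simps)
  define V where "V x = a (norm x) *\<^sub>R x" for x :: 'a
  define g where "g x = norm (V x) powr e *\<^sub>R V x" for x
  have norm_V: "norm (V x) = norm x * a (norm x)" "norm (V x) \<le> 1" if "x \<in> ball 0 1" for x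
  proof -
    have "norm x \<in> {0..1}" using that by simp
    then show "norm (V x) = norm x * a (norm x)" "norm (V x) \<le> 1"
      using a_nonneg a_le_1 by (auto simp: V_def mult.commute intro: mult_le_one)
  qed
  have a_norm_cont: "continuous_on (ball 0 1) (\<lambda>x::'a. a (norm x))"
    by (rule continuous_on_compose2[OF a_cont]) (auto intro!: continuous_intros)
  have V_cont: "continuous_on (ball 0 1) V"
    unfolding V_def by (intro continuous_intros a_norm_cont)
  have g_cont: "continuous_on (ball 0 1) g"
    unfolding g_def using e(1) by (intro continuous_intros continuous_on_powr' V_cont) auto
  have norm_g: "norm (g x) = norm (V x) powr (e + 1)" for x by (simp add: g_def powr_add)
  \<comment> \<open>The exponents cancel by the third identity for \<open>e\<close>. Where
    \<open>V\<close> vanishes, so does \<open>g\<close>, in accordance with reading the field as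
    \<open>0\<close> at critical points.\<close>
  have g_powr: "norm (g x) powr (p - 2) *\<^sub>R g x = V x" for x
  proof (cases "V x = 0")
    case False
    have "norm (g x) powr (p - 2) *\<^sub>R g x = (norm (V x) powr ((e + 1) * (p - 2)) * norm (V x) powr e) *\<^sub>R V x"
      unfolding norm_g powr_powr by (simp add: g_def)
    also have "\<dots> = V x" using False e(3) by (simp add: powr_add[symmetric])
    finally show ?thesis .
  qed (simp add: g_def)
  have u_deriv: "(u has_derivative (\<lambda>y. g x \<bullet> y)) (at x)" if x: "x \<in> ball 0 1" "x \<noteq> 0" for x
  proof -
    let ?r = "norm x"
    have r: "0 < ?r" "?r < 1" using x by auto
    have flux: "flux_inv p (?r * a ?r) = (?r * a ?r) powr e * (?r * a ?r)"
      using norm_V[OF x(1)] a_nonneg[of ?r] r e(2)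
      by (subst flux_inv_eq) (auto simp: powr_add intro: mult_le_one a_le_1)
    have "(U has_real_derivative flux_inv p (?r * a ?r)) (at ?r)"
      using U_deriv[of ?r] r by (simp add: at_within_Icc_at)
    moreover have "(norm has_derivative (\<lambda>y. y \<bullet> sgn x)) (at x)"
      using has_derivative_norm[OF x(2)] .
    ultimately have "((\<lambda>x. U (norm x)) has_derivative (\<lambda>y. flux_inv p (?r * a ?r) * (y \<bullet> sgn x))) (at x)"
      using has_derivative_compose[of norm "\<lambda>y. y \<bullet> sgn x" x UNIV U] by (simp add: has_field_derivative_def)
    then have "(u has_derivative (\<lambda>y. flux_inv p (?r * a ?r) * (y \<bullet> sgn x))) (at x)"
      by (rule has_derivative_transform_within_open[where s="ball 0 1"]) (use x in \<open>auto simp: u_def\<close>)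
    moreover have "flux_inv p (?r * a ?r) * (y \<bullet> sgn x) = g x \<bullet> y" for y
      using r unfolding flux g_def norm_V(1)[OF x(1)]
      by (simp add: V_def sgn_div_norm inner_commute)
    ultimately show ?thesis by simp
  qed
  have wg: "is_weak_gradient u g"
  proof (rule lipschitz_is_weak_gradient[OF u_lip _ u_deriv g_cont])
    show "\<bar>u x\<bar> \<le> 2" for x using u_bounds[of x] by simp
  qed
  have u_meas: "u \<in> borel_measurable ball_leb" by (intro ball_leb_continuous_measurable u_cont)
  have upow_cont: "continuous_on A (\<lambda>x. u x powr c)" for A c
    using u_bounds(1) by (intro continuous_on_powr continuous_intros u_cont) (metis not_numeral_le_zero divide_le_0_1_iff)
  have upow_meas: "(\<lambda>x. u x powr c) \<in> borel_measurable ball_leb" for c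
    by (intro ball_leb_continuous_measurable upow_cont)
  have upow_bound: "\<bar>u x powr c\<bar> \<le> 2 powr c" if "0 \<le> c" for x c
    using u_bounds[of x] that by (auto intro: powr_mono2)
  have g_bound: "norm (g x) powr p \<le> 1" if "x \<in> ball 0 1" for x
  proof -
    have "norm (g x) \<le> 1" unfolding norm_g using norm_V(2)[OF that] e by (intro powr_le1) auto
    then show ?thesis using p by (intro powr_le1) auto
  qed
  have "integrable ball_leb (\<lambda>x. norm (g x) powr p)"
    using p g_bound
    by (intro integrable_ball_leb_bounded[where B=1] ball_leb_continuous_measurable continuous_on_powr'
        continuous_intros g_cont) auto
  moreover have "integrable ball_leb (\<lambda>x. \<bar>u x\<bar> powr p)"
  proof -
    have "\<bar>u x\<bar> = u x" for x using u_bounds(1)[of x] by simp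
    then show ?thesis using integrable_ball_leb_bounded[OF upow_meas upow_bound[of p]] p by simp
  qed
  ultimately have u_W1p: "u \<in> W1p p" using u_meas wg by (auto simp: W1p_def)
  show "u 0 = d" using U_0 by (simp add: u_def)
  show "u \<in> rad_cone p"
    unfolding rad_cone_def W1p_rad_def
  proof (intro CollectI conjI ballI allI impI exI)
    show "continuous_on {0<..1} U" by (rule continuous_on_subset[OF U_cont]) auto
    show "u x = U (norm x)" if "x \<in> cball 0 1 - {0}" for x using that by (simp add: u_def)
    show "0 \<le> u x" for x using u_bounds(1)[of x] by simp
    show "u x \<le> u y" if "0 < norm x \<and> norm x \<le> norm y \<and> norm y \<le> 1" for x y
      using that U_mono[of "norm x" "norm y"] by (simp add: u_def)
    show "(u \<longlongrightarrow> u 0) (at 0)" using u_cont[of UNIV] by (simp add: continuous_on_def)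
  qed (rule u_W1p)
  show "nonconstant u"
    unfolding nonconstant_def
  proof
    assume "\<exists>c. \<forall>x\<in>ball 0 1. u x = c"
    then obtain c where c: "\<And>x. x \<in> ball 0 1 \<Longrightarrow> u x = c" by blast
    \<comment> \<open>The boundary is not in the open ball, so a radius strictly inside is needed.
      Since \<open>U\<close> is 1-Lipschitz, stepping back by half of \<open>U 1 - d\<close> keeps
      \<open>U r\<close> above \<open>d\<close>.\<close>
    define r where "r = 1 - (U 1 - d) / 2"
    have r: "0 \<le> r" "r < 1" using U_range[of 1] U_1 d by (auto simp: r_def)
    obtain b :: 'a where b: "b \<in> Basis" using nonempty_Basis by blast
    have "U r = c" using c[of "r *\<^sub>R b"] r b by (simp add: u_def)
    moreover have "d = c" using c[of 0] U_0 by (simp add: u_def)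
    ultimately show False using U_lipschitz[of r 1] r U_1 d by (simp add: r_def)
  qed
  show "solves_P p q u"
    unfolding solves_P_def
  proof (intro conjI ballI u_W1p)
    show "0 < u x" for x using u_bounds(1)[of x] by simp
    fix \<phi> :: "'a \<Rightarrow> real" assume \<phi>: "\<phi> \<in> W1p p"
    have p1: "1 \<le> p" using p by simp
    note \<phi>_int = W1p_integrable[OF p1 \<phi>]
    note wu = wgrad_is_weak_gradient[OF u_W1p] and w\<phi> = wgrad_is_weak_gradient[OF \<phi>]
    have u\<phi>: "integrable ball_leb (\<lambda>x. u x powr c * \<phi> x)" if "0 \<le> c" for c
      using integrable_bounded_mult[OF \<phi>_int(1) upow_meas upow_bound[OF that]] by (simp add: mult.commute)
    show "integrable ball_leb (\<lambda>x. u x powr (q - 1) * \<phi> x)" using q by (intro u\<phi>) simp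
    have V\<phi>: "integrable ball_leb (\<lambda>x. (x \<bullet> wgrad \<phi> x) * a (norm x))"
    proof (rule integrable_bounded_mult[OF integrable_inner_id[OF \<phi>_int(2)]])
      show "\<bar>a (norm x)\<bar> \<le> 1" if "x \<in> space ball_leb" for x :: 'a
        using that a_nonneg[of "norm x"] a_le_1[of "norm x"] by simp
    qed (rule ball_leb_continuous_measurable[OF a_norm_cont])
    \<comment> \<open>The chosen gradient of \<open>u\<close> is replaced by the explicit
      \<open>g\<close>, up to a null set.\<close>
    have "AE x in ball_leb. norm (wgrad u x) powr (p - 2) * (wgrad u x \<bullet> wgrad \<phi> x) + u x powr (p - 1) * \<phi> x
        = (x \<bullet> wgrad \<phi> x) * a (norm x) + u x powr (p - 1) * \<phi> x"
      using weak_gradient_AE_unique[OF wu wg]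
    proof eventually_elim
      case (elim x)
      have "norm (g x) powr (p - 2) * (g x \<bullet> wgrad \<phi> x) = V x \<bullet> wgrad \<phi> x"
        using g_powr[of x] by (metis inner_scaleR_left)
      then show ?case by (simp add: elim V_def mult.commute)
    qed
    then have "(LINT x|ball_leb. norm (wgrad u x) powr (p - 2) * (wgrad u x \<bullet> wgrad \<phi> x) + u x powr (p - 1) * \<phi> x)
        = (LINT x|ball_leb. (x \<bullet> wgrad \<phi> x) * a (norm x) + u x powr (p - 1) * \<phi> x)"
    proof (rule integral_cong_AE[rotated 2])
      have [measurable]: "wgrad u \<in> borel_measurable ball_leb" "wgrad \<phi> \<in> borel_measurable ball_leb"
        "\<phi> \<in> borel_measurable ball_leb" "u \<in> borel_measurable ball_leb"
        using weak_gradient_measurable wu w\<phi> \<phi>_int u_meas by auto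
      show "(\<lambda>x. norm (wgrad u x) powr (p - 2) * (wgrad u x \<bullet> wgrad \<phi> x) + u x powr (p - 1) * \<phi> x)
          \<in> borel_measurable ball_leb"
        by measurable
      show "(\<lambda>x. (x \<bullet> wgrad \<phi> x) * a (norm x) + u x powr (p - 1) * \<phi> x) \<in> borel_measurable ball_leb"
        using V\<phi> u\<phi>[of "p - 1"] p by (intro borel_measurable_integrable Bochner_Integration.integrable_add) auto
    qed
    also have "\<dots> = (LINT x|ball_leb. (x \<bullet> wgrad \<phi> x) * a (norm x)) + (LINT x|ball_leb. u x powr (p - 1) * \<phi> x)"
      using V\<phi> u\<phi>[of "p - 1"] p by (intro Bochner_Integration.integral_add) auto
    \<comment> \<open>The Neumann condition enters here: \<open>a 1 = 0\<close> is the hypothesis on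
      \<open>H\<close> in \<open>radial_flux_identity\<close>, so no boundary term arises for an
      arbitrary test in \<open>W1p\<close>.\<close>
    also have "(LINT x|ball_leb. (x \<bullet> wgrad \<phi> x) * a (norm x)) = - (LINT x|ball_leb. \<phi> x * f (norm x))"
      using radial_flux_identity[OF w\<phi> \<phi>_int f_cont] a_1 by (simp add: a_def)
    also have "(LINT x|ball_leb. \<phi> x * f (norm x))
        = (LINT x|ball_leb. u x powr (p - 1) * \<phi> x - u x powr (q - 1) * \<phi> x)"
      by (intro Bochner_Integration.integral_cong refl)
         (simp add: f_eq u_def algebra_simps min_absorb2)
    also have "\<dots> = (LINT x|ball_leb. u x powr (p - 1) * \<phi> x) - (LINT x|ball_leb. u x powr (q - 1) * \<phi> x)"
      using u\<phi>[of "p - 1"] u\<phi>[of "q - 1"] p q by (intro Bochner_Integration.integral_diff) auto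
    finally show "(LINT x|ball_leb. norm (wgrad u x) powr (p - 2) * (wgrad u x \<bullet> wgrad \<phi> x) + u x powr (p - 1) * \<phi> x)
        = (LINT x|ball_leb. u x powr (q - 1) * \<phi> x)" by simp
  qed
qed

theorem theorem1p3:
  fixes p l C :: real
    and u :: "real \<Rightarrow> 'a::euclidean_space \<Rightarrow> real"
    and G :: "'a \<Rightarrow> real"
  assumes p: "1 < p" "p < 2"
    and l: "p < l" "ereal l < p_star DIM('a) p"
    and C: "\<And>w :: 'a \<Rightarrow> real. w \<in> rad_cone p \<Longrightarrow> Linf_norm w \<le> ereal (C * W1p_norm p w)"
    and u_sol: "\<forall>\<^sub>F q in at_top. u q \<in> rad_cone p \<and> solves_P p q (u q) \<and> nonconstant (u q)"
    and u_min: "\<forall>\<^sub>F q in at_top. ereal (energy p l C q (u q)) = 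
        (INF w\<in>(nehari p l C q :: ('a \<Rightarrow> real) set). ereal (energy p l C q w))"
    and u_less: "\<forall>\<^sub>F q in at_top. energy p l C q (u q) < energy p l C q (\<lambda>x :: 'a. 1)"
    and G: "solves_Dirichlet p G"
    and u_lim_W1p: "((\<lambda>q. W1p_norm p (\<lambda>x. u q x - G x)) \<longlongrightarrow> 0) at_top"
    and u_lim_holder: "\<And>\<alpha>. 0 < \<alpha> \<Longrightarrow> \<alpha> < 1 \<Longrightarrow>
      holder_norm \<alpha> G < \<infinity> \<and> ((\<lambda>q. holder_norm \<alpha> (\<lambda>x. u q x - G x)) \<longlongrightarrow> 0) at_top"
  shows "\<forall>\<^sub>F q in at_top. \<exists>v. v \<in> rad_cone p \<and> solves_P p q v \<and> nonconstant v \<and>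
           (\<exists>x\<in>ball 0 1. v x \<noteq> u q x)"
proof -
  obtain q0 where q0: "\<And>q. q0 < q \<Longrightarrow> \<exists>d1 d2 U1 U2. d1 < d2 \<and>
      neumann_profile p q DIM('a) d1 U1 \<and> neumann_profile p q DIM('a) d2 U2"
    using two_neumann_profiles[OF p, of "DIM('a)"] by auto
  show ?thesis
    using eventually_gt_at_top[of q0]
  proof eventually_elim
    case (elim q)
    obtain d1 d2 U1 U2 where d: "d1 < d2"
      and prof: "neumann_profile p q DIM('a) d1 U1" "neumann_profile p q DIM('a) d2 U2"
      using q0[OF elim] by blast
    note v1 = neumann_profile_solution[OF prof(1) refl] and v2 = neumann_profile_solution[OF prof(2) refl]
    \<comment> \<open>The origin lies in the open ball, so comparing values there provides the point
      where the chosen solution differs from \<open>u q\<close>.\<close>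
    show ?case
    proof (cases "u q 0 = d1")
      case True
      then show ?thesis
        using v2 d by (intro exI[of _ "\<lambda>x. U2 (min 1 (norm x))"] conjI bexI[of _ 0]) auto
    next
      case False
      then show ?thesis
        using v1 by (intro exI[of _ "\<lambda>x. U1 (min 1 (norm x))"] conjI bexI[of _ 0]) auto
    qed
  qed
qed

end
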